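(* Let $n\ge 2$ and let $\Omega\subset\mathbb{R}^n_+$ be a domain as described in the context, with constants $0<m<M<+\infty$, $m=\inf_{(x,y)\in\Omega}y$, $M=\sup_{(x,y)\in\Omega}y$. Let $\mathcal{D}_H=\sum_{i=1}^{n-1}e_iy\partial_{x_i}-\alpha_ne_n+e_ny\partial_y$ be the Dirac operator on the hyperbolic space, where $\alpha_n=\frac{n-1}{2}$ and $\beta_n=\alpha_n+\alpha_n^2$. Let $s\in\mathbb{R}^{n+1}$ be such that $|s|^2-\beta_n\ne0$, $$\big||s|^2-\beta_n\big|-\alpha_n\sqrt{1+4s_0^2}+m^2>0$$ and $$4m^2\big||s|^2-\beta_n\big|-4nM^2s_0^2-4\Big(m^2\alpha_n+M^2(1+\alpha_n)\sqrt n\Big)\sqrt{1+4s_0^2}>M^2\Big(4(1+\alpha_n)^2+n\Big).$$ Then for every $f\in L^2(\Omega,\mathbb{R}_n)$ the right $S$-resolvent operator $S_R^{-1}(s,\mathcal{D}_H)f:=(\overline s-\mathcal{D}_H)Q_s(\mathcal{D}_H)^{-1}f$ satisfies $$\|S_R^{-1}(s,\mathcal{D}_H)f\|_2\le\Big(|s|+\alpha_n+M\sqrt n\Big)\frac{1}{K_{n,m,M}(s)}\|f\|_2,$$ where $$K_{n,m,M}(s)=\tfrac12\big||s|^2-\beta_n\big|-\tfrac12\alpha_n\sqrt{1+4s_0^2}+\tfrac12m^2-\tfrac12\sqrt{\Big(\big||s|^2-\beta_n\big|-\alpha_n\sqrt{1+4s_0^2}-m^2\Big)^2+M^2\Big(2(1+\alpha_n)+\sqrt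 n\sqrt{1+4s_0^2}\Big)^2}.$$
   Context: $\mathbb{R}_n$ is the real Clifford algebra generated by $e_1,\dots,e_n$ with $e_i^2=-1$, $e_ie_j=-e_je_i$ for $i\ne j$, with basis $e_A=e_{i_1}\cdots e_{i_r}$, $A=(i_1<\dots<i_r)$, $e_\emptyset=1$. For $x=\sum_Ax_Ae_A$: $\mathrm{Sc}(x)=x_\emptyset$, conjugation is $\overline x=\sum_Ax_A\overline{e_A}$ with $\overline{e_A}=\overline{e_{i_r}}\cdots\overline{e_{i_1}}$, $\overline{e_i}=-e_i$, and $|x|=(\sum_A|x_A|^2)^{1/2}$. $\mathbb{R}^{n+1}$ is identified with the paravectors $s=s_0+s_1e_1+\dots+s_ne_n$, $s_i\in\mathbb{R}$. $\mathbb{R}^n_+=\{(x,y): x=(x_1,\dots,x_{n-1})\in\mathbb{R}^{n-1},\ y>0\}$. $\Omega\subset\mathbb{R}^n_+$ is an open set with smooth boundary, bounded or unbounded (for example the strip $\{0<a<y<b\}$), such that $\inf_\Omega y=m$ and $\sup_\Omega y=M$ with $0<m<M<+\infty$. Functions take values in $\mathbb{R}_n$; $L^2(\Omega,\mathbb{R}_n)=L^2(\Omega,\mathbb{R})\otimes\mathbb{R}_n$ and $H^1_0(\Omega,\mathbb{R}_n)=H^1_0(\Omega,\mathbb{R})\otimes\mathbb{R}_n$ (Lebesgue measure), conjugation and derivatives being applied pointwise/componentwise. $\langle F,G\rangle_2=\int_\Omega\overline FG\,dx\in\mathbb{R}_n$, $\|F\|_2^2=\mathrm{Sc}\langle F,F\rangle_2$.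 Clifford numbers act on functions by left multiplication. The sesquilinear form on $H^1_0(\Omega,\mathbb{R}_n)\times H^1_0(\Omega,\mathbb{R}_n)$ is $$q_s(F,G)=\sum_{i=1}^{n-1}\langle y^2\partial_{x_i}F,\partial_{x_i}G\rangle_2+\langle y^2\partial_yF,\partial_yG\rangle_2+2(1+\alpha_n)\langle y\partial_yF,G\rangle_2+\langle(e_n-2s_0)\mathcal{D}_HF,G\rangle_2+\langle(|s|^2-\beta_n)F,G\rangle_2.$$ It is the weak form of the Dirichlet problem for $Q_s(\mathcal{D}_H)=\mathcal{D}_H^2-2s_0\mathcal{D}_H+|s|^2$. Under the stated conditions on $s$, for every $f\in L^2(\Omega,\mathbb{R}_n)$ there is a unique $F_f\in H^1_0(\Omega,\mathbb{R}_n)$ with $q_s(F_f,G)=\langle f,G\rangle_2$ for all $G\in H^1_0(\Omega,\mathbb{R}_n)$, and $Q_s(\mathcal{D}_H)^{-1}f$ denotes this weak solution $F_f$. *)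

theory Defs
  imports "HOL-Analysis.Analysis"
begin

section \<open>The real Clifford algebra\<close>

text \<open>
  The index type \<open>'n\<close> plays the role of \<open>{1, \<dots>, n}\<close>, with \<open>n = CARD('n)\<close>. An element
  \<open>x = \<Sum>\<^sub>A x\<^sub>A e\<^sub>A\<close> is the family of its coordinates \<open>x $ A\<close>, where \<open>A\<close> ranges over
  the subsets of the index type; the library norm on this type is
  \<open>|x| = (\<Sum>\<^sub>A x\<^sub>A\<^sup>2)\<^sup>1\<^sup>/\<^sup>2\<close>.
\<close>

type_synonym 'n cliff = "real ^ 'n set"
type_synonym 'n pt = "(real, 'n) vec"

definition basis_e :: "'n::finite set \<Rightarrow> 'n cliff" where
  "basis_e A = axis A 1"

abbreviation cliff_one :: "'n::finite cliff" where
  "cliff_one \<equiv> basis_e {}"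

abbreviation gen_e :: "'n::finite \<Rightarrow> 'n cliff" where
  "gen_e i \<equiv> basis_e {i}"

text \<open>
  Multiplication table \<open>e\<^sub>A e\<^sub>B = \<plusminus> e\<^sub>C\<close> with \<open>C\<close> the symmetric difference. Sorting the
  word \<open>e\<^sub>A e\<^sub>B\<close> costs one sign for every pair \<open>(i, j) \<in> A \<times> B\<close> with \<open>j < i\<close>, and every common
  index contributes one more sign because \<open>e\<^sub>i\<^sup>2 = -1\<close>. The lemmas below show that
  this is an associative unital algebra in which the defining relations hold and in which
  \<open>e\<^sub>A\<close> is the increasing product of generators.
\<close>

definition cliff_sgn :: "'n::{finite,linorder} set \<Rightarrow> 'n set \<Rightarrow> real" where
  "cliff_sgn A B = (-1) ^ card {(i, j) \<in> A \<times> B. j \<le> i}"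

definition cliff_mult :: "'n::{finite,linorder} cliff \<Rightarrow> 'n cliff \<Rightarrow> 'n cliff"
    (infixl "\<odot>" 70) where
  "x \<odot> y = (\<Sum>A\<in>UNIV. \<Sum>B\<in>UNIV. (cliff_sgn A B * x $ A * y $ B) *\<^sub>R basis_e (sym_diff A B))"

definition Sc :: "'n::finite cliff \<Rightarrow> real" where
  "Sc x = x $ {}"

text \<open>\<open>conj_e {i\<^sub>1 < \<dots> < i\<^sub>r}\<close> is \<open>(-e\<^bsub>i\<^sub>r\<^esub>) \<cdots> (-e\<^bsub>i\<^sub>1\<^esub>)\<close>.\<close>

definition conj_e :: "'n::{finite,linorder} set \<Rightarrow> 'n cliff" where
  "conj_e A = foldr (\<lambda>i p. (- gen_e i) \<odot> p) (rev (sorted_list_of_set A)) cliff_one"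

definition cliff_conj :: "'n::{finite,linorder} cliff \<Rightarrow> 'n cliff" where
  "cliff_conj x = (\<Sum>A\<in>UNIV. x $ A *\<^sub>R conj_e A)"

definition paravectors :: "'n::finite cliff set" where
  "paravectors = {s. \<exists>(s0::real) (v :: 'n \<Rightarrow> real). s = s0 *\<^sub>R cliff_one + (\<Sum>i\<in>UNIV. v i *\<^sub>R gen_e i)}"

lemma cliff_sgn_prod:
  "cliff_sgn A B = (\<Prod>i\<in>A. \<Prod>j\<in>B. if j \<le> i then -1 else 1)"
proof -
  have "(\<Prod>i\<in>A. \<Prod>j\<in>B. if j \<le> i then -1 else (1::real))
      = (\<Prod>p\<in>A\<times>B. if snd p \<le> fst p then -1 else 1)"
    by (simp add: prod.cartesian_product case_prod_beta)
  also have "\<dots> = (\<Prod>p\<in>{p\<in>A\<times>B. snd p \<le> fst p}. -1)"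
    by (subst prod.inter_filter[symmetric]) auto
  also have "\<dots> = (-1) ^ card {p\<in>A\<times>B. snd p \<le> fst p}" by simp
  also have "{p\<in>A\<times>B. snd p \<le> fst p} = {(i, j) \<in> A \<times> B. j \<le> i}" by auto
  finally show ?thesis by (simp add: cliff_sgn_def)
qed

lemma prod_sym_diff:
  fixes f :: "'a::finite \<Rightarrow> real"
  assumes "\<And>i. f i * f i = 1"
  shows "prod f (sym_diff A B) = prod f A * prod f B"
proof -
  have 1: "prod f (A \<inter> B) * prod f (A \<inter> B) = 1"
    by (simp add: assms flip: prod.distrib)
  have "prod f A = prod f (A - B) * prod f (A \<inter> B)"
    by (subst prod.union_disjoint[symmetric]) (auto intro: prod.cong)
  moreover have "prod f B = prod f (B - A) * prod f (A \<inter> B)"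
    by (subst prod.union_disjoint[symmetric]) (auto intro: prod.cong)
  moreover have "prod f (sym_diff A B) = prod f (A - B) * prod f (B - A)"
    by (subst prod.union_disjoint) auto
  ultimately show ?thesis using 1 by (simp add: algebra_simps)
qed

lemma cliff_sgn_sym_diff_left:
  "cliff_sgn (sym_diff A B) C = cliff_sgn A C * cliff_sgn B C"
  unfolding cliff_sgn_prod
  by (rule prod_sym_diff) (auto simp flip: prod.distrib intro!: prod.neutral)

lemma cliff_sgn_sym_diff_right:
  "cliff_sgn A (sym_diff B C) = cliff_sgn A B * cliff_sgn A C"
  unfolding cliff_sgn_prod
  by (subst prod_sym_diff) (auto simp: prod.distrib)

lemma cliff_mult_sum_left: "sum f S \<odot> y = (\<Sum>k\<in>S. f k \<odot> y)"
proof (induction S rule: infinite_finite_induct)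
  case (insert k S)
  have "(u + v) \<odot> y = u \<odot> y + v \<odot> y" for u v
    by (simp add: cliff_mult_def algebra_simps scaleR_add_left sum.distrib)
  with insert show ?case by simp
qed (simp_all add: cliff_mult_def)

lemma cliff_mult_sum_right: "y \<odot> sum f S = (\<Sum>k\<in>S. y \<odot> f k)"
proof (induction S rule: infinite_finite_induct)
  case (insert k S)
  have "y \<odot> (u + v) = y \<odot> u + y \<odot> v" for u v
    by (simp add: cliff_mult_def algebra_simps scaleR_add_left sum.distrib)
  with insert show ?case by simp
qed (simp_all add: cliff_mult_def)

lemma cliff_mult_scaleR_left: "(c *\<^sub>R x) \<odot> y = c *\<^sub>R (x \<odot> y)"
  by (simp add: cliff_mult_def scaleR_sum_right mult_ac)

lemma cliff_mult_scaleR_right: "x \<odot> (c *\<^sub>R y) = c *\<^sub>R (x \<odot> y)"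
  by (simp add: cliff_mult_def scaleR_sum_right mult_ac)

lemma basis_mult: "basis_e A \<odot> basis_e B = cliff_sgn A B *\<^sub>R basis_e (sym_diff A B)"
proof -
  have "basis_e A \<odot> basis_e B = (\<Sum>A'\<in>UNIV. \<Sum>B'\<in>UNIV. if A' = A then if B' = B
      then cliff_sgn A' B' *\<^sub>R basis_e (sym_diff A' B') else 0 else 0)"
    unfolding cliff_mult_def by (intro sum.cong) (auto simp: basis_e_def axis_def)
  also have "\<dots> = (\<Sum>A'\<in>UNIV. if A' = A then (\<Sum>B'\<in>UNIV. if B' = B
      then cliff_sgn A' B' *\<^sub>R basis_e (sym_diff A' B') else 0) else 0)"
    by (intro sum.cong) auto
  also have "\<dots> = cliff_sgn A B *\<^sub>R basis_e (sym_diff A B)" by simp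
  finally show ?thesis .
qed

lemma cliff_expand: "x = (\<Sum>A\<in>UNIV. x $ A *\<^sub>R basis_e A)" for x :: "'n::finite cliff"
proof -
  have "(\<Sum>A\<in>UNIV. x $ A *\<^sub>R basis_e A) $ B = x $ B" for B
    by (simp add: basis_e_def axis_def if_distrib cong: if_cong)
  then show ?thesis by (simp add: vec_eq_iff)
qed

lemma cliff_mult_assoc: "(x \<odot> y) \<odot> z = x \<odot> (y \<odot> z)"
proof -
  have sd: "sym_diff (sym_diff A B) C = sym_diff A (sym_diff B C)" for A B C :: "'a set" by auto
  have e: "(basis_e A \<odot> basis_e B) \<odot> basis_e C = basis_e A \<odot> (basis_e B \<odot> basis_e C)"
    for A B C :: "'a set"
    by (simp only: basis_mult cliff_mult_scaleR_left cliff_mult_scaleR_right scaleR_scaleR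
        cliff_sgn_sym_diff_left cliff_sgn_sym_diff_right sd mult_ac)
  show ?thesis
    apply (subst (1 2) cliff_expand[of x], subst (1 2) cliff_expand[of y],
        subst (1 2) cliff_expand[of z])
    apply (simp only: cliff_mult_sum_left cliff_mult_sum_right cliff_mult_scaleR_left
        cliff_mult_scaleR_right e)
    done
qed

lemma cliff_one_left: "cliff_one \<odot> x = x"
proof -
  have "cliff_one \<odot> (\<Sum>A\<in>UNIV. x $ A *\<^sub>R basis_e A) = (\<Sum>A\<in>UNIV. x $ A *\<^sub>R basis_e A)"
    by (simp add: cliff_mult_sum_right cliff_mult_scaleR_right basis_mult cliff_sgn_prod)
  then show ?thesis by (simp flip: cliff_expand)
qed

lemma cliff_one_right: "x \<odot> cliff_one = x"
proof -
  have "(\<Sum>A\<in>UNIV. x $ A *\<^sub>R basis_e A) \<odot> cliff_one = (\<Sum>A\<in>UNIV. x $ A *\<^sub>R basis_e A)"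
    by (simp add: cliff_mult_sum_left cliff_mult_scaleR_left basis_mult cliff_sgn_prod)
  then show ?thesis by (simp flip: cliff_expand)
qed

lemma gen_square: "gen_e i \<odot> gen_e i = - cliff_one"
  by (simp add: basis_mult cliff_sgn_prod)

lemma gen_anticommute: "i \<noteq> j \<Longrightarrow> gen_e i \<odot> gen_e j = - (gen_e j \<odot> gen_e i)"
  by (auto simp: basis_mult cliff_sgn_prod Un_commute)

lemma basis_e_eq_prod:
  "basis_e A = foldr (\<lambda>i p. gen_e i \<odot> p) (sorted_list_of_set A) cliff_one"
proof -
  have "sorted xs \<Longrightarrow> distinct xs \<Longrightarrow> foldr (\<lambda>i p. gen_e i \<odot> p) xs cliff_one = basis_e (set xs)"
    for xs :: "'a list"
  proof (induction xs)
    case (Cons i xs)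
    have "cliff_sgn {i} (set xs) = 1"
      using Cons.prems by (auto simp: cliff_sgn_prod intro!: prod.neutral)
    moreover have "sym_diff {i} (set xs) = insert i (set xs)"
      using Cons.prems by auto
    ultimately show ?case using Cons by (simp add: basis_mult)
  qed simp
  from this[of "sorted_list_of_set A"] show ?thesis by simp
qed


section \<open>Smooth functions and smooth boundaries\<close>

fun Ck_on :: "nat \<Rightarrow> ('a::euclidean_space \<Rightarrow> real) \<Rightarrow> 'a set \<Rightarrow> bool" where
  "Ck_on 0 f U \<longleftrightarrow> continuous_on U f"
| "Ck_on (Suc k) f U \<longleftrightarrow> (\<forall>x\<in>U. f differentiable (at x)) \<and>
     (\<forall>v. Ck_on k (\<lambda>x. frechet_derivative f (at x) v) U)"

definition smooth_on :: "('a::euclidean_space \<Rightarrow> real) \<Rightarrow> 'a set \<Rightarrow> bool" where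
  "smooth_on f U \<longleftrightarrow> open U \<and> (\<forall>k. Ck_on k f U)"

text \<open>Near each boundary point, the set is a sublevel set of a smooth function without
  critical points.\<close>

definition smooth_boundary :: "'a::euclidean_space set \<Rightarrow> bool" where
  "smooth_boundary \<Omega> \<longleftrightarrow> (\<forall>p\<in>frontier \<Omega>. \<exists>U \<rho>. p \<in> U \<and> smooth_on \<rho> U \<and>
     (\<forall>z\<in>U. frechet_derivative \<rho> (at z) \<noteq> (\<lambda>v. 0)) \<and> \<Omega> \<inter> U = {z\<in>U. \<rho> z < 0})"


section \<open>Function spaces\<close>

text \<open>Elements of the function spaces are represented by functions on the whole space; only
  their restriction to \<open>\<Omega>\<close>, up to null sets, matters.\<close>

definition L2 :: "'a::euclidean_space set \<Rightarrow> ('a \<Rightarrow> 'b::euclidean_space) set" where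
  "L2 \<Omega> = {f. f \<in> borel_measurable (lebesgue_on \<Omega>) \<and> integrable (lebesgue_on \<Omega>) (\<lambda>z. (norm (f z))\<^sup>2)}"

definition pderiv_i :: "'n::finite \<Rightarrow> ('n pt \<Rightarrow> real) \<Rightarrow> 'n pt \<Rightarrow> real" where
  "pderiv_i i \<phi> z = frechet_derivative \<phi> (at z) (axis i 1)"

definition test_functions :: "'n::finite pt set \<Rightarrow> ('n pt \<Rightarrow> real) set" where
  "test_functions \<Omega> = {\<phi>. smooth_on \<phi> UNIV \<and> compact (closure {z. \<phi> z \<noteq> 0}) \<and> closure {z. \<phi> z \<noteq> 0} \<subseteq> \<Omega>}"

definition is_weak_deriv ::
    "'n::finite pt set \<Rightarrow> 'n \<Rightarrow> ('n pt \<Rightarrow> real) \<Rightarrow> ('n pt \<Rightarrow> real) \<Rightarrow> bool" where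
  "is_weak_deriv \<Omega> i u g \<longleftrightarrow> (\<forall>\<phi>\<in>test_functions \<Omega>.
     (LINT z|lebesgue_on \<Omega>. u z * pderiv_i i \<phi> z) = - (LINT z|lebesgue_on \<Omega>. g z * \<phi> z))"

text \<open>The weak derivative is unique almost everywhere; the choice is that of a representative.\<close>

definition weak_deriv :: "'n::finite pt set \<Rightarrow> 'n \<Rightarrow> ('n pt \<Rightarrow> real) \<Rightarrow> 'n pt \<Rightarrow> real" where
  "weak_deriv \<Omega> i u = (SOME g. g \<in> L2 \<Omega> \<and> is_weak_deriv \<Omega> i u g)"

definition H1 :: "'n::finite pt set \<Rightarrow> ('n pt \<Rightarrow> real) set" where
  "H1 \<Omega> = {u \<in> L2 \<Omega>. \<forall>i. \<exists>g \<in> L2 \<Omega>. is_weak_deriv \<Omega> i u g}"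

definition H1_norm :: "'n::finite pt set \<Rightarrow> ('n pt \<Rightarrow> real) \<Rightarrow> real" where
  "H1_norm \<Omega> u = sqrt ((LINT z|lebesgue_on \<Omega>. (u z)\<^sup>2) +
     (\<Sum>i\<in>UNIV. LINT z|lebesgue_on \<Omega>. (weak_deriv \<Omega> i u z)\<^sup>2))"

definition H10 :: "'n::finite pt set \<Rightarrow> ('n pt \<Rightarrow> real) set" where
  "H10 \<Omega> = {u \<in> H1 \<Omega>. \<forall>\<epsilon>>0. \<exists>\<phi>\<in>test_functions \<Omega>. H1_norm \<Omega> (\<lambda>z. u z - \<phi> z) < \<epsilon>}"

text \<open>Clifford-valued versions: the tensor product with the finite-dimensional space of Clifford
  numbers amounts to imposing the condition on each coordinate. (For \<open>L2\<close> this
  already follows from its definition, which is polymorphic in the codomain.)\<close>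

definition cH10 :: "'n::finite pt set \<Rightarrow> ('n pt \<Rightarrow> 'n cliff) set" where
  "cH10 \<Omega> = {F. \<forall>A. (\<lambda>z. F z $ A) \<in> H10 \<Omega>}"

definition cderiv :: "'n::finite pt set \<Rightarrow> 'n \<Rightarrow> ('n pt \<Rightarrow> 'n cliff) \<Rightarrow> 'n pt \<Rightarrow> 'n cliff" where
  "cderiv \<Omega> i F z = (\<chi> A. weak_deriv \<Omega> i (\<lambda>w. F w $ A) z)"

definition inner2 ::
    "'n::{finite,linorder} pt set \<Rightarrow> ('n pt \<Rightarrow> 'n cliff) \<Rightarrow> ('n pt \<Rightarrow> 'n cliff) \<Rightarrow> 'n cliff" where
  "inner2 \<Omega> F G = (LINT z|lebesgue_on \<Omega>. cliff_conj (F z) \<odot> G z)"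

definition norm2 :: "'n::{finite,linorder} pt set \<Rightarrow> ('n pt \<Rightarrow> 'n cliff) \<Rightarrow> real" where
  "norm2 \<Omega> F = sqrt (Sc (inner2 \<Omega> F F))"


section \<open>The Dirac operator on hyperbolic space and the S-resolvent\<close>

text \<open>The last index \<open>n\<close>; the coordinate \<open>y\<close> is the one with this index.\<close>

definition last_ix :: "'n::{finite,linorder}" where
  "last_ix = Max UNIV"

definition ycoord :: "'n::{finite,linorder} pt \<Rightarrow> real" where
  "ycoord z = z $ last_ix"

definition alpha :: "nat \<Rightarrow> real" where
  "alpha n = (real n - 1) / 2"

definition beta :: "nat \<Rightarrow> real" where
  "beta n = alpha n + (alpha n)\<^sup>2"

definition Dirac_H ::
    "'n::{finite,linorder} pt set \<Rightarrow> ('n pt \<Rightarrow> 'n cliff) \<Rightarrow> 'n pt \<Rightarrow> 'n cliff" where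
  "Dirac_H \<Omega> F z =
     (\<Sum>i\<in>UNIV - {last_ix}. gen_e i \<odot> (ycoord z *\<^sub>R cderiv \<Omega> i F z))
     - alpha CARD('n) *\<^sub>R (gen_e last_ix \<odot> F z)
     + gen_e last_ix \<odot> (ycoord z *\<^sub>R cderiv \<Omega> last_ix F z)"

definition q_form ::
    "'n::{finite,linorder} pt set \<Rightarrow> 'n cliff \<Rightarrow> ('n pt \<Rightarrow> 'n cliff) \<Rightarrow> ('n pt \<Rightarrow> 'n cliff) \<Rightarrow> 'n cliff" where
  "q_form \<Omega> s F G =
     (\<Sum>i\<in>UNIV - {last_ix}. inner2 \<Omega> (\<lambda>z. (ycoord z)\<^sup>2 *\<^sub>R cderiv \<Omega> i F z) (cderiv \<Omega> i G))
     + inner2 \<Omega> (\<lambda>z. (ycoord z)\<^sup>2 *\<^sub>R cderiv \<Omega> last_ix F z) (cderiv \<Omega> last_ix G)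
     + (2 * (1 + alpha CARD('n))) *\<^sub>R inner2 \<Omega> (\<lambda>z. ycoord z *\<^sub>R cderiv \<Omega> last_ix F z) G
     + inner2 \<Omega> (\<lambda>z. (gen_e last_ix - (2 * Sc s) *\<^sub>R cliff_one) \<odot> Dirac_H \<Omega> F z) G
     + inner2 \<Omega> (\<lambda>z. ((norm s)\<^sup>2 - beta CARD('n)) *\<^sub>R F z) G"

definition weak_solution ::
    "'n::{finite,linorder} pt set \<Rightarrow> 'n cliff \<Rightarrow> ('n pt \<Rightarrow> 'n cliff) \<Rightarrow> ('n pt \<Rightarrow> 'n cliff) \<Rightarrow> bool" where
  "weak_solution \<Omega> s f F \<longleftrightarrow> F \<in> cH10 \<Omega> \<and> (\<forall>G\<in>cH10 \<Omega>. q_form \<Omega> s F G = inner2 \<Omega> f G)"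

text \<open>The choice is that of a representative of the weak solution, which is unique almost
  everywhere; without existence nothing could be concluded about \<open>Q_inv\<close>.\<close>

definition Q_inv ::
    "'n::{finite,linorder} pt set \<Rightarrow> 'n cliff \<Rightarrow> ('n pt \<Rightarrow> 'n cliff) \<Rightarrow> 'n pt \<Rightarrow> 'n cliff" where
  "Q_inv \<Omega> s f = (SOME F. weak_solution \<Omega> s f F)"

definition SR_inv ::
    "'n::{finite,linorder} pt set \<Rightarrow> 'n cliff \<Rightarrow> ('n pt \<Rightarrow> 'n cliff) \<Rightarrow> 'n pt \<Rightarrow> 'n cliff" where
  "SR_inv \<Omega> s f z = cliff_conj s \<odot> Q_inv \<Omega> s f z - Dirac_H \<Omega> (Q_inv \<Omega> s f) z"

definition K_const :: "nat \<Rightarrow> real \<Rightarrow> real \<Rightarrow> 'n::finite cliff \<Rightarrow> real" where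
  "K_const n m M s =
     1/2 * \<bar>(norm s)\<^sup>2 - beta n\<bar> - 1/2 * alpha n * sqrt (1 + 4 * (Sc s)\<^sup>2) + 1/2 * m\<^sup>2
     - 1/2 * sqrt ((\<bar>(norm s)\<^sup>2 - beta n\<bar> - alpha n * sqrt (1 + 4 * (Sc s)\<^sup>2) - m\<^sup>2)\<^sup>2
         + M\<^sup>2 * (2 * (1 + alpha n) + sqrt (real n) * sqrt (1 + 4 * (Sc s)\<^sup>2))\<^sup>2)"

end

theory Submission
  imports Defs
begin

text \<open>
  Put \<open>a = ||s|\<^sup>2 - \<beta>\<^sub>n| - \<alpha>\<^sub>n \<surd>(1 + 4 s\<^sub>0\<^sup>2)\<close>, \<open>b = m\<^sup>2\<close> and
  \<open>c = M (2 (1 + \<alpha>\<^sub>n) + \<surd>n \<surd>(1 + 4 s\<^sub>0\<^sup>2))\<close>. The constant \<open>K = K\<^sub>n\<^sub>,\<^sub>m\<^sub>,\<^sub>M(s)\<close> is the smaller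
  eigenvalue of the quadratic form \<open>a X\<^sup>2 - c X P + b P\<^sup>2\<close>; the two inequalities imposed on \<open>s\<close> say
  that \<open>a + b > 0\<close> and \<open>4 a b > c\<^sup>2\<close>, hence \<open>K > 0\<close> (lemma \<open>K_const_pos\<close>). The second one also
  forces \<open>|s|\<^sup>2 > \<beta>\<^sub>n\<close>: otherwise the modulus would be at most \<open>\<beta>\<^sub>n \<le> (1 + \<alpha>\<^sub>n)\<^sup>2\<close>, which is too small
  (lemma \<open>norm_exceeds_beta\<close>). So the zeroth order term of the form \<open>q\<^sub>s\<close> is positive.

  Record a function \<open>F\<close> together with its gradient in the jet \<open>JF = (F, \<nabla>F)\<close>, whose \<open>L\<^sup>2\<close> norm is the
  \<open>H\<^sup>1\<close> norm of \<open>F\<close>. Write \<open>x\<^sup>*\<close> for the conjugate of \<open>x\<close>. Since \<open>Sc(x\<^sup>* y)\<close> is the Euclidean inner product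
  of the Clifford numbers \<open>x\<close> and \<open>y\<close>, the scalar part of \<open>q\<^sub>s(F, G)\<close> is \<open>\<integral> B\<^sub>y(JF, JG)\<close> for a bilinear form \<open>B\<^sub>y\<close> on the jets
  at one point, depending on the height \<open>y\<close> only. Left multiplication by a paravector \<open>p\<close> scales the norm by
  \<open>|p|\<close> (lemma \<open>norm_paravector_mult\<close>), so the symbol of the Dirac operator has norm at most
  \<open>y \<surd>n |\<nabla>F| + \<alpha>\<^sub>n |F|\<close>, and for \<open>m \<le> y \<le> M\<close> the estimate \<open>B\<^sub>y(X, X) \<ge> K |X|\<^sup>2\<close> holds already pointwise
  (lemma \<open>form_symbol_coercive\<close>).

  Existence: the jets of the functions in \<open>H\<^sup>1\<^sub>0\<close> form a closed subspace of \<open>L\<^sup>2\<close>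
  (lemma \<open>jet_space_complete\<close>), on which the form is bounded and coercive, so the
  Lax--Milgram theorem (lemma \<open>lax_milgram\<close>) gives \<open>F\<close> with \<open>Sc q\<^sub>s(F, G) = Sc \<langle>f, G\<rangle>\<close> for all \<open>G\<close>.
  Replacing \<open>G\<close> by \<open>G e\<^sub>A\<close> recovers the remaining coordinates, because both sides are right linear
  in \<open>G\<close>. Linearity of the weak derivative, which is only a chosen representative, rests on its
  uniqueness almost everywhere and thus on the fundamental lemma of the calculus of variations.

  Estimate: testing with \<open>G = F\<close> gives \<open>K \<parallel>JF\<parallel>\<^sup>2 \<le> \<parallel>f\<parallel> \<parallel>F\<parallel>\<close>, hence \<open>K \<parallel>JF\<parallel> \<le> \<parallel>f\<parallel>\<close>, while
  \<open>|(s\<^sup>* - D\<^sub>H) F| \<le> (|s| + \<alpha>\<^sub>n + M \<surd>n) |JF|\<close> pointwise.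
\<close>

section \<open>The Lax--Milgram theorem\<close>

text \<open>The linear combination \<open>X + c Y\<close> of two functions. It is kept as a single operation, so that
  linearity of a functional on a set of functions is one equation.\<close>

definition axpy :: "('x \<Rightarrow> 'b::real_vector) \<Rightarrow> real \<Rightarrow> ('x \<Rightarrow> 'b) \<Rightarrow> 'x \<Rightarrow> 'b" where
  "axpy X c Y = (\<lambda>z. X z + c *\<^sub>R Y z)"

text \<open>A linear space of functions with a positive semidefinite inner product. Semidefiniteness allows
  functions that agree almost everywhere to stay unidentified.\<close>

locale semi_inner_space =
  fixes V :: "('x \<Rightarrow> 'b::real_vector) set" and ip :: "('x \<Rightarrow> 'b) \<Rightarrow> ('x \<Rightarrow> 'b) \<Rightarrow> real"
  assumes zero_in: "(\<lambda>z. 0) \<in> V"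
    and axpy_in: "X \<in> V \<Longrightarrow> Y \<in> V \<Longrightarrow> axpy X c Y \<in> V"
    and ip_axpy: "X \<in> V \<Longrightarrow> Y \<in> V \<Longrightarrow> Z \<in> V \<Longrightarrow> ip (axpy X c Y) Z = ip X Z + c * ip Y Z"
    and ip_commute: "X \<in> V \<Longrightarrow> Y \<in> V \<Longrightarrow> ip X Y = ip Y X"
    and ip_nonneg: "X \<in> V \<Longrightarrow> 0 \<le> ip X X"
begin

text \<open>The seminorm of the inner product.\<close>

definition nrm :: "('x \<Rightarrow> 'b) \<Rightarrow> real" where
  "nrm X = sqrt (ip X X)"

lemma ip_axpy_right: "X \<in> V \<Longrightarrow> Y \<in> V \<Longrightarrow> Z \<in> V \<Longrightarrow> ip Z (axpy X c Y) = ip Z X + c * ip Z Y"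
  using ip_axpy[of X Y Z c] ip_commute axpy_in by metis

lemma nrm_nonneg: "X \<in> V \<Longrightarrow> 0 \<le> nrm X"
  by (simp add: nrm_def ip_nonneg)

lemma nrm_sq: "X \<in> V \<Longrightarrow> nrm X ^ 2 = ip X X"
  by (simp add: nrm_def ip_nonneg)

lemma ip_expand: "X \<in> V \<Longrightarrow> Y \<in> V \<Longrightarrow>
    ip (axpy X c Y) (axpy X c Y) = ip X X + 2 * c * ip X Y + c\<^sup>2 * ip Y Y"
  by (simp add: ip_axpy ip_axpy_right axpy_in ip_commute[of Y X] algebra_simps power2_eq_square)

lemma ip_bound: 
  assumes "X \<in> V" "Y \<in> V" shows "\<bar>ip X Y\<bar> \<le> nrm X * nrm Y"
proof (cases "ip Y Y = 0")
  case True
  have "ip X Y = 0"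
  proof (rule ccontr)
    assume n: "ip X Y \<noteq> 0"
    define c where "c = - (ip X X + 1) / (2 * ip X Y)"
    have "0 \<le> ip (axpy X c Y) (axpy X c Y)" using assms by (simp add: ip_nonneg axpy_in)
    also have "\<dots> = -1" using assms n True by (simp add: ip_expand c_def field_simps)
    finally show False by simp
  qed
  then show ?thesis using assms by (simp add: nrm_nonneg)
next
  case False
  then have p: "ip Y Y > 0" using ip_nonneg[of Y] assms by simp
  define c where "c = - ip X Y / ip Y Y"
  have "0 \<le> ip (axpy X c Y) (axpy X c Y)" using assms by (simp add: ip_nonneg axpy_in)
  also have "\<dots> = ip X X - (ip X Y)\<^sup>2 / ip Y Y"
    using assms p by (simp add: ip_expand c_def field_simps power2_eq_square)
  finally have "(ip X Y)\<^sup>2 \<le> ip X X * ip Y Y" using p by (simp add: field_simps)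
  then have "sqrt ((ip X Y)\<^sup>2) \<le> sqrt (ip X X * ip Y Y)" by (rule real_sqrt_le_mono)
  then show ?thesis by (simp add: nrm_def real_sqrt_mult)
qed

lemma nrm_axpy: 
  assumes "X \<in> V" "Y \<in> V" shows "nrm (axpy X c Y) \<le> nrm X + \<bar>c\<bar> * nrm Y"
proof (rule power2_le_imp_le)
  have "c * ip X Y \<le> \<bar>c\<bar> * (nrm X * nrm Y)"
    using mult_left_mono[OF ip_bound[OF assms], of "\<bar>c\<bar>"] abs_le_iff by (fastforce simp: abs_mult)
  then show "(nrm (axpy X c Y))\<^sup>2 \<le> (nrm X + \<bar>c\<bar> * nrm Y)\<^sup>2"
    using assms by (simp add: nrm_sq axpy_in ip_expand power2_sum power_mult_distrib mult_ac)
qed (use assms in \<open>simp add: nrm_nonneg\<close>)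

lemma nrm_triangle:
  assumes "X \<in> V" "Y \<in> V" "Z \<in> V"
  shows "nrm (axpy X (-1) Z) \<le> nrm (axpy X (-1) Y) + nrm (axpy Y (-1) Z)"
proof -
  have "axpy X (-1) Z = axpy (axpy X (-1) Y) 1 (axpy Y (-1) Z)"
    by (simp add: axpy_def)
  then show ?thesis using nrm_axpy[of "axpy X (-1) Y" "axpy Y (-1) Z" 1] assms axpy_in by simp
qed

lemma nrm_minus_commute: "X \<in> V \<Longrightarrow> Y \<in> V \<Longrightarrow> nrm (axpy X (-1) Y) = nrm (axpy Y (-1) X)"
  by (simp add: nrm_def ip_expand ip_commute)

end

text \<open>A complete space of this kind; limits are unique only up to seminorm zero.\<close>

locale hilbert_space_on = semi_inner_space +
  assumes complete: "\<lbrakk>\<And>k::nat. u k \<in> V;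
      \<And>e. e > 0 \<Longrightarrow> \<exists>N. \<forall>i\<ge>N. \<forall>j\<ge>N. nrm (axpy (u i) (-1) (u j)) < e\<rbrakk>
    \<Longrightarrow> \<exists>X\<in>V. (\<lambda>k. nrm (axpy (u k) (-1) X)) \<longlonglongrightarrow> 0"
begin

text \<open>The Riesz representation theorem, by minimising \<open>\<langle>X, X\<rangle> - 2 l(X)\<close>: a minimising sequence is
  Cauchy by the parallelogram law, and the first variation vanishes at its limit.\<close>

lemma riesz:
  assumes lin: "\<And>X Y c. X \<in> V \<Longrightarrow> Y \<in> V \<Longrightarrow> l (axpy X c Y) = l X + c * l Y"
    and bd: "\<And>X. X \<in> V \<Longrightarrow> \<bar>l X\<bar> \<le> L * nrm X"
  obtains R where "R \<in> V" "\<And>Y. Y \<in> V \<Longrightarrow> ip R Y = l Y"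
proof -
  define J where "J X = ip X X - 2 * l X" for X
  have Jlow: "J X \<ge> - L\<^sup>2" if "X \<in> V" for X
  proof -
    have "0 \<le> (nrm X - L)\<^sup>2" by simp
    then show ?thesis using bd[OF that] nrm_sq[OF that] mult.commute[of L "nrm X"]
      unfolding J_def power2_diff by linarith
  qed
  define d where "d = Inf (J ` V)"
  have bb: "bdd_below (J ` V)" using Jlow by (auto simp: bdd_below_def)
  have dle: "d \<le> J X" if "X \<in> V" for X
    unfolding d_def using bb that by (intro cInf_lower) auto
  have "\<exists>X\<in>V. J X < d + e" if "e > 0" for e
  proof -
    have "Inf (J ` V) < d + e" using that by (simp add: d_def)
    then show ?thesis using bb zero_in by (subst (asm) cInf_less_iff) auto
  qed
  from this[OF inverse_Suc] have "\<forall>k::nat. \<exists>X. X \<in> V \<and> J X < d + inverse (real (Suc k))" by blast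
  then obtain u where u: "\<And>k. u k \<in> V" "\<And>k. J (u k) < d + inverse (real (Suc k))" by metis
  have par: "ip (axpy X (-1) Y) (axpy X (-1) Y) \<le> 2 * (J X - d) + 2 * (J Y - d)"
    if "X \<in> V" "Y \<in> V" for X Y
  proof -
    have z: "axpy (\<lambda>z. 0) (1/2) (axpy X 1 Y) \<in> V" using that zero_in axpy_in by auto
    have z0: "ip (\<lambda>z. 0) W = 0" "l (\<lambda>z. 0) = 0" if "W \<in> V" for W
      using ip_axpy[OF zero_in zero_in that, of 1] lin[OF zero_in zero_in, of 1] by (simp_all add: axpy_def)
    have "4 * J (axpy (\<lambda>z. 0) (1/2) (axpy X 1 Y)) = ip X X + 2 * ip X Y + ip Y Y - 4 * l X - 4 * l Y"
      using that by (simp add: J_def ip_expand axpy_in zero_in z0 lin ip_commute field_simps power2_eq_square)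
    then show ?thesis using dle[OF z] that by (simp add: ip_expand J_def)
  qed
  have "\<exists>N. \<forall>i\<ge>N. \<forall>j\<ge>N. nrm (axpy (u i) (-1) (u j)) < e" if "e > 0" for e
  proof -
    obtain N :: nat where N: "inverse (real (Suc N)) < e\<^sup>2 / 4"
      using reals_Archimedean[of "e\<^sup>2/4"] \<open>e > 0\<close> by auto
    have "nrm (axpy (u i) (-1) (u j)) < e" if "i \<ge> N" "j \<ge> N" for i j
    proof (rule power2_less_imp_less)
      have *: "J (u i) - d < e\<^sup>2/4" if "i \<ge> N" for i
      proof -
        have "inverse (real (Suc i)) \<le> inverse (real (Suc N))"
          using that by (intro le_imp_inverse_le) auto
        then show ?thesis using u(2)[of i] N by linarith
      qed
      have "(nrm (axpy (u i) (-1) (u j)))\<^sup>2 \<le> 2 * (J (u i) - d) + 2 * (J (u j) - d)"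
        using par u by (simp add: nrm_sq axpy_in)
      also have "\<dots> < e\<^sup>2" using *[of i] *[of j] that by simp
      finally show "(nrm (axpy (u i) (-1) (u j)))\<^sup>2 < e\<^sup>2" .
    qed (use \<open>e > 0\<close> in simp)
    then show ?thesis by blast
  qed
  from complete[of u, OF u(1) this] obtain R where R: "R \<in> V"
    and lim: "(\<lambda>k. nrm (axpy (u k) (-1) R)) \<longlonglongrightarrow> 0" by auto
  have JR: "J R \<le> d"
  proof -
    have b: "\<bar>l (u k) - l R\<bar> \<le> L * nrm (axpy (u k) (-1) R)" for k
      using bd[OF axpy_in[OF u(1)[of k] R, of "-1"]] lin[OF u(1)[of k] R, of "-1"] by simp
    have "(\<lambda>k. L * nrm (axpy (u k) (-1) R)) \<longlonglongrightarrow> 0" by (rule tendsto_mult_right_zero[OF lim])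
    then have "(\<lambda>k. l (u k) - l R) \<longlonglongrightarrow> 0"
      by (rule Lim_null_comparison[rotated]) (simp add: b)
    then have 1: "(\<lambda>k. 2 * (l (u k) - l R)) \<longlonglongrightarrow> 0" by (rule tendsto_mult_right_zero)
    have 2: "ip (u k) (u k) = ip R R + 2 * ip (axpy (u k) (-1) R) R + (nrm (axpy (u k) (-1) R))\<^sup>2" for k
      using nrm_sq[OF axpy_in[OF u(1)[of k] R, of "-1"]] ip_expand[OF u(1)[of k] R, of "-1"]
        ip_axpy[OF u(1)[of k] R R, of "-1"] by simp
    have 3: "(\<lambda>k. ip (axpy (u k) (-1) R) R) \<longlonglongrightarrow> 0"
    proof (rule Lim_null_comparison)
      show "\<forall>\<^sub>F k in sequentially. norm (ip (axpy (u k) (-1) R) R) \<le> nrm (axpy (u k) (-1) R) * nrm R"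
        using ip_bound u R axpy_in by auto
      show "(\<lambda>k. nrm (axpy (u k) (-1) R) * nrm R) \<longlonglongrightarrow> 0" by (rule tendsto_mult_left_zero[OF lim])
    qed
    have "(\<lambda>k. J R + 2 * ip (axpy (u k) (-1) R) R + (nrm (axpy (u k) (-1) R))\<^sup>2 - 2 * (l (u k) - l R))
        \<longlonglongrightarrow> J R + 2 * 0 + 0\<^sup>2 - 0"
      by (intro tendsto_intros 3 lim 1)
    then have "(\<lambda>k. J (u k)) \<longlonglongrightarrow> J R" by (simp add: J_def 2 algebra_simps)
    moreover have "(\<lambda>k. d + inverse (real (Suc k))) \<longlonglongrightarrow> d + 0"
      by (intro tendsto_intros LIMSEQ_inverse_real_of_nat)
    ultimately show ?thesis using u(2) by (intro LIMSEQ_le[where Y="\<lambda>k. d + inverse (real (Suc k))"]) (auto intro: less_imp_le)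
  qed
  show thesis
  proof
    show "R \<in> V" by fact
    fix Y assume Y: "Y \<in> V"
    define b where "b = ip R Y - l Y"
    have q: "2 * t * b + t\<^sup>2 * ip Y Y \<ge> 0" for t
    proof -
      have "J (axpy R t Y) \<ge> J R" using JR dle[of "axpy R t Y"] R Y axpy_in by force
      then show ?thesis using R Y by (simp add: J_def ip_expand lin b_def algebra_simps)
    qed
    \<comment> \<open>A step of this size along \<open>Y\<close> would lower \<open>J\<close> unless \<open>b = 0\<close>.\<close>
    have "2 * (- b / (ip Y Y + 1)) * b + (- b / (ip Y Y + 1))\<^sup>2 * ip Y Y 
        = - b\<^sup>2 * (ip Y Y + 2) / (ip Y Y + 1)\<^sup>2"
      using ip_nonneg[OF Y] by (simp add: divide_simps power2_eq_square) (simp add: algebra_simps)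
    with q have "b\<^sup>2 * (ip Y Y + 2) / (ip Y Y + 1)\<^sup>2 \<le> 0" by (smt (verit) mult_minus_left minus_divide_left)
    then have "b = 0" using ip_nonneg[OF Y] by (auto simp: divide_le_0_iff mult_le_0_iff)
    then show "ip R Y = l Y" by (simp add: b_def)
  qed
qed

text \<open>The form need not be symmetric. With \<open>A\<close> the operator that represents \<open>a\<close>, the map
  \<open>X \<mapsto> X + r (f - A X)\<close> is a contraction for small \<open>r\<close>, and its fixed point is the solution.\<close>

lemma lax_milgram:
  assumes linl: "\<And>X Y Z c. X \<in> V \<Longrightarrow> Y \<in> V \<Longrightarrow> Z \<in> V \<Longrightarrow> a (axpy X c Y) Z = a X Z + c * a Y Z"
    and linr: "\<And>X Y Z c. X \<in> V \<Longrightarrow> Y \<in> V \<Longrightarrow> Z \<in> V \<Longrightarrow> a Z (axpy X c Y) = a Z X + c * a Z Y"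
    and bda: "\<And>X Y. X \<in> V \<Longrightarrow> Y \<in> V \<Longrightarrow> \<bar>a X Y\<bar> \<le> C * nrm X * nrm Y"
    and coer: "\<And>X. X \<in> V \<Longrightarrow> K * ip X X \<le> a X X" and K: "0 < K"
    and lin: "\<And>X Y c. X \<in> V \<Longrightarrow> Y \<in> V \<Longrightarrow> l (axpy X c Y) = l X + c * l Y"
    and bd: "\<And>X. X \<in> V \<Longrightarrow> \<bar>l X\<bar> \<le> L * nrm X"
  obtains X where "X \<in> V" "\<And>Y. Y \<in> V \<Longrightarrow> a X Y = l Y"
proof -
  obtain f where f: "f \<in> V" "\<And>Y. Y \<in> V \<Longrightarrow> ip f Y = l Y"
    by (rule riesz[of l L, OF lin bd]) auto
  have "\<exists>R\<in>V. \<forall>Y\<in>V. ip R Y = a X Y" if X: "X \<in> V" for X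
  proof -
    obtain R where "R \<in> V" "\<And>Y. Y \<in> V \<Longrightarrow> ip R Y = a X Y"
      using riesz[of "a X" "C * nrm X", OF linr[OF _ _ X] bda[OF X]] by blast
    then show ?thesis by blast
  qed
  then obtain A where A: "\<And>X. X \<in> V \<Longrightarrow> A X \<in> V" "\<And>X Y. X \<in> V \<Longrightarrow> Y \<in> V \<Longrightarrow> ip (A X) Y = a X Y"
    by metis
  define D where "D = max C K"
  have D: "D > 0" "K \<le> D" using K by (auto simp: D_def)
  have bda': "\<bar>a X Y\<bar> \<le> D * nrm X * nrm Y" if "X \<in> V" "Y \<in> V" for X Y
  proof -
    have "C * (nrm X * nrm Y) \<le> D * (nrm X * nrm Y)" using that by (intro mult_right_mono) (auto simp: D_def nrm_nonneg)
    then show ?thesis using bda[OF that] by simp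
  qed
  \<comment> \<open>This \<open>r\<close> minimises \<open>1 - 2 r K + r\<^sup>2 D\<^sup>2\<close>, the bound for the squared contraction factor.\<close>
  define r where "r = K / D\<^sup>2"
  define th where "th = sqrt (1 - K\<^sup>2 / D\<^sup>2)"
  have KD: "K\<^sup>2 \<le> D\<^sup>2" using K D by (intro power_mono) auto
  have th: "0 \<le> th" "th < 1" using KD K D by (auto simp: th_def)
  define T where "T X = axpy X r (axpy f (-1) (A X))" for X
  have TV: "T X \<in> V" if "X \<in> V" for X using that f A by (simp add: T_def axpy_in)
  have contr: "nrm (axpy (T X) (-1) (T Y)) \<le> th * nrm (axpy X (-1) Y)" if X: "X \<in> V" and Y: "Y \<in> V" for X Y
  proof -
    define w where "w = axpy X (-1) Y"
    define g where "g = axpy (A X) (-1) (A Y)"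
    have w: "w \<in> V" and g: "g \<in> V" using X Y A axpy_in by (auto simp: w_def g_def)
    have eq: "axpy (T X) (-1) (T Y) = axpy w (-r) g"
      by (simp add: T_def w_def g_def axpy_def algebra_simps)
    have ipg: "ip g Z = a w Z" if "Z \<in> V" for Z
      using X Y A that by (simp add: g_def w_def ip_axpy linl)
    have "nrm g * nrm g \<le> D * nrm w * nrm g"
      using ipg[OF g] bda'[OF w g] nrm_sq[OF g] by (simp add: power2_eq_square)
    then have gw: "nrm g \<le> D * nrm w"
      using nrm_nonneg[OF g] nrm_nonneg[OF w] D(1) by (cases "nrm g = 0") simp_all
    have "ip g g \<le> D\<^sup>2 * ip w w"
      using power_mono[OF gw nrm_nonneg[OF g], of 2] g w by (simp add: power_mult_distrib nrm_sq)
    then have 1: "r\<^sup>2 * ip g g \<le> r\<^sup>2 * (D\<^sup>2 * ip w w)" by (intro mult_left_mono) auto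
    have 2: "2 * r * (K * ip w w) \<le> 2 * r * a w w" using K D coer[OF w] by (intro mult_left_mono) (auto simp: r_def)
    have "(nrm (axpy w (-r) g))\<^sup>2 = ip w w - 2 * r * a w w + r\<^sup>2 * ip g g"
      using w g ipg[OF w] ip_commute[OF w g] by (simp add: nrm_sq axpy_in ip_expand)
    also have "\<dots> \<le> ip w w - 2 * r * (K * ip w w) + r\<^sup>2 * (D\<^sup>2 * ip w w)" using 1 2 by linarith
    also have "\<dots> = (1 - K\<^sup>2 / D\<^sup>2) * ip w w"
    proof -
      have "r * K = K\<^sup>2 / D\<^sup>2" "r\<^sup>2 * D\<^sup>2 = K\<^sup>2 / D\<^sup>2"
        using D(1) by (simp_all add: r_def power2_eq_square)
      moreover have "ip w w - 2 * r * (K * ip w w) + r\<^sup>2 * (D\<^sup>2 * ip w w)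
          = ip w w - 2 * (r * K) * ip w w + (r\<^sup>2 * D\<^sup>2) * ip w w" by simp
      ultimately show ?thesis by (simp add: left_diff_distrib)
    qed
    also have "\<dots> = (th * nrm w)\<^sup>2" using KD D w by (simp add: th_def power_mult_distrib nrm_sq)
    finally show ?thesis unfolding eq w_def[symmetric] by (rule power2_le_imp_le) (use th w in \<open>simp add: nrm_nonneg\<close>)
  qed
  define u where "u k = (T ^^ k) f" for k
  have uV: "u k \<in> V" for k by (induction k) (auto simp: u_def f TV)
  define N0 where "N0 = nrm (axpy (u 0) (-1) (u 1))"
  have N0: "0 \<le> N0" by (simp add: N0_def nrm_nonneg axpy_in uV)
  have step: "nrm (axpy (u k) (-1) (u (Suc k))) \<le> th ^ k * N0" for k
  proof (induction k)
    case (Suc k)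
    have "nrm (axpy (u (Suc k)) (-1) (u (Suc (Suc k)))) \<le> th * nrm (axpy (u k) (-1) (u (Suc k)))"
      using contr[OF uV[of k] uV[of "Suc k"]] by (simp add: u_def)
    also have "\<dots> \<le> th * (th ^ k * N0)" using Suc th by (intro mult_left_mono) auto
    finally show ?case by simp
  qed (simp add: N0_def)
  have tail: "nrm (axpy (u i) (-1) (u (i + k))) \<le> th ^ i * N0 * (1 - th ^ k) / (1 - th)" for i k
  proof (induction k)
    case 0
    have "nrm (axpy (u i) (-1) (u i)) = 0" using uV by (simp add: nrm_def ip_expand)
    then show ?case by simp
  next
    case (Suc k)
    have "nrm (axpy (u i) (-1) (u (i + Suc k))) \<le>
        th ^ i * N0 * (1 - th ^ k) / (1 - th) + th ^ (i + k) * N0"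
      using nrm_triangle[OF uV[of i] uV[of "i + k"] uV[of "i + Suc k"]] Suc step[of "i + k"] by simp
    also have "\<dots> = th ^ i * N0 * (1 - th ^ Suc k) / (1 - th)"
    proof -
      have "x / (1 - th) + y = (x + y * (1 - th)) / (1 - th)" for x y
        using th(2) by (simp add: add_divide_distrib)
      then show ?thesis by (simp add: power_add algebra_simps)
    qed
    finally show ?case .
  qed
  have tail': "nrm (axpy (u i) (-1) (u j)) \<le> th ^ i * (N0 / (1 - th))" if "i \<le> j" for i j
  proof -
    have "th ^ i * N0 * (1 - th ^ (j - i)) / (1 - th) \<le> th ^ i * N0 * 1 / (1 - th)"
      using th N0 by (intro divide_right_mono mult_left_mono) auto
    then show ?thesis using tail[of i "j - i"] that by simp
  qed
  have "\<exists>N. \<forall>i\<ge>N. \<forall>j\<ge>N. nrm (axpy (u i) (-1) (u j)) < e" if e: "e > 0" for e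
  proof -
    have "(\<lambda>i. th ^ i * (N0 / (1 - th))) \<longlonglongrightarrow> 0"
      using th by (intro tendsto_mult_left_zero LIMSEQ_power_zero) auto
    then have "\<forall>\<^sub>F i in sequentially. th ^ i * (N0 / (1 - th)) < e" using e by (rule order_tendstoD)
    then obtain N where N: "\<And>i. i \<ge> N \<Longrightarrow> th ^ i * (N0 / (1 - th)) < e" by (auto simp: eventually_sequentially)
    have "nrm (axpy (u i) (-1) (u j)) < e" if "i \<ge> N" "j \<ge> N" for i j
    proof (cases "i \<le> j")
      case True then show ?thesis using tail'[of i j] N[of i] that by simp
    next
      case False then show ?thesis using tail'[of j i] N[of j] that nrm_minus_commute[OF uV[of i] uV[of j]] by simp
    qed
    then show ?thesis by blast
  qed
  with complete[of u, OF uV] obtain X where X: "X \<in> V"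
    and lim: "(\<lambda>k. nrm (axpy (u k) (-1) X)) \<longlonglongrightarrow> 0" by auto
  have "nrm (axpy (T X) (-1) X) \<le> 0"
  proof (rule LIMSEQ_le_const)
    show "\<exists>N. \<forall>k\<ge>N. nrm (axpy (T X) (-1) X) \<le> th * nrm (axpy (u k) (-1) X) + nrm (axpy (u (Suc k)) (-1) X)"
    proof (intro exI allI impI)
      fix k
      have "nrm (axpy (T X) (-1) (u (Suc k))) \<le> th * nrm (axpy (u k) (-1) X)"
        using contr[OF X uV[of k]] nrm_minus_commute[OF X uV[of k]] by (simp add: u_def)
      then show "nrm (axpy (T X) (-1) X) \<le> th * nrm (axpy (u k) (-1) X) + nrm (axpy (u (Suc k)) (-1) X)"
        using nrm_triangle[OF TV[OF X] uV[of "Suc k"] X] by simp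
    qed
    have "(\<lambda>k. nrm (axpy (u (Suc k)) (-1) X)) \<longlonglongrightarrow> 0" using lim by (rule LIMSEQ_Suc)
    then show "(\<lambda>k. th * nrm (axpy (u k) (-1) X) + nrm (axpy (u (Suc k)) (-1) X)) \<longlonglongrightarrow> 0"
      using lim by (auto intro!: tendsto_eq_intros)
  qed
  then have z: "nrm (axpy (T X) (-1) X) = 0" using nrm_nonneg[OF axpy_in[OF TV[OF X] X]] by (rule antisym)
  show thesis
  proof
    show "X \<in> V" by fact
    fix Y assume Y: "Y \<in> V"
    have "\<bar>ip (axpy (T X) (-1) X) Y\<bar> \<le> 0" using ip_bound[of "axpy (T X) (-1) X" Y] z Y TV X axpy_in by simp
    then have "r * (l Y - a X Y) = 0"
      using X Y f A by (simp add: T_def ip_axpy axpy_in)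
    then show "a X Y = l Y" using K D by (simp add: r_def)
  qed
qed

end

section \<open>Square-integrable functions\<close>

text \<open>The square-integrable functions on a measure space, as functions rather than as classes modulo
  null sets.\<close>

definition sq_integrable :: "'x measure \<Rightarrow> ('x \<Rightarrow> 'b::euclidean_space) set" where
  "sq_integrable M = {f \<in> borel_measurable M. integrable M (\<lambda>z. (norm (f z))\<^sup>2)}"

text \<open>The \<open>L\<^sup>2\<close> inner product, for functions with values in a Euclidean space.\<close>

definition ip2 :: "'x measure \<Rightarrow> ('x \<Rightarrow> 'b::euclidean_space) \<Rightarrow> ('x \<Rightarrow> 'b) \<Rightarrow> real" where
  "ip2 M f g = (LINT z|M. f z \<bullet> g z)"

lemma sq_integrableD:
  assumes "f \<in> sq_integrable M"
  shows "f \<in> borel_measurable M" "integrable M (\<lambda>z. (norm (f z))\<^sup>2)"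
  using assms by (auto simp: sq_integrable_def)

lemma L2_eq: "L2 \<Omega> = sq_integrable (lebesgue_on \<Omega>)"
  by (simp add: L2_def sq_integrable_def)

lemma sq_integrable_bound:
  assumes "g \<in> sq_integrable M" "f \<in> borel_measurable M"
    "AE z in M. norm (f z) \<le> c * norm (g z)"
  shows "f \<in> sq_integrable M"
proof -
  have "integrable M (\<lambda>z. (norm (f z))\<^sup>2)"
  proof (rule Bochner_Integration.integrable_bound)
    show "integrable M (\<lambda>z. c\<^sup>2 * (norm (g z))\<^sup>2)" using sq_integrableD[OF assms(1)] by simp
    show "AE z in M. norm ((norm (f z))\<^sup>2) \<le> norm (c\<^sup>2 * (norm (g z))\<^sup>2)"
      using assms(3)
    proof eventually_elim
      case (elim z)
      then have "(norm (f z))\<^sup>2 \<le> (c * norm (g z))\<^sup>2" by (intro power_mono) auto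
      then show ?case by (simp add: power_mult_distrib)
    qed
  qed (use assms(2) in measurable)
  then show ?thesis using assms by (simp add: sq_integrable_def)
qed

text \<open>A function \<open>h\<close> that is pointwise controlled by \<open>|f| |g|\<close>, such as a bilinear expression in \<open>f\<close> and \<open>g\<close>.\<close>

lemma sq_integrable_bilinear:
  fixes f :: "'x \<Rightarrow> 'b::euclidean_space" and g :: "'x \<Rightarrow> 'c::euclidean_space"
    and h :: "'x \<Rightarrow> 'd::{banach, second_countable_topology}"
  assumes "f \<in> sq_integrable M" "g \<in> sq_integrable M" "h \<in> borel_measurable M"
    "AE z in M. norm (h z) \<le> c * (norm (f z) * norm (g z))"
  shows "integrable M h"
proof (rule Bochner_Integration.integrable_bound)
  show "integrable M (\<lambda>z. \<bar>c\<bar> * ((norm (f z))\<^sup>2 + (norm (g z))\<^sup>2))"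
    using sq_integrableD[OF assms(1)] sq_integrableD[OF assms(2)] by simp
  show "AE z in M. norm (h z) \<le> norm (\<bar>c\<bar> * ((norm (f z))\<^sup>2 + (norm (g z))\<^sup>2))"
    using assms(4)
  proof eventually_elim
    case (elim z)
    have "c * (norm (f z) * norm (g z)) \<le> \<bar>c\<bar> * (norm (f z) * norm (g z))"
      by (intro mult_right_mono) auto
    also have "\<dots> \<le> \<bar>c\<bar> * ((norm (f z))\<^sup>2 + (norm (g z))\<^sup>2)"
    proof (intro mult_left_mono)
      have "0 \<le> (norm (f z) - norm (g z))\<^sup>2" "0 \<le> norm (f z) * norm (g z)" by simp_all
      then show "norm (f z) * norm (g z) \<le> (norm (f z))\<^sup>2 + (norm (g z))\<^sup>2"
        unfolding power2_diff by linarith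
    qed simp
    finally show ?case using elim by simp
  qed
qed fact

lemma sq_integrable_inner:
  "f \<in> sq_integrable M \<Longrightarrow> g \<in> sq_integrable M \<Longrightarrow> integrable M (\<lambda>z. f z \<bullet> g z)"
  by (rule sq_integrable_bilinear[where c=1 and f=f and g=g])
     (auto dest!: sq_integrableD(1) simp: Cauchy_Schwarz_ineq2 intro: borel_measurable_inner)

lemma sq_integrable_axpy:
  assumes "f \<in> sq_integrable M" "g \<in> sq_integrable M"
  shows "axpy f c g \<in> sq_integrable M"
proof -
  have "(norm (f z + c *\<^sub>R g z))\<^sup>2 = (norm (f z))\<^sup>2 + 2 * c * (f z \<bullet> g z) + c\<^sup>2 * (norm (g z))\<^sup>2" for z
    
    unfolding power2_norm_eq_inner by (simp add: inner_add inner_commute[of "g z" "f z"] algebra_simps power2_eq_square)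
  then have "integrable M (\<lambda>z. (norm (f z + c *\<^sub>R g z))\<^sup>2)"
    using sq_integrableD[OF assms(1)] sq_integrableD[OF assms(2)] sq_integrable_inner[OF assms] by simp
  moreover have "axpy f c g \<in> borel_measurable M"
    using sq_integrableD[OF assms(1)] sq_integrableD[OF assms(2)] by (simp add: axpy_def)
  ultimately show ?thesis by (simp add: sq_integrable_def axpy_def)
qed

lemma sq_integrable_zero: "(\<lambda>z. 0) \<in> sq_integrable M"
  by (simp add: sq_integrable_def)

interpretation sq: semi_inner_space "sq_integrable M :: ('x \<Rightarrow> 'b::euclidean_space) set" "ip2 M" for M :: "'x measure"
proof
  fix X Y Z :: "'x \<Rightarrow> 'b" and c :: real
  assume XYZ: "X \<in> sq_integrable M" "Y \<in> sq_integrable M" "Z \<in> sq_integrable M"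
  then show "ip2 M (axpy X c Y) Z = ip2 M X Z + c * ip2 M Y Z"
    by (simp add: ip2_def axpy_def inner_add_left sq_integrable_inner)
qed (auto simp: sq_integrable_axpy sq_integrable_zero ip2_def inner_commute intro: integral_nonneg)

text \<open>The \<open>L\<^sup>2\<close> seminorm.\<close>

abbreviation nrm2 :: "'x measure \<Rightarrow> ('x \<Rightarrow> 'b::euclidean_space) \<Rightarrow> real" where
  "nrm2 M \<equiv> semi_inner_space.nrm (ip2 M)"

lemma nrm2_eq: "nrm2 M f = sqrt (LINT z|M. (norm (f z))\<^sup>2)"
  by (simp add: sq.nrm_def ip2_def power2_norm_eq_inner)

lemma nrm2_sq: "(nrm2 M f)\<^sup>2 = (LINT z|M. (norm (f z))\<^sup>2)"
  by (simp add: nrm2_eq)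

lemma nrm2_bound:
  assumes "g \<in> sq_integrable M" "f \<in> borel_measurable M"
    "AE z in M. norm (f z) \<le> c * norm (g z)" "0 \<le> c"
  shows "nrm2 M f \<le> c * nrm2 M g"
proof -
  have "(LINT z|M. (norm (f z))\<^sup>2) \<le> (LINT z|M. c\<^sup>2 * (norm (g z))\<^sup>2)"
  proof (rule integral_mono_AE)
    show "AE z in M. (norm (f z))\<^sup>2 \<le> c\<^sup>2 * (norm (g z))\<^sup>2"
      using assms(3)
    proof eventually_elim
      case (elim z)
      then have "(norm (f z))\<^sup>2 \<le> (c * norm (g z))\<^sup>2" by (intro power_mono) auto
      then show ?case by (simp add: power_mult_distrib)
    qed
  qed (use sq_integrableD[OF assms(1)] sq_integrableD[OF sq_integrable_bound[OF assms(1-3)]] in auto)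
  then have "(nrm2 M f)\<^sup>2 \<le> (c * nrm2 M g)\<^sup>2"
    by (simp add: nrm2_sq power_mult_distrib)
  then show ?thesis by (rule power2_le_imp_le) (use assms in \<open>simp add: sq.nrm_nonneg\<close>)
qed

lemma nrm2_cong: "AE z in M. f z = g z \<Longrightarrow> f \<in> borel_measurable M \<Longrightarrow> g \<in> borel_measurable M \<Longrightarrow> nrm2 M f = nrm2 M g"
  unfolding nrm2_eq by (intro arg_cong[where f=sqrt] integral_cong_AE) auto

lemma nn_integral_sq:
  assumes "f \<in> sq_integrable M"
  shows "(\<integral>\<^sup>+z. ennreal ((norm (f z))\<^sup>2) \<partial>M) = ennreal ((nrm2 M f)\<^sup>2)"
  using nn_integral_eq_integral[OF sq_integrableD(2)[OF assms]] by (simp add: nrm2_sq)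

text \<open>Riesz--Fischer. A subsequence with differences of norm at most \<open>2\<^sup>-\<^sup>k\<close> converges almost everywhere, and
  Fatou's lemma turns the pointwise limit into a limit in \<open>L\<^sup>2\<close>.\<close>

lemma sq_integrable_complete:
  fixes u :: "nat \<Rightarrow> 'x \<Rightarrow> 'b::euclidean_space"
  assumes u: "\<And>k. u k \<in> sq_integrable M"
    and cau: "\<And>e. e > 0 \<Longrightarrow> \<exists>N. \<forall>i\<ge>N. \<forall>j\<ge>N. nrm2 M (axpy (u i) (-1) (u j)) < e"
  shows "\<exists>X\<in>sq_integrable M. (\<lambda>k. nrm2 M (axpy (u k) (-1) X)) \<longlonglongrightarrow> 0"
proof -
  have um[measurable]: "u k \<in> borel_measurable M" for k using u sq_integrableD by blast
  have "\<exists>N. \<forall>k. (\<forall>i\<ge>N k. \<forall>j\<ge>N k. nrm2 M (axpy (u i) (-1) (u j)) < (1/2)^k)"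
    by (intro choice allI cau) simp
  then obtain N where N: "\<And>k i j. i \<ge> N k \<Longrightarrow> j \<ge> N k \<Longrightarrow> nrm2 M (axpy (u i) (-1) (u j)) < (1/2)^k" by blast
  \<comment> \<open>A subsequence along which every threshold \<open>N k\<close> is respected.\<close>
  define r where "r k = (\<Sum>i\<le>k. N i) + k" for k
  have rN: "r k \<ge> N k" for k unfolding r_def by (cases k) auto
  have rk: "r k \<ge> k" for k by (simp add: r_def)
  have rSuc: "r (Suc k) \<ge> N k" for k using rN[of k] by (simp add: r_def)
  define d where "d k = axpy (u (r k)) (-1) (u (r (Suc k)))" for k
  have dsq: "d k \<in> sq_integrable M" for k by (simp add: d_def sq_integrable_axpy u)
  have [measurable]: "d k \<in> borel_measurable M" for k using dsq sq_integrableD by blast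
  have dn: "(nrm2 M (d k))\<^sup>2 \<le> (1/4)^k" for k
  proof -
    have "(nrm2 M (d k))\<^sup>2 \<le> ((1/2)^k)\<^sup>2"
      using N[of k "r k" "r (Suc k)"] rN rSuc sq.nrm_nonneg[OF dsq[of k]]
      by (intro power_mono) (auto simp: d_def intro: less_imp_le)
    also have "\<dots> = ((1/2)\<^sup>2)^k" by (simp only: power_mult[symmetric] mult.commute)
    also have "(1/2::real)\<^sup>2 = 1/4" by (simp add: power2_eq_square)
    finally show ?thesis .
  qed
  \<comment> \<open>The weights \<open>2\<^sup>k\<close> keep the series of integrals summable, and boundedness of the terms
    \<open>2\<^sup>k |d\<^sub>k(z)|\<^sup>2\<close> alone makes \<open>\<Sum>\<^sub>k d\<^sub>k(z)\<close> absolutely convergent.\<close>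
  have "(\<integral>\<^sup>+z. (\<Sum>k. ennreal (2^k * (norm (d k z))\<^sup>2)) \<partial>M) = (\<Sum>k. \<integral>\<^sup>+z. ennreal (2^k * (norm (d k z))\<^sup>2) \<partial>M)"
    by (intro nn_integral_suminf) measurable
  also have "\<dots> = (\<Sum>k. ennreal (2^k * (nrm2 M (d k))\<^sup>2))"
    by (simp add: ennreal_mult nn_integral_cmult nn_integral_sq dsq)
  also have "\<dots> \<le> (\<Sum>k. ennreal ((1/2)^k))"
  proof (intro suminf_le)
    fix k
    have "2^k * (nrm2 M (d k))\<^sup>2 \<le> 2^k * (1/4)^k" using dn by (intro mult_left_mono) auto
    also have "\<dots> = (2 * (1/4))^k" by (simp only: power_mult_distrib)
    also have "2 * (1/4) = (1/2::real)" by simp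
    finally show "ennreal (2^k * (nrm2 M (d k))\<^sup>2) \<le> ennreal ((1/2)^k)" by (rule ennreal_leI)
  qed auto
  also have "\<dots> = ennreal (\<Sum>k. (1/2)^k)" by (rule suminf_ennreal2) (auto simp: summable_geometric)
  also have "\<dots> < \<infinity>" by simp
  finally have "AE z in M. (\<Sum>k. ennreal (2^k * (norm (d k z))\<^sup>2)) \<noteq> \<infinity>"
    by (intro nn_integral_PInf_AE) auto
  then have conv: "AE z in M. convergent (\<lambda>k. u (r k) z)"
  proof eventually_elim
    case (elim z)
    have s: "summable (\<lambda>k. 2^k * (norm (d k z))\<^sup>2)"
      by (rule summable_suminf_not_top) (use elim in \<open>auto simp: infinity_ennreal_def\<close>)
    have "sqrt (1/2) < sqrt 1" by (rule real_sqrt_less_mono) simp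
    then have s': "summable (\<lambda>k. (sqrt (1/2))^k)" by (intro summable_geometric) simp
    obtain c where "\<forall>k. norm (2^k * (norm (d k z))\<^sup>2) \<le> c"
      using summable_imp_Bseq[OF s] by (rule BseqE)
    then have c: "2^k * (norm (d k z))\<^sup>2 \<le> c" for k by (simp add: norm_mult norm_power)
    have "norm (d k z) \<le> sqrt c * (sqrt (1/2))^k" for k
    proof (rule power2_le_imp_le)
      have "(norm (d k z))\<^sup>2 \<le> c * (1/2)^k" using c[of k] by (simp add: power_one_over pos_le_divide_eq mult.commute)
      moreover have "0 \<le> c" by (rule order_trans[OF _ c[of 0]]) simp
      moreover have "(sqrt (1/2) ^ k)\<^sup>2 = (1/2::real)^k"
        by (simp only: power_mult[symmetric] mult.commute[of k])
           (simp only: power_mult real_sqrt_pow2_iff, simp)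
      ultimately show "(norm (d k z))\<^sup>2 \<le> (sqrt c * (sqrt (1/2))^k)\<^sup>2"
        by (simp add: power_mult_distrib)
      show "0 \<le> sqrt c * sqrt (1/2)^k" using \<open>0 \<le> c\<close> by simp
    qed
    then have "summable (\<lambda>k. d k z)"
      by (intro summable_comparison_test'[OF summable_mult[OF s', of "sqrt c"]])
    then have "convergent (\<lambda>k. \<Sum>i<k. d i z)" by (simp add: summable_iff_convergent)
    moreover have "(\<Sum>i<k. d i z) = u (r 0) z - u (r k) z" for k
      by (induction k) (auto simp: d_def axpy_def)
    ultimately have "convergent (\<lambda>k. u (r 0) z - u (r k) z)" by simp
    from convergent_diff[OF convergent_const this, of "u (r 0) z"] show ?case by simp
  qed
  define X where "X z = lim (\<lambda>k. u (r k) z)" for z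
  have Xm[measurable]: "X \<in> borel_measurable M" unfolding X_def by measurable
  have Xlim: "AE z in M. (\<lambda>k. u (r k) z) \<longlonglongrightarrow> X z"
    using conv by eventually_elim (simp add: X_def convergent_LIMSEQ_iff)
  have fatou: "(\<integral>\<^sup>+z. ennreal ((norm (u i z - X z))\<^sup>2) \<partial>M) \<le> ennreal (((1/2)^k)\<^sup>2)" if i: "i \<ge> N k" for i k
  proof -
    have "(\<integral>\<^sup>+z. ennreal ((norm (u i z - X z))\<^sup>2) \<partial>M)
        = (\<integral>\<^sup>+z. liminf (\<lambda>j. ennreal ((norm (u i z - u (r j) z))\<^sup>2)) \<partial>M)"
    proof (rule nn_integral_cong_AE)
      show "AE z in M. ennreal ((norm (u i z - X z))\<^sup>2) = liminf (\<lambda>j. ennreal ((norm (u i z - u (r j) z))\<^sup>2))"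
        using Xlim
      proof eventually_elim
        case (elim z)
        have "(\<lambda>j. ennreal ((norm (u i z - u (r j) z))\<^sup>2)) \<longlonglongrightarrow> ennreal ((norm (u i z - X z))\<^sup>2)"
          by (intro tendsto_intros tendsto_ennrealI elim)
        from lim_imp_Liminf[OF trivial_limit_sequentially this] show ?case by simp
      qed
    qed
    also have "\<dots> \<le> liminf (\<lambda>j. \<integral>\<^sup>+z. ennreal ((norm (u i z - u (r j) z))\<^sup>2) \<partial>M)"
      by (rule nn_integral_liminf) measurable
    also have "\<dots> \<le> ennreal (((1/2)^k)\<^sup>2)"
    proof (rule Liminf_le)
      show "\<forall>\<^sub>F j in sequentially. (\<integral>\<^sup>+z. ennreal ((norm (u i z - u (r j) z))\<^sup>2) \<partial>M) \<le> ennreal (((1/2)^k)\<^sup>2)"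
        using eventually_ge_at_top[of "N k"]
      proof eventually_elim
        case (elim j)
        have "r j \<ge> N k" using elim rk[of j] by simp
        then have "nrm2 M (axpy (u i) (-1) (u (r j))) \<le> (1/2)^k" using N[of k i "r j"] i by simp
        then have "(nrm2 M (axpy (u i) (-1) (u (r j))))\<^sup>2 \<le> ((1/2)^k)\<^sup>2"
          by (intro power_mono sq.nrm_nonneg sq_integrable_axpy u)
        moreover have "(\<integral>\<^sup>+z. ennreal ((norm (u i z - u (r j) z))\<^sup>2) \<partial>M) = ennreal ((nrm2 M (axpy (u i) (-1) (u (r j))))\<^sup>2)"
          using nn_integral_sq[OF sq_integrable_axpy[OF u[of i] u[of "r j"], of "-1"]] by (simp add: axpy_def)
        ultimately show ?case by (simp add: ennreal_leI)
      qed
    qed simp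
    finally show ?thesis .
  qed
  have diff: "axpy (u i) (-1) X \<in> sq_integrable M" if "i \<ge> N k" for i k
  proof -
    have "integrable M (\<lambda>z. (norm (u i z - X z))\<^sup>2)"
      using fatou[OF that] by (intro integrableI_bounded) (auto intro: le_less_trans)
    then show ?thesis by (simp add: sq_integrable_def axpy_def)
  qed
  have Xsq: "X \<in> sq_integrable M"
  proof -
    have "axpy (u (N 0)) (-1) (axpy (u (N 0)) (-1) X) \<in> sq_integrable M"
      using sq_integrable_axpy[OF u diff] by blast
    then show ?thesis by (simp add: axpy_def)
  qed
  have le: "nrm2 M (axpy (u i) (-1) X) \<le> (1/2)^k" if "i \<ge> N k" for i k
  proof (rule power2_le_imp_le)
    show "(nrm2 M (axpy (u i) (-1) X))\<^sup>2 \<le> ((1/2)^k)\<^sup>2"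
      using fatou[OF that] nn_integral_sq[OF diff[OF that]] by (simp add: axpy_def)
  qed simp
  have "(\<lambda>k. nrm2 M (axpy (u k) (-1) X)) \<longlonglongrightarrow> 0"
  proof (rule LIMSEQ_I)
    fix e :: real assume "e > 0"
    then obtain k where k: "(1/2)^k < e" using real_arch_pow_inv[of e "1/2"] by auto
    show "\<exists>no. \<forall>n\<ge>no. norm (nrm2 M (axpy (u n) (-1) X) - 0) < e"
      using le[of k] k sq.nrm_nonneg[OF sq_integrable_axpy[OF u Xsq]]
      by (intro exI[of _ "N k"]) (auto intro: le_less_trans)
  qed
  with Xsq show ?thesis by blast
qed

lemma sq_integrable_linear:
  fixes f :: "'x \<Rightarrow> 'b::euclidean_space" and T :: "'b \<Rightarrow> 'c::euclidean_space"
  assumes "linear T" "f \<in> sq_integrable M"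
  shows "(\<lambda>z. T (f z)) \<in> sq_integrable M"
proof -
  have T: "bounded_linear T" using assms(1) by (simp add: linear_conv_bounded_linear)
  obtain K where K: "\<And>x. norm (T x) \<le> norm x * K" using bounded_linear.bounded[OF T] by blast
  show ?thesis
  proof (rule sq_integrable_bound[OF assms(2), where c=K])
    show "(\<lambda>z. T (f z)) \<in> borel_measurable M"
      by (rule measurable_compose[OF sq_integrableD(1)[OF assms(2)] borel_measurable_continuous_onI])
         (rule linear_continuous_on[OF T])
    show "AE z in M. norm (T (f z)) \<le> K * norm (f z)" using K by (simp add: mult.commute)
  qed
qed

section \<open>Smooth functions of compact support\<close>

lemma frechet_eq: "(f has_derivative f') (at x) \<Longrightarrow> frechet_derivative f (at x) = f'"
  by (rule frechet_derivative_at[symmetric])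

lemma has_frechet: "f differentiable (at x) \<Longrightarrow> (f has_derivative frechet_derivative f (at x)) (at x)"
  by (simp add: frechet_derivative_works)

lemma Ck_on_SucD: "Ck_on (Suc k) f UNIV \<Longrightarrow> Ck_on k f UNIV"
proof (induction k arbitrary: f)
  case 0
  then show ?case by (auto intro!: continuous_at_imp_continuous_on differentiable_imp_continuous_within)
next
  case (Suc k)
  then show ?case by (auto simp del: Ck_on.simps(1))
qed

lemma Ck_on_const: "Ck_on k (\<lambda>z. c) UNIV"
proof (induction k arbitrary: c)
  case (Suc k)
  have "frechet_derivative (\<lambda>z. c) (at x) = (\<lambda>v. 0)" for x :: 'a
    by (rule frechet_eq) simp
  with Suc show ?case by simp
qed simp

lemma Ck_on_add: "Ck_on k f UNIV \<Longrightarrow> Ck_on k g UNIV \<Longrightarrow> Ck_on k (\<lambda>z. f z + g z) UNIV"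
proof (induction k arbitrary: f g)
  case 0 then show ?case by (auto intro: continuous_intros)
next
  case (Suc k)
  have *: "((\<lambda>z. f z + g z) has_derivative
      (\<lambda>v. frechet_derivative f (at x) v + frechet_derivative g (at x) v)) (at x)" for x
    using Suc.prems by (intro has_derivative_add has_frechet) auto
  then have "(\<lambda>z. f z + g z) differentiable (at x)" for x by (auto simp: differentiable_def)
  moreover have "frechet_derivative (\<lambda>z. f z + g z) (at x) = (\<lambda>v. frechet_derivative f (at x) v + frechet_derivative g (at x) v)" for x
    by (rule frechet_eq[OF *])
  ultimately show ?case using Suc by simp
qed

lemma Ck_on_mult: "Ck_on k f UNIV \<Longrightarrow> Ck_on k g UNIV \<Longrightarrow> Ck_on k (\<lambda>z. f z * g z) UNIV"
proof (induction k arbitrary: f g)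
  case 0 then show ?case by (auto intro: continuous_intros)
next
  case (Suc k)
  have *: "((\<lambda>z. f z * g z) has_derivative
      (\<lambda>v. f x * frechet_derivative g (at x) v + frechet_derivative f (at x) v * g x)) (at x)" for x
    using Suc.prems by (intro has_derivative_mult has_frechet) auto
  then have "(\<lambda>z. f z * g z) differentiable (at x)" for x by (auto simp: differentiable_def)
  moreover have "frechet_derivative (\<lambda>z. f z * g z) (at x) = (\<lambda>v. f x * frechet_derivative g (at x) v + frechet_derivative f (at x) v * g x)" for x
    by (rule frechet_eq[OF *])
  moreover have "Ck_on k f UNIV" "Ck_on k g UNIV" using Suc.prems Ck_on_SucD by blast+
  ultimately show ?case using Suc by (simp add: Ck_on_add)
qed

lemma Ck_on_prod: "(\<And>i. i \<in> I \<Longrightarrow> Ck_on k (f i) UNIV) \<Longrightarrow> Ck_on k (\<lambda>z. \<Prod>i\<in>I. f i z) UNIV"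
  by (induction I rule: infinite_finite_induct) (auto simp: Ck_on_const Ck_on_mult)

text \<open>The functions \<open>p(1/t) exp(-1/t)\<close>, extended by \<open>0\<close> to \<open>t \<le> 0\<close>. The family, indexed by polynomials \<open>p\<close>, is
  closed under differentiation, which shows that all its members are smooth.\<close>

definition flat :: "real poly \<Rightarrow> real \<Rightarrow> real" where
  "flat p t = (if t > 0 then poly p (1 / t) * exp (- (1 / t)) else 0)"

lemma poly_exp_lim: "((\<lambda>x. poly p x * exp (- x)) \<longlongrightarrow> (0::real)) at_top"
proof -
  have "((\<lambda>x. \<Sum>i\<le>degree p. coeff p i * (x ^ i / exp x)) \<longlongrightarrow> (\<Sum>i\<le>degree p. coeff p i * 0)) at_top"
    by (intro tendsto_intros tendsto_power_div_exp_0)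
  then show ?thesis by (simp add: poly_altdef exp_minus sum_distrib_right divide_inverse mult.assoc)
qed

lemma flat_deriv: "(flat p has_real_derivative flat ([:0, 0, 1:] * (p - pderiv p)) t) (at t)"
proof -
  consider "t > 0" | "t < 0" | "t = 0" by linarith
  then show ?thesis
  proof cases
    case 1
    have "((\<lambda>t. poly p (1 / t) * exp (- (1 / t))) has_real_derivative flat ([:0, 0, 1:] * (p - pderiv p)) t) (at t)"
      using 1 by (auto intro!: derivative_eq_intros DERIV_chain2[OF poly_DERIV] simp: flat_def field_simps power2_eq_square)
    then show ?thesis
      by (rule DERIV_cong_ev[OF refl _ refl, THEN iffD1, rotated])
         (use eventually_gt_at_top in \<open>auto simp: flat_def eventually_nhds intro!: exI[of _ "{0<..}"] 1\<close>)
  next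
    case 2
    have "((\<lambda>t. 0) has_real_derivative flat ([:0, 0, 1:] * (p - pderiv p)) t) (at t)"
      using 2 by (auto simp: flat_def)
    then show ?thesis
      by (rule DERIV_cong_ev[OF refl _ refl, THEN iffD1, rotated])
         (auto simp: flat_def eventually_nhds intro!: exI[of _ "{..<0}"] 2)
  next
    case 3
    have "((\<lambda>h. flat p h / h) \<longlongrightarrow> 0) (at_right 0)"
    proof (rule Lim_transform_eventually)
      have "((\<lambda>h. poly (pCons 0 p) (inverse h) * exp (- inverse h)) \<longlongrightarrow> 0) (at_right 0)"
        by (rule filterlim_compose[OF poly_exp_lim filterlim_inverse_at_top_right])
      then show "((\<lambda>h. poly (pCons 0 p) (inverse h) * exp (- inverse h)) \<longlongrightarrow> 0) (at_right 0)" .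
      show "\<forall>\<^sub>F h in at_right 0. poly (pCons 0 p) (inverse h) * exp (- inverse h) = flat p h / h"
        by (auto simp: eventually_at_right_field flat_def field_simps intro!: exI[of _ 1])
    qed
    moreover have "((\<lambda>h. flat p h / h) \<longlongrightarrow> 0) (at_left 0)"
      by (rule Lim_transform_eventually[OF tendsto_const])
         (auto simp: eventually_at_left_field flat_def intro!: exI[of _ "-1"])
    ultimately have "((\<lambda>h. flat p h / h) \<longlongrightarrow> 0) (at 0)" by (simp add: filterlim_split_at)
    then show ?thesis using 3 by (simp add: DERIV_def flat_def)
  qed
qed

lemma Ck_on_flat: "Ck_on k (\<lambda>z. flat p (c * (z \<bullet> b) + d)) UNIV"
proof (induction k arbitrary: p)
  case 0
  have "continuous_on UNIV (flat p)"
    using flat_deriv by (intro continuous_at_imp_continuous_on) (auto intro: DERIV_isCont)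
  then show ?case by (auto intro!: continuous_on_compose2[of UNIV "flat p"] continuous_intros)
next
  case (Suc k)
  let ?q = "[:0, 0, 1:] * (p - pderiv p)"
  have *: "((\<lambda>z. flat p (c * (z \<bullet> b) + d)) has_derivative
      (\<lambda>v. (c * (v \<bullet> b)) * flat ?q (c * (x \<bullet> b) + d))) (at x)" for x
  proof -
    have "(flat p has_derivative (\<lambda>v. flat ?q (c * (x \<bullet> b) + d) * v)) (at (c * (x \<bullet> b) + d))"
      using flat_deriv[of p "c * (x \<bullet> b) + d"] by (simp only: has_field_derivative_def)
    moreover have "((\<lambda>z. c * (z \<bullet> b) + d) has_derivative (\<lambda>v. c * (v \<bullet> b))) (at x)"
      by (auto intro!: derivative_eq_intros)
    ultimately show ?thesis
      using has_derivative_compose[of "\<lambda>z. c * (z \<bullet> b) + d" "\<lambda>v. c * (v \<bullet> b)" x UNIV "flat p"] by (simp add: mult.commute)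
  qed
  then have "(\<lambda>z. flat p (c * (z \<bullet> b) + d)) differentiable (at x)" for x by (auto simp: differentiable_def)
  moreover note frechet_eq[OF *]
  ultimately show ?case by (simp add: Ck_on_mult Ck_on_const Suc del: mult_pCons_left)
qed

text \<open>A smooth function supported in a box. Both the shift by \<open>1\<close>, which keeps the support compactly inside
  the open box, and the factor \<open>k\<close> are chosen such that the functions converge to the indicator function
  of the box as \<open>k \<rightarrow> \<infinity>\<close>.\<close>

definition bump :: "nat \<Rightarrow> 'a::euclidean_space \<Rightarrow> 'a \<Rightarrow> 'a \<Rightarrow> real" where
  "bump k a b z = (\<Prod>i\<in>Basis. flat 1 (real k * (z \<bullet> i) + (- real k * (a \<bullet> i) - 1)) *
     flat 1 (- real k * (z \<bullet> i) + (real k * (b \<bullet> i) - 1)))"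

lemma smooth_bump: "smooth_on (bump k a b) UNIV"
  unfolding smooth_on_def bump_def by (intro conjI allI Ck_on_prod Ck_on_mult Ck_on_flat) auto

lemma flat_1_bounds: "0 \<le> flat 1 t" "flat 1 t \<le> 1"
  by (auto simp: flat_def)

lemma bump_bounds: "0 \<le> bump k a b z" "bump k a b z \<le> 1"
  unfolding bump_def by (auto intro!: prod_nonneg prod_le_1 mult_le_one simp: flat_1_bounds)

lemma bump_support:
  fixes a b :: "'a::euclidean_space"
  obtains K where "compact K" "K \<subseteq> box a b" "{z. bump k a b z \<noteq> 0} \<subseteq> K"
proof (cases "k = 0")
  case True
  then have "{z. bump k a b z \<noteq> 0} = {}" by (auto simp: bump_def flat_def)
  then show ?thesis using that[of "{}"] by simp
next
  case False
  define o1 where "o1 = (\<Sum>i\<in>Basis. (1 / real k) *\<^sub>R (i::'a))"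
  have o1: "o1 \<bullet> i = 1 / real k" if "i \<in> Basis" for i
    using that by (simp add: o1_def inner_sum_left inner_Basis if_distrib cong: if_cong)
  show ?thesis
  proof
    show "compact (cbox (a + o1) (b - o1))" by simp
    show "cbox (a + o1) (b - o1) \<subseteq> box a b"
    proof
      fix z assume z: "z \<in> cbox (a + o1) (b - o1)"
      have "a \<bullet> i < z \<bullet> i \<and> z \<bullet> i < b \<bullet> i" if "i \<in> Basis" for i
      proof -
        have "a \<bullet> i + 1 / real k \<le> z \<bullet> i \<and> z \<bullet> i \<le> b \<bullet> i - 1 / real k"
          using z that by (simp add: mem_box o1 inner_add_left inner_diff_left)
        moreover have "0 < 1 / real k" using False by simp
        ultimately show ?thesis by linarith
      qed
      then show "z \<in> box a b" by (simp add: mem_box)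
    qed
    show "{z. bump k a b z \<noteq> 0} \<subseteq> cbox (a + o1) (b - o1)"
    proof
      fix z assume "z \<in> {z. bump k a b z \<noteq> 0}"
      then have *: "0 < real k * (z \<bullet> i) + (- real k * (a \<bullet> i) - 1) \<and> 0 < - real k * (z \<bullet> i) + (real k * (b \<bullet> i) - 1)"
        if "i \<in> Basis" for i using that by (auto simp: bump_def flat_def split: if_splits)
      have "a \<bullet> i + 1 / real k \<le> z \<bullet> i \<and> z \<bullet> i \<le> b \<bullet> i - 1 / real k" if "i \<in> Basis" for i
        using *[OF that] False by (simp add: field_simps)
      then show "z \<in> cbox (a + o1) (b - o1)" by (simp add: mem_box o1 inner_add_left inner_diff_left)
    qed
  qed
qed

lemma bump_lim: "(\<lambda>k. bump k a b z) \<longlonglongrightarrow> indicator (box a b) z"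
proof (cases "z \<in> box a b")
  case True
  have fl: "(\<lambda>k. flat 1 (real k * c - 1)) \<longlonglongrightarrow> 1" if "c > 0" for c
  proof -
    have f: "filterlim (\<lambda>k. real k * c - 1) at_top sequentially"
      using filterlim_tendsto_add_at_top[OF tendsto_const[of "-1"]
        filterlim_tendsto_pos_mult_at_top[OF tendsto_const[of c] that filterlim_real_sequentially]]
      by (simp add: algebra_simps)
    have "(\<lambda>k. exp (- (1 / (real k * c - 1)))) \<longlonglongrightarrow> exp (- 0)"
      by (intro tendsto_intros tendsto_divide_0[OF tendsto_const] filterlim_at_top_imp_at_infinity f)
    then have "(\<lambda>k. exp (- (1 / (real k * c - 1)))) \<longlonglongrightarrow> 1" by simp
    then show ?thesis
    proof (rule Lim_transform_eventually)
      show "\<forall>\<^sub>F k in sequentially. exp (- (1 / (real k * c - 1))) = flat 1 (real k * c - 1)"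
        using filterlim_at_top_dense[THEN iffD1, OF f, rule_format, of 0] by eventually_elim (simp add: flat_def)
    qed
  qed
  have "(\<lambda>k. \<Prod>i\<in>Basis. flat 1 (real k * ((z - a) \<bullet> i) - 1) * flat 1 (real k * ((b - z) \<bullet> i) - 1)) \<longlonglongrightarrow> (\<Prod>i\<in>(Basis::'a set). 1 * 1)"
    using True by (intro tendsto_prod tendsto_mult fl) (auto simp: mem_box inner_diff_left)
  moreover have "bump k a b z =
      (\<Prod>i\<in>Basis. flat 1 (real k * ((z - a) \<bullet> i) - 1) * flat 1 (real k * ((b - z) \<bullet> i) - 1))" for k
    unfolding bump_def
    by (intro prod.cong refl arg_cong2[where f="(*)"] arg_cong[where f="flat 1"])
       (simp_all add: inner_diff_left right_diff_distrib)
  ultimately have "(\<lambda>k. bump k a b z) \<longlonglongrightarrow> 1" by (simp only: mult_1 prod.neutral_const)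
  then show ?thesis using True by simp
next
  case False
  have "bump k a b z = 0" for k
  proof -
    obtain K where "K \<subseteq> box a b" "{z. bump k a b z \<noteq> 0} \<subseteq> K" by (rule bump_support)
    with False show ?thesis by auto
  qed
  with False show ?thesis by simp
qed

section \<open>Test functions and the fundamental lemma\<close>

lemma test_functionsD:
  assumes "\<phi> \<in> test_functions \<Omega>"
  shows "Ck_on k \<phi> UNIV" "compact (closure {z. \<phi> z \<noteq> 0})" "closure {z. \<phi> z \<noteq> 0} \<subseteq> \<Omega>"
    "\<phi> differentiable (at z)" "continuous_on UNIV \<phi>" "\<phi> \<in> borel_measurable borel" "z \<notin> \<Omega> \<Longrightarrow> \<phi> z = 0"
proof -
  show k: "Ck_on k \<phi> UNIV" for k using assms by (simp add: test_functions_def smooth_on_def)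
  show "compact (closure {z. \<phi> z \<noteq> 0})" "closure {z. \<phi> z \<noteq> 0} \<subseteq> \<Omega>"
    using assms by (auto simp: test_functions_def)
  show "z \<notin> \<Omega> \<Longrightarrow> \<phi> z = 0" using assms closure_subset[of "{z. \<phi> z \<noteq> 0}"] by (auto simp: test_functions_def)
  show "\<phi> differentiable (at z)" using k[of 1] by simp
  show "continuous_on UNIV \<phi>" using k[of 0] by simp
  then show "\<phi> \<in> borel_measurable borel" by (rule borel_measurable_continuous_onI)
qed

lemma test_functionsI:
  assumes "\<And>k. Ck_on k \<phi> UNIV" "{z. \<phi> z \<noteq> 0} \<subseteq> K" "compact K" "K \<subseteq> \<Omega>"
  shows "\<phi> \<in> test_functions \<Omega>"
proof -
  have "closure {z. \<phi> z \<noteq> 0} \<subseteq> K"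
    using assms(2,3) by (intro closure_minimal compact_imp_closed)
  moreover have "compact (closure {z. \<phi> z \<noteq> 0})"
    using calculation assms(3) by (metis closed_closure compact_Int_closed inf.absorb_iff2)
  ultimately show ?thesis using assms by (auto simp: test_functions_def smooth_on_def)
qed

lemma test_functions_zero: "(\<lambda>z. 0) \<in> test_functions \<Omega>"
  by (rule test_functionsI[of _ "{}"]) (auto simp: Ck_on_const)

lemma test_functions_axpy:
  assumes "\<phi> \<in> test_functions \<Omega>" "\<psi> \<in> test_functions \<Omega>"
  shows "axpy \<phi> c \<psi> \<in> test_functions \<Omega>"
  unfolding axpy_def real_scaleR_def
proof (rule test_functionsI)
  show "Ck_on k (\<lambda>z. \<phi> z + c * \<psi> z) UNIV" for k
    using assms by (intro Ck_on_add Ck_on_mult Ck_on_const test_functionsD)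
  show "{z. \<phi> z + c * \<psi> z \<noteq> 0} \<subseteq> closure {z. \<phi> z \<noteq> 0} \<union> closure {z. \<psi> z \<noteq> 0}"
    using closure_subset[of "{z. \<phi> z \<noteq> 0}"] closure_subset[of "{z. \<psi> z \<noteq> 0}"] by fastforce
qed (use test_functionsD(2,3)[OF assms(1)] test_functionsD(2,3)[OF assms(2)] in auto)

lemma test_functions_mult:
  assumes "\<phi> \<in> test_functions \<Omega>" "\<psi> \<in> test_functions \<Omega>"
  shows "(\<lambda>z. \<phi> z * \<psi> z) \<in> test_functions \<Omega>"
proof (rule test_functionsI)
  show "Ck_on k (\<lambda>z. \<phi> z * \<psi> z) UNIV" for k
    using assms by (intro Ck_on_mult test_functionsD)
  show "{z. \<phi> z * \<psi> z \<noteq> 0} \<subseteq> closure {z. \<phi> z \<noteq> 0}"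
    using closure_subset[of "{z. \<phi> z \<noteq> 0}"] by auto
qed (use test_functionsD(2,3)[OF assms(1)] in auto)

lemma test_functions_pderiv:
  assumes "\<phi> \<in> test_functions \<Omega>"
  shows "pderiv_i i \<phi> \<in> test_functions \<Omega>"
proof (rule test_functionsI)
  show "Ck_on k (pderiv_i i \<phi>) UNIV" for k
    using test_functionsD(1)[OF assms, of "Suc k"] by (simp add: pderiv_i_def[abs_def])
  show "{z. pderiv_i i \<phi> z \<noteq> 0} \<subseteq> closure {z. \<phi> z \<noteq> 0}"
  proof (rule ccontr)
    assume "\<not> ?thesis"
    then obtain z where z: "pderiv_i i \<phi> z \<noteq> 0" "z \<in> - closure {z. \<phi> z \<noteq> 0}" by blast
    have "(\<phi> has_derivative (\<lambda>v. 0)) (at z)"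
    proof (rule has_derivative_transform_within_open[OF has_derivative_const])
      show "open (- closure {z. \<phi> z \<noteq> 0})" by auto
      show "\<And>x. x \<in> - closure {z. \<phi> z \<noteq> 0} \<Longrightarrow> 0 = \<phi> x" using closure_subset[of "{z. \<phi> z \<noteq> 0}"] by auto
    qed fact
    then have "frechet_derivative \<phi> (at z) = (\<lambda>v. 0)" by (rule frechet_eq)
    then show False using z by (simp add: pderiv_i_def)
  qed
qed (use test_functionsD(2,3)[OF assms] in auto)

lemma test_function_bounded:
  assumes "\<phi> \<in> test_functions \<Omega>"
  shows "\<exists>B\<ge>0. \<forall>z. \<bar>\<phi> z\<bar> \<le> B * indicator (closure {z. \<phi> z \<noteq> 0}) z"
proof -
  let ?K = "closure {z. \<phi> z \<noteq> 0}"
  have "compact (\<phi> ` ?K)"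
    by (intro compact_continuous_image continuous_on_subset[OF test_functionsD(5)[OF assms]]
        test_functionsD(2)[OF assms]) simp
  then obtain B where B: "\<And>z. z \<in> ?K \<Longrightarrow> norm (\<phi> z) \<le> B" using compact_imp_bounded bounded_iff by (metis imageI)
  have "\<bar>\<phi> z\<bar> \<le> max B 0 * indicator ?K z" for z
    using B[of z] closure_subset[of "{z. \<phi> z \<noteq> 0}"] by (auto simp: indicator_def max_def)
  then show ?thesis by (intro exI[of _ "max B 0"]) auto
qed

lemma integrable_indicator_compact:
  fixes K :: "'a::euclidean_space set"
  assumes "compact K"
  shows "integrable lborel (indicator K :: 'a \<Rightarrow> real)"
proof (rule integrable_real_indicator)
  show "K \<in> sets lborel" using borel_compact[OF assms] by simp
  show "emeasure lborel K < \<infinity>" by (rule emeasure_compact_finite[OF assms])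
qed

lemma test_function_integrable:
  assumes "\<phi> \<in> test_functions \<Omega>"
  shows "integrable lborel \<phi>"
proof -
  obtain B where B: "B \<ge> 0" "\<And>z. \<bar>\<phi> z\<bar> \<le> B * indicator (closure {z. \<phi> z \<noteq> 0}) z"
    using test_function_bounded[OF assms] by blast
  show ?thesis
  proof (rule Bochner_Integration.integrable_bound)
    show "integrable lborel (\<lambda>z. B * indicator (closure {z. \<phi> z \<noteq> 0}) z)"
      by (intro integrable_mult_right integrable_indicator_compact test_functionsD(2)[OF assms])
    show "AE z in lborel. norm (\<phi> z) \<le> norm (B * indicator (closure {z. \<phi> z \<noteq> 0}) z :: real)"
      using B by (intro AE_I2) (auto simp: abs_mult)
    show "\<phi> \<in> borel_measurable lborel" using test_functionsD(6)[OF assms] by simp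
  qed
qed

lemma integral_lebesgue_on_eq_lborel:
  fixes f :: "'a::euclidean_space \<Rightarrow> real"
  assumes "open \<Omega>" "f \<in> borel_measurable borel" "\<And>z. z \<notin> \<Omega> \<Longrightarrow> f z = 0"
  shows "(LINT z|lebesgue_on \<Omega>. f z) = (LINT z|lborel. f z)"
    and "integrable (lebesgue_on \<Omega>) f \<longleftrightarrow> integrable lborel f"
proof -
  have s: "\<Omega> \<inter> space lebesgue \<in> sets lebesgue" using assms(1) by simp
  have "(\<lambda>z. indicator \<Omega> z *\<^sub>R f z) = f" using assms(3) by (auto simp: indicator_def fun_eq_iff)
  then show "(LINT z|lebesgue_on \<Omega>. f z) = (LINT z|lborel. f z)"
    "integrable (lebesgue_on \<Omega>) f \<longleftrightarrow> integrable lborel f"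
    using assms(2) by (simp_all add: integral_restrict_space[OF s] integrable_restrict_space[OF s]
        integral_completion integrable_completion)
qed

lemma test_function_sq_integrable:
  assumes "open \<Omega>" "\<phi> \<in> test_functions \<Omega>"
  shows "\<phi> \<in> sq_integrable (lebesgue_on \<Omega>)"
proof -
  have "integrable lborel (\<lambda>z. \<phi> z * \<phi> z)" by (rule test_function_integrable[OF test_functions_mult[OF assms(2,2)]])
  then have "integrable (lebesgue_on \<Omega>) (\<lambda>z. \<phi> z * \<phi> z)"
    using assms by (subst integral_lebesgue_on_eq_lborel(2)) (auto simp: test_functionsD(7) intro: test_functionsD(6)[OF test_functions_mult])
  moreover have "\<phi> \<in> borel_measurable (lebesgue_on \<Omega>)"
    using test_functionsD(6)[OF assms(2)] by (intro measurable_restrict_space1 measurable_completion) simp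
  ultimately show ?thesis by (simp add: sq_integrable_def power2_eq_square)
qed

text \<open>By translation invariance of Lebesgue measure the difference quotients of \<open>\<phi>\<close> have integral zero, and
  they converge dominatedly to the derivative.\<close>

lemma integral_pderiv_test_function:
  fixes \<phi> :: "'n::finite pt \<Rightarrow> real"
  assumes phi: "\<phi> \<in> test_functions \<Omega>"
  shows "(LINT z|lborel. pderiv_i i \<phi> z) = 0"
proof -
  define v :: "'n pt" where "v = axis i 1"
  define K where "K = closure {z. \<phi> z \<noteq> 0}"
  \<comment> \<open>All difference quotients with steps in \<open>[0, 1]\<close> vanish off this compact set.\<close>
  define K' where "K' = (\<lambda>p. fst p - snd p *\<^sub>R v) ` (K \<times> {0..1::real})"
  define q where "q k z = (\<phi> (z + (1 / real (Suc k)) *\<^sub>R v) - \<phi> z) * real (Suc k)" for k z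
  have K: "compact K" using phi test_functionsD(2) by (simp add: K_def)
  have K': "compact K'" unfolding K'_def
    by (intro compact_continuous_image compact_Times K compact_Icc) (auto intro!: continuous_intros)
  have phi0: "\<phi> z = 0" if "z \<notin> K" for z using that closure_subset[of "{z. \<phi> z \<noteq> 0}"] by (auto simp: K_def)
  have [measurable]: "\<phi> \<in> borel_measurable borel" using phi by (rule test_functionsD)
  have dphi: "pderiv_i i \<phi> \<in> test_functions \<Omega>" using phi by (rule test_functions_pderiv)
  have [measurable]: "pderiv_i i \<phi> \<in> borel_measurable borel" using dphi by (rule test_functionsD)
  have int: "integrable lborel \<phi>" using phi by (rule test_function_integrable)
  have tr: "integrable lborel (\<lambda>z. \<phi> (z + c))" "(LINT z|lborel. \<phi> (z + c)) = (LINT z|lborel. \<phi> z)" for c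
  proof -
    have d: "distr lborel borel ((+) c) = lborel" by (rule lborel_distr_plus)
    have "integrable (distr lborel borel ((+) c)) \<phi>" using int d by simp
    then show "integrable lborel (\<lambda>z. \<phi> (z + c))"
      by (subst (asm) integrable_distr_eq) (auto simp: add.commute)
    have "(LINT z|distr lborel borel ((+) c). \<phi> z) = (LINT z|lborel. \<phi> (c + z))"
      by (rule integral_distr) auto
    then show "(LINT z|lborel. \<phi> (z + c)) = (LINT z|lborel. \<phi> z)" by (simp add: d add.commute)
  qed
  have q0: "(LINT z|lborel. q k z) = 0" for k
    unfolding q_def using tr int by (simp add: Bochner_Integration.integral_diff)
  obtain B where B: "B \<ge> 0" "\<And>z. \<bar>pderiv_i i \<phi> z\<bar> \<le> B * indicator (closure {z. pderiv_i i \<phi> z \<noteq> 0}) z"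
    using test_function_bounded[OF dphi] by blast
  have Bd: "\<bar>pderiv_i i \<phi> z\<bar> \<le> B" for z using B(2)[of z] B(1) by (auto simp: indicator_def of_bool_def split: if_splits)
  have der: "((\<lambda>s. \<phi> (z + s *\<^sub>R v)) has_real_derivative pderiv_i i \<phi> (z + s *\<^sub>R v)) (at s)" for z s
  proof -
    have "(\<phi> has_derivative frechet_derivative \<phi> (at (z + s *\<^sub>R v))) (at (z + s *\<^sub>R v))"
      using test_functionsD(4)[OF phi] has_frechet by blast
    moreover have "((\<lambda>s. z + s *\<^sub>R v) has_derivative (\<lambda>t. t *\<^sub>R v)) (at s)"
      by (auto intro!: derivative_eq_intros)
    ultimately have *: "((\<lambda>s. \<phi> (z + s *\<^sub>R v)) has_derivative (\<lambda>t. frechet_derivative \<phi> (at (z + s *\<^sub>R v)) (t *\<^sub>R v))) (at s)"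
      using has_derivative_compose by blast
    have "linear (frechet_derivative \<phi> (at (z + s *\<^sub>R v)))"
      using test_functionsD(4)[OF phi] by (rule linear_frechet_derivative)
    then have "(\<lambda>t. frechet_derivative \<phi> (at (z + s *\<^sub>R v)) (t *\<^sub>R v)) = (\<lambda>t. pderiv_i i \<phi> (z + s *\<^sub>R v) * t)"
      by (simp add: linear_scale pderiv_i_def v_def mult.commute)
    with * show ?thesis by (simp add: has_field_derivative_def)
  qed
  have "(\<lambda>k. LINT z|lborel. q k z) \<longlonglongrightarrow> (LINT z|lborel. pderiv_i i \<phi> z)"
  proof (rule integral_dominated_convergence)
    show "integrable lborel (\<lambda>z. B * indicator K' z)"
      by (intro integrable_mult_right integrable_indicator_compact K')
    show "AE z in lborel. (\<lambda>k. q k z) \<longlonglongrightarrow> pderiv_i i \<phi> z"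
    proof (intro AE_I2)
      fix z
      have "((\<lambda>h. (\<phi> (z + h *\<^sub>R v) - \<phi> z) / h) \<longlongrightarrow> pderiv_i i \<phi> z) (at 0)"
        using der[of z 0] by (simp add: DERIV_def)
      moreover have "filterlim (\<lambda>k. 1 / real (Suc k)) (at 0) sequentially"
        by (rule filterlim_atI) (use LIMSEQ_inverse_real_of_nat in \<open>simp_all add: inverse_eq_divide\<close>)
      ultimately have "(\<lambda>k. (\<phi> (z + (1 / real (Suc k)) *\<^sub>R v) - \<phi> z) / (1 / real (Suc k))) \<longlonglongrightarrow> pderiv_i i \<phi> z"
        by (rule filterlim_compose)
      then show "(\<lambda>k. q k z) \<longlonglongrightarrow> pderiv_i i \<phi> z" by (simp add: q_def)
    qed
    show "AE z in lborel. norm (q k z) \<le> B * indicator K' z" for k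
    proof (intro AE_I2)
      fix z
      define t where "t = 1 / real (Suc k)"
      have t: "0 < t" "t \<le> 1" by (auto simp: t_def)
      obtain x where "\<phi> (z + t *\<^sub>R v) - \<phi> (z + 0 *\<^sub>R v) = (t - 0) * pderiv_i i \<phi> (z + x *\<^sub>R v)"
        using MVT2[OF t(1), of "\<lambda>s. \<phi> (z + s *\<^sub>R v)" "\<lambda>s. pderiv_i i \<phi> (z + s *\<^sub>R v)"] der by blast
      then have "q k z = pderiv_i i \<phi> (z + x *\<^sub>R v)"
        by (simp add: q_def t_def)
      then have 1: "norm (q k z) \<le> B" using Bd by simp
      show "norm (q k z) \<le> B * indicator K' z"
      proof (cases "z \<in> K'")
        case False
        have "z + t *\<^sub>R v \<notin> K"
        proof
          assume "z + t *\<^sub>R v \<in> K"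
          then have "(z + t *\<^sub>R v) - t *\<^sub>R v \<in> K'" using t unfolding K'_def
            by (intro image_eqI[of _ _ "(z + t *\<^sub>R v, t)"]) auto
          with False show False by simp
        qed
        moreover have "z \<notin> K"
        proof
          assume "z \<in> K"
          then have "z - 0 *\<^sub>R v \<in> K'" unfolding K'_def
            by (intro image_eqI[of _ _ "(z, 0)"]) auto
          with False show False by simp
        qed
        ultimately have "q k z = 0" by (simp add: q_def phi0 t_def)
        then show ?thesis using False by simp
      qed (use 1 in simp)
    qed
  qed (auto simp: q_def[abs_def])
  then have "(\<lambda>k::nat. 0) \<longlonglongrightarrow> (LINT z|lborel. pderiv_i i \<phi> z)" by (simp only: q0)
  then show ?thesis by (simp add: LIMSEQ_const_iff)
qed

text \<open>Integration by parts.\<close>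

lemma is_weak_deriv_test_function:
  assumes "open \<Omega>" "\<phi> \<in> test_functions \<Omega>"
  shows "is_weak_deriv \<Omega> i \<phi> (pderiv_i i \<phi>)"
  unfolding is_weak_deriv_def
proof
  fix \<psi> assume psi: "\<psi> \<in> test_functions \<Omega>"
  note dpsi = test_functions_pderiv[OF psi, of i] and dphi = test_functions_pderiv[OF assms(2), of i]
  note t1 = test_functions_mult[OF assms(2) dpsi] and t2 = test_functions_mult[OF dphi psi]
  have "pderiv_i i (\<lambda>z. \<phi> z * \<psi> z) z = \<phi> z * pderiv_i i \<psi> z + pderiv_i i \<phi> z * \<psi> z" for z
  proof -
    have "((\<lambda>z. \<phi> z * \<psi> z) has_derivative (\<lambda>v. \<phi> z * frechet_derivative \<psi> (at z) v + frechet_derivative \<phi> (at z) v * \<psi> z)) (at z)"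
      by (intro has_derivative_mult has_frechet test_functionsD(4)[OF psi] test_functionsD(4)[OF assms(2)])
    from frechet_eq[OF this] show ?thesis by (simp add: pderiv_i_def)
  qed
  then have "(LINT z|lborel. \<phi> z * pderiv_i i \<psi> z + pderiv_i i \<phi> z * \<psi> z) = 0"
    using integral_pderiv_test_function[OF test_functions_mult[OF assms(2) psi], of i] by simp
  then have "(LINT z|lborel. \<phi> z * pderiv_i i \<psi> z) + (LINT z|lborel. pderiv_i i \<phi> z * \<psi> z) = 0"
    using test_function_integrable[OF t1] test_function_integrable[OF t2] by (simp add: Bochner_Integration.integral_add)
  then show "(LINT z|lebesgue_on \<Omega>. \<phi> z * pderiv_i i \<psi> z) = - (LINT z|lebesgue_on \<Omega>. pderiv_i i \<phi> z * \<psi> z)"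
    using assms(1) test_functionsD(6,7)[OF t1] test_functionsD(6,7)[OF t2]
    by (simp add: integral_lebesgue_on_eq_lborel)
qed

text \<open>The sets over which \<open>h\<close> has integral zero form a Dynkin system that contains the open boxes, hence all
  Borel sets. The support condition reduces an arbitrary box, and the whole space, to boxes inside
  \<open>box c d\<close>.\<close>

lemma AE_zero_if_box_integrals_zero:
  fixes h :: "'a::euclidean_space \<Rightarrow> real"
  assumes int: "integrable lebesgue h" and supp: "\<And>z. z \<notin> box c d \<Longrightarrow> h z = 0"
    and zero: "\<And>a b. box a b \<subseteq> box c d \<Longrightarrow> (LINT z|lebesgue. indicator (box a b) z * h z) = 0"
  shows "AE z in lebesgue. h z = 0"
proof -
  obtain h' where h'm[measurable]: "h' \<in> borel_measurable lborel" and eq: "AE z in lborel. h z = h' z"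
    using completion_ex_borel_measurable_real[of h lborel] int by auto
  have eqc: "AE z in lebesgue. h z = h' z" using eq by (rule AE_completion)
  have int': "integrable lborel h'"
  proof -
    have "integrable lebesgue h'"
      using int eqc h'm by (subst integrable_cong_AE[of h' _ h]) (auto intro: measurable_completion)
    then show ?thesis by (simp add: integrable_completion)
  qed
  have tr: "(LINT z|lborel. indicator A z * h' z) = (LINT z|lebesgue. indicator A z * h z)" if [measurable]: "A \<in> sets borel" for A
  proof -
    have "(LINT z|lborel. indicator A z * h' z) = (LINT z|lebesgue. indicator A z * h' z)"
      by (subst integral_completion) auto
    also have "\<dots> = (LINT z|lebesgue. indicator A z * h z)"
    proof (rule integral_cong_AE)
      show "AE z in lebesgue. indicator A z * h' z = indicator A z * h z" using eqc by eventually_elim simp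
      show "(\<lambda>z. indicator A z * h' z) \<in> borel_measurable lebesgue" by (rule measurable_completion) measurable
      show "(\<lambda>z. indicator A z * h z) \<in> borel_measurable lebesgue" using int that by (intro borel_measurable_times borel_measurable_indicator) auto
    qed
    finally show ?thesis .
  qed
  have box0: "(LINT z|lborel. indicator (box a b) z * h' z) = 0" for a b
  proof -
    obtain a' b' where ab: "box a b \<inter> box c d = box a' b'" by (rule that[OF box_Int_box])
    have "(\<lambda>z. indicator (box a b) z * h z) = (\<lambda>z. indicator (box a' b') z * h z)"
    proof
      fix z show "indicator (box a b) z * h z = indicator (box a' b') z * h z"
        using supp[of z] ab by (cases "z \<in> box c d") (auto simp: indicator_def)
    qed
    moreover have "box a' b' \<subseteq> box c d" using ab by blast
    ultimately show ?thesis using zero by (simp add: tr)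
  qed
  have all0: "(LINT z|lborel. h' z) = 0"
  proof -
    have "(\<lambda>z. indicator UNIV z * h z) = (\<lambda>z. indicator (box c d) z * h z)"
      using supp by (auto simp: fun_eq_iff indicator_def)
    then have "(LINT z|lebesgue. indicator UNIV z * h z) = 0" by (simp only: zero order_refl)
    then show ?thesis using tr[of UNIV] by simp
  qed
  have "(LINT z|lborel. indicator A z * h' z) = 0" if "A \<in> sets borel" for A
  proof -
    have gen: "A \<in> sigma_sets UNIV (range (\<lambda>(a, b). box a b :: 'a set))" using that by (simp add: borel_eq_box)
    have Pow_UNIV_sub: "range (\<lambda>(a, b). box a b :: 'a set) \<subseteq> Pow UNIV" by simp
    have "Int_stable (range (\<lambda>(a, b). box a b :: 'a set))"
      by (auto simp: Int_stable_def box_Int_box)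
    then show ?thesis using Pow_UNIV_sub gen
    proof (induction A rule: sigma_sets_induct_disjoint)
      case (compl A)
      have [measurable]: "A \<in> sets borel" using compl(1) by (simp add: borel_eq_box)
      have "(LINT z|lborel. indicator (UNIV - A) z * h' z) = (LINT z|lborel. h' z - indicator A z * h' z)"
        by (intro Bochner_Integration.integral_cong) (auto simp: indicator_def)
      also have "\<dots> = (LINT z|lborel. h' z) - (LINT z|lborel. indicator A z * h' z)"
        using int' integrable_real_mult_indicator[of A lborel h'] by (intro Bochner_Integration.integral_diff) (auto simp: mult.commute)
      finally show ?case using compl all0 by simp
    next
      case (union A)
      have [measurable]: "A i \<in> sets borel" for i using union(2) by (auto simp: borel_eq_box)
      have "set_integrable lborel (\<Union>i. A i) h'"
        unfolding set_integrable_def by (intro integrable_mult_indicator int') measurable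
      then have "(LINT z:(\<Union>i. A i)|lborel. h' z) = (\<Sum>i. (LINT z:(A i)|lborel. h' z))"
        using union(1) by (intro lebesgue_integral_countable_add) (auto simp: disjoint_family_on_def)
      then show ?case using union(3) by (simp add: set_lebesgue_integral_def)
    qed (auto simp: box0)
  qed
  then have "AE z in lborel. h' z = 0"
    by (intro sigma_finite_measure.density_zero[OF sigma_finite_lborel int']) (simp add: set_lebesgue_integral_def)
  then have "AE z in lebesgue. h' z = 0" by (rule AE_completion)
  with eqc show ?thesis by eventually_elim simp
qed

text \<open>Testing against the bump functions of an open box shows that the integral of \<open>g\<close> over the box vanishes.\<close>

lemma fundamental_lemma_calculus_of_variations:
  fixes g :: "'n::finite pt \<Rightarrow> real"
  assumes op: "open \<Omega>" and g: "g \<in> sq_integrable (lebesgue_on \<Omega>)"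
    and zero: "\<And>\<phi>. \<phi> \<in> test_functions \<Omega> \<Longrightarrow> (LINT z|lebesgue_on \<Omega>. g z * \<phi> z) = 0"
  shows "AE z in lebesgue_on \<Omega>. g z = 0"
proof -
  have s: "\<Omega> \<inter> space lebesgue \<in> sets lebesgue" using op by simp
  have ind: "(indicator (box a b) :: 'n pt \<Rightarrow> real) \<in> sq_integrable (lebesgue_on \<Omega>)" if "box a b \<subseteq> \<Omega>" for a b :: "'n pt"
  proof -
    have "integrable lborel (indicator (box a b) :: 'n pt \<Rightarrow> real)"
      by (rule integrable_real_indicator) (use emeasure_lborel_box_finite[of a b] in \<open>auto simp: infinity_ennreal_def\<close>)
    then have "integrable (lebesgue_on \<Omega>) (indicator (box a b) :: 'n pt \<Rightarrow> real)"
      using that op by (subst integral_lebesgue_on_eq_lborel) (auto simp: indicator_def)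
    moreover have "(norm (indicator (box a b) z :: real))\<^sup>2 = indicator (box a b) z" for z by (simp add: indicator_def)
    ultimately show ?thesis by (simp add: sq_integrable_def)
  qed
  have bx: "(LINT z|lebesgue_on \<Omega>. g z * indicator (box a b) z) = 0"
    "integrable (lebesgue_on \<Omega>) (\<lambda>z. g z * indicator (box a b) z)" if ab: "box a b \<subseteq> \<Omega>" for a b
  proof -
    show i: "integrable (lebesgue_on \<Omega>) (\<lambda>z. g z * indicator (box a b) z)"
      using sq_integrable_inner[OF g ind[OF ab]] by simp
    have t: "bump k a b \<in> test_functions \<Omega>" for k
    proof -
      obtain K where "compact K" "K \<subseteq> box a b" "{z. bump k a b z \<noteq> 0} \<subseteq> K" by (rule bump_support)
      then show ?thesis using smooth_bump[of k a b] ab by (intro test_functionsI[of _ K]) (auto simp: smooth_on_def)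
    qed
    have "(\<lambda>k. LINT z|lebesgue_on \<Omega>. g z * bump k a b z) \<longlonglongrightarrow> (LINT z|lebesgue_on \<Omega>. g z * indicator (box a b) z)"
    proof (rule integral_dominated_convergence)
      show "integrable (lebesgue_on \<Omega>) (\<lambda>z. \<bar>g z * indicator (box a b) z\<bar>)" using i by simp
      show "AE z in lebesgue_on \<Omega>. (\<lambda>k. g z * bump k a b z) \<longlonglongrightarrow> g z * indicator (box a b) z"
        by (intro AE_I2 tendsto_intros bump_lim)
      show "AE z in lebesgue_on \<Omega>. norm (g z * bump k a b z) \<le> \<bar>g z * indicator (box a b) z\<bar>" for k
      proof (intro AE_I2)
        fix z
        show "norm (g z * bump k a b z) \<le> \<bar>g z * indicator (box a b) z\<bar>"
        proof (cases "z \<in> box a b")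
          case True
          then show ?thesis using mult_left_mono[OF bump_bounds(2)[of k a b z], of "\<bar>g z\<bar>"] bump_bounds(1)[of k a b z]
            by (simp add: abs_mult)
        next
          case False
          moreover obtain K where "K \<subseteq> box a b" "{z. bump k a b z \<noteq> 0} \<subseteq> K" by (rule bump_support)
          ultimately have "bump k a b z = 0" by auto
          then show ?thesis by simp
        qed
      qed
      show "(\<lambda>z. g z * bump k a b z) \<in> borel_measurable (lebesgue_on \<Omega>)" for k
        using sq_integrableD(1)[OF g] sq_integrableD(1)[OF test_function_sq_integrable[OF op t]] by simp
    qed (use i in auto)
    then show "(LINT z|lebesgue_on \<Omega>. g z * indicator (box a b) z) = 0"
      using zero[OF t] by (simp add: LIMSEQ_const_iff)
  qed
  obtain \<D> where D: "countable \<D>" "\<D> \<subseteq> Pow \<Omega>" "\<And>X. X \<in> \<D> \<Longrightarrow> \<exists>a b. X = box a b" "\<Union>\<D> = \<Omega>"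
    using open_countable_Union_open_box[OF op] by metis
  have "AE z in lebesgue. z \<in> X \<longrightarrow> g z = 0" if X: "X \<in> \<D>" for X
  proof -
    obtain c d where X_eq: "X = box c d" using D(3)[OF X] by blast
    have sub: "box c d \<subseteq> \<Omega>" using D(2) X X_eq by auto
    define h where "h z = indicator (box c d) z * g z" for z
    have ieq: "indicator \<Omega> z *\<^sub>R (g z * indicator (box a b) z) = indicator (box a b) z * g z" if "box a b \<subseteq> \<Omega>" for a b z
      using that by (auto simp: indicator_def)
    have "AE z in lebesgue. h z = 0"
    proof (rule AE_zero_if_box_integrals_zero[of h c d])
      show "integrable lebesgue h" using bx(2)[OF sub] unfolding integrable_restrict_space[OF s] ieq[OF sub] h_def .
      show "h z = 0" if "z \<notin> box c d" for z using that by (simp add: h_def)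
      show "(LINT z|lebesgue. indicator (box a b) z * h z) = 0" if ab: "box a b \<subseteq> box c d" for a b
      proof -
        have b: "box a b \<subseteq> \<Omega>" using ab sub by blast
        have "indicator (box a b) z * h z = indicator (box a b) z * g z" for z
          using ab by (auto simp: h_def indicator_def)
        then have "(LINT z|lebesgue. indicator (box a b) z * h z) = (LINT z|lebesgue. indicator (box a b) z * g z)"
          by (simp only:)
        also have "\<dots> = (LINT z|lebesgue_on \<Omega>. g z * indicator (box a b) z)"
          unfolding integral_restrict_space[OF s] ieq[OF b] ..
        finally show ?thesis using bx(1)[OF b] by (simp only:)
      qed
    qed
    then show ?thesis by eventually_elim (auto simp: h_def X_eq)
  qed
  then have "AE z in lebesgue. \<forall>X\<in>\<D>. z \<in> X \<longrightarrow> g z = 0" using D(1) by (rule AE_ball_countable')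
  then have "AE z in lebesgue. z \<in> \<Omega> \<longrightarrow> g z = 0" by eventually_elim (use D(4) in blast)
  then show ?thesis by (simp add: AE_restrict_space_iff[OF s])
qed

section \<open>Sobolev functions\<close>

lemma borel_measurable_vecI:
  fixes f :: "'x \<Rightarrow> 'b::euclidean_space ^ 'n::finite"
  assumes "\<And>i. (\<lambda>z. f z $ i) \<in> borel_measurable M"
  shows "f \<in> borel_measurable M"
proof (subst borel_measurable_euclidean_space, intro ballI)
  fix b :: "'b ^ 'n" assume "b \<in> Basis"
  then obtain i u where "b = axis i u" by (auto simp: Basis_vec_def)
  then show "(\<lambda>z. f z \<bullet> b) \<in> borel_measurable M"
    using assms[of i] by (simp add: inner_axis)
qed

lemma norm_vec_sq: "(norm x)\<^sup>2 = (\<Sum>i\<in>UNIV. (norm (x $ i))\<^sup>2)"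
  by (simp add: norm_vec_def L2_set_def sum_nonneg)

lemma sq_integrable_vecI:
  fixes f :: "'x \<Rightarrow> 'b::euclidean_space ^ 'n::finite"
  assumes "\<And>i. (\<lambda>z. f z $ i) \<in> sq_integrable M"
  shows "f \<in> sq_integrable M"
  unfolding sq_integrable_def norm_vec_sq
  using sq_integrableD[OF assms] by (auto intro!: borel_measurable_vecI)

lemma norm_vec_nth_le: "norm (x $ i) \<le> norm x"
  unfolding norm_vec_def by (rule member_le_L2_set) auto

lemma norm_fst_le': "norm (fst p) \<le> norm p" and norm_snd_le': "norm (snd p) \<le> norm p"
  using norm_fst_le[of "fst p" "snd p"] norm_snd_le[of "snd p" "fst p"] by simp_all

lemma sq_integrable_vec_nth:
  fixes f :: "'x \<Rightarrow> 'b::euclidean_space ^ 'n::finite"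
  assumes "f \<in> sq_integrable M"
  shows "(\<lambda>z. f z $ i) \<in> sq_integrable M"
  by (rule sq_integrable_linear[OF _ assms]) (auto intro: linearI)

lemma sq_integrable_Pair:
  assumes "f \<in> sq_integrable M" "g \<in> sq_integrable M"
  shows "(\<lambda>z. (f z, g z)) \<in> sq_integrable M"
  using sq_integrableD[OF assms(1)] sq_integrableD[OF assms(2)]
  by (simp add: sq_integrable_def norm_Pair)

lemma sq_integrable_fst:
  fixes X :: "'x \<Rightarrow> 'b::euclidean_space \<times> 'c::euclidean_space"
  assumes "X \<in> sq_integrable M"
  shows "(\<lambda>z. fst (X z)) \<in> sq_integrable M"
  by (rule sq_integrable_linear[OF linear_fst assms])

lemma sq_integrable_snd:
  fixes X :: "'x \<Rightarrow> 'b::euclidean_space \<times> 'c::euclidean_space"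
  assumes "X \<in> sq_integrable M"
  shows "(\<lambda>z. snd (X z)) \<in> sq_integrable M"
  by (rule sq_integrable_linear[OF linear_snd assms])

lemma is_weak_deriv_ip2:
  "is_weak_deriv \<Omega> i u g \<longleftrightarrow>
    (\<forall>\<phi>\<in>test_functions \<Omega>. ip2 (lebesgue_on \<Omega>) u (pderiv_i i \<phi>) = - ip2 (lebesgue_on \<Omega>) g \<phi>)"
  by (simp add: is_weak_deriv_def ip2_def)

lemma is_weak_deriv_axpy:
  assumes "open \<Omega>" "u \<in> L2 \<Omega>" "v \<in> L2 \<Omega>" "g \<in> L2 \<Omega>" "h \<in> L2 \<Omega>"
    "is_weak_deriv \<Omega> i u g" "is_weak_deriv \<Omega> i v h"
  shows "is_weak_deriv \<Omega> i (axpy u c v) (axpy g c h)"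
  unfolding is_weak_deriv_ip2
proof
  fix \<phi> assume phi: "\<phi> \<in> test_functions \<Omega>"
  have "\<phi> \<in> sq_integrable (lebesgue_on \<Omega>)" "pderiv_i i \<phi> \<in> sq_integrable (lebesgue_on \<Omega>)"
    using test_function_sq_integrable assms(1) phi test_functions_pderiv by blast+
  then show "ip2 (lebesgue_on \<Omega>) (axpy u c v) (pderiv_i i \<phi>) = - ip2 (lebesgue_on \<Omega>) (axpy g c h) \<phi>"
    using assms phi by (simp add: sq.ip_axpy L2_eq is_weak_deriv_ip2)
qed

lemma weak_deriv_unique:
  assumes "open \<Omega>" "g \<in> L2 \<Omega>" "h \<in> L2 \<Omega>" "is_weak_deriv \<Omega> i u g" "is_weak_deriv \<Omega> i u h"
  shows "AE z in lebesgue_on \<Omega>. g z = h z"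
proof -
  have "AE z in lebesgue_on \<Omega>. axpy g (-1) h z = 0"
  proof (rule fundamental_lemma_calculus_of_variations[OF assms(1)])
    show "axpy g (-1) h \<in> sq_integrable (lebesgue_on \<Omega>)"
      using assms by (simp add: L2_eq sq_integrable_axpy)
    fix \<phi> assume phi: "\<phi> \<in> test_functions \<Omega>"
    then have "\<phi> \<in> sq_integrable (lebesgue_on \<Omega>)" using test_function_sq_integrable assms(1) by blast
    then have "ip2 (lebesgue_on \<Omega>) (axpy g (-1) h) \<phi> = ip2 (lebesgue_on \<Omega>) g \<phi> - ip2 (lebesgue_on \<Omega>) h \<phi>"
      using assms by (simp add: sq.ip_axpy L2_eq)
    also have "\<dots> = 0" using assms(4,5) phi by (auto simp: is_weak_deriv_ip2)
    finally show "(LINT z|lebesgue_on \<Omega>. axpy g (-1) h z * \<phi> z) = 0" by (simp add: ip2_def)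
  qed
  then show ?thesis by eventually_elim (simp add: axpy_def)
qed

lemma H1_weak_deriv:
  assumes "u \<in> H1 \<Omega>"
  shows "weak_deriv \<Omega> i u \<in> L2 \<Omega>" "is_weak_deriv \<Omega> i u (weak_deriv \<Omega> i u)" "u \<in> L2 \<Omega>"
proof -
  have "\<exists>g. g \<in> L2 \<Omega> \<and> is_weak_deriv \<Omega> i u g" using assms by (auto simp: H1_def)
  from someI_ex[OF this] show "weak_deriv \<Omega> i u \<in> L2 \<Omega>" "is_weak_deriv \<Omega> i u (weak_deriv \<Omega> i u)"
    by (simp_all add: weak_deriv_def)
  show "u \<in> L2 \<Omega>" using assms by (simp add: H1_def)
qed

lemma L2_axpy: "f \<in> L2 \<Omega> \<Longrightarrow> g \<in> L2 \<Omega> \<Longrightarrow> axpy f c g \<in> L2 \<Omega>"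
  by (simp add: L2_eq sq_integrable_axpy)

lemma is_weak_deriv_H1_axpy:
  assumes "open \<Omega>" "u \<in> H1 \<Omega>" "v \<in> H1 \<Omega>"
  shows "is_weak_deriv \<Omega> i (axpy u c v) (axpy (weak_deriv \<Omega> i u) c (weak_deriv \<Omega> i v))"
  using assms(1) H1_weak_deriv(3)[OF assms(2)] H1_weak_deriv(3)[OF assms(3)]
    H1_weak_deriv(1,2)[OF assms(2), of i] H1_weak_deriv(1,2)[OF assms(3), of i]
  by (intro is_weak_deriv_axpy)

lemma H1_axpy:
  assumes "open \<Omega>" "u \<in> H1 \<Omega>" "v \<in> H1 \<Omega>"
  shows "axpy u c v \<in> H1 \<Omega>"
proof -
  have "axpy u c v \<in> L2 \<Omega>" "axpy (weak_deriv \<Omega> i u) c (weak_deriv \<Omega> i v) \<in> L2 \<Omega>" for i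
    using H1_weak_deriv(3)[OF assms(2)] H1_weak_deriv(3)[OF assms(3)]
    H1_weak_deriv(1,2)[OF assms(2), of i] H1_weak_deriv(1,2)[OF assms(3), of i] by (simp_all add: L2_axpy)
  then show ?thesis using is_weak_deriv_H1_axpy[OF assms] unfolding H1_def by blast
qed

text \<open>Linearity holds only almost everywhere, as the weak derivative is an arbitrary representative.\<close>

lemma weak_deriv_axpy:
  assumes "open \<Omega>" "u \<in> H1 \<Omega>" "v \<in> H1 \<Omega>"
  shows "AE z in lebesgue_on \<Omega>. weak_deriv \<Omega> i (axpy u c v) z = weak_deriv \<Omega> i u z + c * weak_deriv \<Omega> i v z"
proof -
  note h = H1_weak_deriv(1,2)[OF H1_axpy[OF assms, of c], of i]
  have "AE z in lebesgue_on \<Omega>. weak_deriv \<Omega> i (axpy u c v) z = axpy (weak_deriv \<Omega> i u) c (weak_deriv \<Omega> i v) z"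
    by (rule weak_deriv_unique[OF assms(1) h(1) L2_axpy[OF H1_weak_deriv(1)[OF assms(2)] H1_weak_deriv(1)[OF assms(3)]]
        h(2) is_weak_deriv_H1_axpy[OF assms]])
  then show ?thesis by (simp add: axpy_def)
qed

lemma test_functions_H1: "open \<Omega> \<Longrightarrow> \<phi> \<in> test_functions \<Omega> \<Longrightarrow> \<phi> \<in> H1 \<Omega>"
  unfolding H1_def L2_eq
  using test_function_sq_integrable test_functions_pderiv is_weak_deriv_test_function by blast

text \<open>A scalar function together with its weak gradient.\<close>

definition jet :: "'n::finite pt set \<Rightarrow> ('n pt \<Rightarrow> real) \<Rightarrow> 'n pt \<Rightarrow> real \<times> (real ^ 'n)" where
  "jet \<Omega> u z = (u z, \<chi> i. weak_deriv \<Omega> i u z)"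

lemma jet_sq_integrable: "u \<in> H1 \<Omega> \<Longrightarrow> jet \<Omega> u \<in> sq_integrable (lebesgue_on \<Omega>)"
  unfolding jet_def[abs_def]
  by (intro sq_integrable_Pair sq_integrable_vecI) (simp_all add: H1_weak_deriv flip: L2_eq)

lemma H1_norm_eq: 
  assumes "u \<in> H1 \<Omega>" shows "H1_norm \<Omega> u = nrm2 (lebesgue_on \<Omega>) (jet \<Omega> u)"
proof -
  have "integrable (lebesgue_on \<Omega>) (\<lambda>z. (u z)\<^sup>2)" "integrable (lebesgue_on \<Omega>) (\<lambda>z. (weak_deriv \<Omega> i u z)\<^sup>2)" for i
    using sq_integrableD(2)[of u] sq_integrableD(2)[of "weak_deriv \<Omega> i u"] H1_weak_deriv[OF assms] by (auto simp: L2_eq)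
  then show ?thesis
    by (simp add: H1_norm_def nrm2_eq jet_def norm_Pair norm_vec_sq sum_nonneg)
qed

lemma jet_axpy:
  assumes "open \<Omega>" "u \<in> H1 \<Omega>" "v \<in> H1 \<Omega>"
  shows "AE z in lebesgue_on \<Omega>. jet \<Omega> (axpy u c v) z = axpy (jet \<Omega> u) c (jet \<Omega> v) z"
proof -
  have "AE z in lebesgue_on \<Omega>. \<forall>i. weak_deriv \<Omega> i (axpy u c v) z = weak_deriv \<Omega> i u z + c * weak_deriv \<Omega> i v z"
    using weak_deriv_axpy[OF assms] by (simp add: AE_all_countable)
  then show ?thesis by eventually_elim (simp add: jet_def axpy_def vec_eq_iff)
qed

lemma nrm2_jet_axpy:
  assumes "open \<Omega>" "u \<in> H1 \<Omega>" "v \<in> H1 \<Omega>"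
  shows "nrm2 (lebesgue_on \<Omega>) (jet \<Omega> (axpy u c v)) = nrm2 (lebesgue_on \<Omega>) (axpy (jet \<Omega> u) c (jet \<Omega> v))"
  using assms by (intro nrm2_cong jet_axpy sq_integrableD(1) sq_integrable_axpy jet_sq_integrable H1_axpy)

lemma H1_norm_axpy:
  assumes "open \<Omega>" "u \<in> H1 \<Omega>" "v \<in> H1 \<Omega>"
  shows "H1_norm \<Omega> (axpy u c v) \<le> H1_norm \<Omega> u + \<bar>c\<bar> * H1_norm \<Omega> v"
  using assms sq.nrm_axpy[OF jet_sq_integrable[OF assms(2)] jet_sq_integrable[OF assms(3)], of c]
  by (simp add: H1_norm_eq H1_axpy nrm2_jet_axpy)

lemma H10_iff:
  "u \<in> H10 \<Omega> \<longleftrightarrow> u \<in> H1 \<Omega> \<and> (\<forall>e>0. \<exists>\<phi>\<in>test_functions \<Omega>. H1_norm \<Omega> (axpy u (-1) \<phi>) < e)"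
  by (simp add: H10_def axpy_def)

lemma H10_axpy:
  assumes op: "open \<Omega>" and u: "u \<in> H10 \<Omega>" and v: "v \<in> H10 \<Omega>"
  shows "axpy u c v \<in> H10 \<Omega>"
  unfolding H10_iff
proof (intro conjI allI impI)
  have H1: "u \<in> H1 \<Omega>" "v \<in> H1 \<Omega>" using u v by (auto simp: H10_iff)
  show "axpy u c v \<in> H1 \<Omega>" using H1 op by (intro H1_axpy)
  fix e :: real assume e: "e > 0"
  then have "e / 2 > 0" "e / (2 * (\<bar>c\<bar> + 1)) > 0" by auto
  then obtain \<phi> \<psi> where t: "\<phi> \<in> test_functions \<Omega>" "\<psi> \<in> test_functions \<Omega>"
    and n: "H1_norm \<Omega> (axpy u (-1) \<phi>) < e / 2" "H1_norm \<Omega> (axpy v (-1) \<psi>) < e / (2 * (\<bar>c\<bar> + 1))"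
    using u v unfolding H10_iff by meson
  have d: "axpy u (-1) \<phi> \<in> H1 \<Omega>" "axpy v (-1) \<psi> \<in> H1 \<Omega>"
    using H1 by (auto intro!: H1_axpy op test_functions_H1[OF op t(1)] test_functions_H1[OF op t(2)])
  have eq: "axpy (axpy u c v) (-1) (axpy \<phi> c \<psi>) = axpy (axpy u (-1) \<phi>) c (axpy v (-1) \<psi>)"
    by (simp add: axpy_def algebra_simps)
  have "\<bar>c\<bar> * H1_norm \<Omega> (axpy v (-1) \<psi>) \<le> \<bar>c\<bar> * (e / (2 * (\<bar>c\<bar> + 1)))"
    using n by (intro mult_left_mono) auto
  also have "\<dots> \<le> e / 2" using e by (simp add: field_simps)
  finally have "H1_norm \<Omega> (axpy (axpy u c v) (-1) (axpy \<phi> c \<psi>)) < e"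
    unfolding eq using H1_norm_axpy[OF op d, of c] n by linarith
  then show "\<exists>\<phi>\<in>test_functions \<Omega>. H1_norm \<Omega> (axpy (axpy u c v) (-1) \<phi>) < e"
    using test_functions_axpy[OF t] by blast
qed

lemma H10_zero:
  assumes "open \<Omega>" shows "(\<lambda>z. 0) \<in> H10 \<Omega>"
  unfolding H10_iff
proof (intro conjI allI impI)
  show H: "(\<lambda>z. 0) \<in> H1 \<Omega>" using assms test_functions_H1 test_functions_zero by blast
  have z: "axpy (\<lambda>z. 0) (-1) (\<lambda>z. 0) = (\<lambda>z. 0 :: real)" by (simp add: axpy_def)
  have "nrm2 (lebesgue_on \<Omega>) (jet \<Omega> (axpy (\<lambda>z. 0) (-1) (\<lambda>z. 0))) = 0"
    unfolding nrm2_jet_axpy[OF assms H H] by (simp add: axpy_def nrm2_eq)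
  then have "H1_norm \<Omega> (axpy (\<lambda>z. 0) (-1) (\<lambda>z. 0)) = 0" using H by (simp add: z H1_norm_eq)
  then show "\<exists>\<phi>\<in>test_functions \<Omega>. H1_norm \<Omega> (axpy (\<lambda>z. 0) (-1) \<phi>) < e" if "e > 0" for e
    using test_functions_zero that by metis
qed

lemma nrm2_tendsto_imp_ip2_tendsto:
  assumes "\<And>k. u k \<in> sq_integrable M" "X \<in> sq_integrable M" "Y \<in> sq_integrable M"
    "(\<lambda>k. nrm2 M (axpy (u k) (-1) X)) \<longlonglongrightarrow> 0"
  shows "(\<lambda>k. ip2 M (u k) Y) \<longlonglongrightarrow> ip2 M X Y"
proof -
  have b: "\<bar>ip2 M (u k) Y - ip2 M X Y\<bar> \<le> nrm2 M (axpy (u k) (-1) X) * nrm2 M Y" for k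
    using sq.ip_bound[OF sq_integrable_axpy[OF assms(1)[of k] assms(2), of "-1"] assms(3)] assms(1-3)
    by (simp add: sq.ip_axpy)
  have "(\<lambda>k. nrm2 M (axpy (u k) (-1) X) * nrm2 M Y) \<longlonglongrightarrow> 0" by (rule tendsto_mult_left_zero[OF assms(4)])
  then have "(\<lambda>k. ip2 M (u k) Y - ip2 M X Y) \<longlonglongrightarrow> 0"
    by (rule Lim_null_comparison[rotated]) (simp add: b)
  then show ?thesis by (simp add: LIM_zero_iff)
qed

text \<open>The jets of functions in \<open>H\<^sup>1\<^sub>0\<close> form a closed subspace of \<open>L\<^sup>2\<close>: weak derivatives pass to \<open>L\<^sup>2\<close> limits, and a
  limit of limits of test functions is a limit of test functions.\<close>

lemma H10_closed:
  assumes op: "open \<Omega>" and u: "\<And>k. u k \<in> H10 \<Omega>"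
    and X: "X \<in> sq_integrable (lebesgue_on \<Omega>)"
    and lim: "(\<lambda>k. nrm2 (lebesgue_on \<Omega>) (axpy (jet \<Omega> (u k)) (-1) X)) \<longlonglongrightarrow> 0"
  shows "(\<lambda>z. fst (X z)) \<in> H10 \<Omega>" "AE z in lebesgue_on \<Omega>. jet \<Omega> (\<lambda>z. fst (X z)) z = X z"
proof -
  let ?M = "lebesgue_on \<Omega>"
  define v where "v z = fst (X z)" for z
  define g where "g i z = snd (X z) $ i" for i z
  have uH1: "u k \<in> H1 \<Omega>" for k using u by (simp add: H10_iff)
  have jd: "axpy (jet \<Omega> (u k)) (-1) X \<in> sq_integrable ?M" for k
    using uH1 X by (intro sq_integrable_axpy jet_sq_integrable)
  have vL: "v \<in> sq_integrable ?M" unfolding v_def[abs_def] by (rule sq_integrable_fst[OF X])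
  have gL: "g i \<in> sq_integrable ?M" for i unfolding g_def[abs_def]
    by (rule sq_integrable_vec_nth[OF sq_integrable_snd[OF X]])
  have uL: "u k \<in> sq_integrable ?M" and dL: "weak_deriv \<Omega> i (u k) \<in> sq_integrable ?M" for k i
    using H1_weak_deriv[OF uH1] by (auto simp: L2_eq)
  have l1: "(\<lambda>k. nrm2 ?M (axpy (u k) (-1) v)) \<longlonglongrightarrow> 0"
  proof (rule Lim_null_comparison[OF _ lim], intro always_eventually allI)
    fix k
    have "nrm2 ?M (axpy (u k) (-1) v) \<le> 1 * nrm2 ?M (axpy (jet \<Omega> (u k)) (-1) X)"
    proof (rule nrm2_bound[OF jd sq_integrableD(1)[OF sq_integrable_axpy[OF uL vL]]])
      have "norm (axpy (u k) (-1) v z) \<le> 1 * norm (axpy (jet \<Omega> (u k)) (-1) X z)" for z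
        using norm_fst_le'[of "axpy (jet \<Omega> (u k)) (-1) X z"]
        by (simp add: axpy_def v_def jet_def)
      then show "AE z in ?M. norm (axpy (u k) (-1) v z) \<le> 1 * norm (axpy (jet \<Omega> (u k)) (-1) X z)" by simp
    qed simp
    then show "norm (nrm2 ?M (axpy (u k) (-1) v)) \<le> nrm2 ?M (axpy (jet \<Omega> (u k)) (-1) X)"
      using sq.nrm_nonneg[OF sq_integrable_axpy[OF uL vL]] by simp
  qed
  have l2: "(\<lambda>k. nrm2 ?M (axpy (weak_deriv \<Omega> i (u k)) (-1) (g i))) \<longlonglongrightarrow> 0" for i
  proof (rule Lim_null_comparison[OF _ lim], intro always_eventually allI)
    fix k
    have "nrm2 ?M (axpy (weak_deriv \<Omega> i (u k)) (-1) (g i)) \<le> 1 * nrm2 ?M (axpy (jet \<Omega> (u k)) (-1) X)"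
    proof (rule nrm2_bound[OF jd sq_integrableD(1)[OF sq_integrable_axpy[OF dL gL]]])
      have "norm (axpy (weak_deriv \<Omega> i (u k)) (-1) (g i) z) \<le> 1 * norm (axpy (jet \<Omega> (u k)) (-1) X z)" for z
      proof -
        have "axpy (weak_deriv \<Omega> i (u k)) (-1) (g i) z = snd (axpy (jet \<Omega> (u k)) (-1) X z) $ i"
          by (simp add: axpy_def g_def jet_def)
        also have "norm \<dots> \<le> norm (snd (axpy (jet \<Omega> (u k)) (-1) X z))" by (rule norm_vec_nth_le)
        also have "\<dots> \<le> norm (axpy (jet \<Omega> (u k)) (-1) X z)" by (rule norm_snd_le')
        finally show ?thesis by simp
      qed
      then show "AE z in ?M. norm (axpy (weak_deriv \<Omega> i (u k)) (-1) (g i) z) \<le> 1 * norm (axpy (jet \<Omega> (u k)) (-1) X z)" by simp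
    qed simp
    then show "norm (nrm2 ?M (axpy (weak_deriv \<Omega> i (u k)) (-1) (g i))) \<le> nrm2 ?M (axpy (jet \<Omega> (u k)) (-1) X)"
      using sq.nrm_nonneg[OF sq_integrable_axpy[OF dL gL]] by simp
  qed
  have wd: "is_weak_deriv \<Omega> i v (g i)" for i
    unfolding is_weak_deriv_ip2
  proof
    fix \<phi> assume phi: "\<phi> \<in> test_functions \<Omega>"
    have pL: "\<phi> \<in> sq_integrable ?M" "pderiv_i i \<phi> \<in> sq_integrable ?M"
      using test_function_sq_integrable op phi test_functions_pderiv by blast+
    have "(\<lambda>k. ip2 ?M (u k) (pderiv_i i \<phi>)) \<longlonglongrightarrow> ip2 ?M v (pderiv_i i \<phi>)"
      by (rule nrm2_tendsto_imp_ip2_tendsto[OF uL vL pL(2) l1])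
    moreover have "(\<lambda>k. - ip2 ?M (weak_deriv \<Omega> i (u k)) \<phi>) \<longlonglongrightarrow> - ip2 ?M (g i) \<phi>"
      by (intro tendsto_minus nrm2_tendsto_imp_ip2_tendsto[OF dL gL pL(1) l2])
    moreover have "ip2 ?M (u k) (pderiv_i i \<phi>) = - ip2 ?M (weak_deriv \<Omega> i (u k)) \<phi>" for k
      using H1_weak_deriv(2)[OF uH1] phi by (simp add: is_weak_deriv_ip2)
    ultimately show "ip2 ?M v (pderiv_i i \<phi>) = - ip2 ?M (g i) \<phi>"
      by (simp add: LIMSEQ_unique)
  qed
  have vH1: "v \<in> H1 \<Omega>" using vL gL wd by (auto simp: H1_def L2_eq)
  have "AE z in ?M. \<forall>i. weak_deriv \<Omega> i v z = g i z"
    using weak_deriv_unique[OF op H1_weak_deriv(1)[OF vH1] _ H1_weak_deriv(2)[OF vH1] wd] gL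
    by (simp add: AE_all_countable L2_eq)
  then have jv: "AE z in ?M. jet \<Omega> v z = X z"
    by eventually_elim (simp add: jet_def g_def v_def)
  then show "AE z in lebesgue_on \<Omega>. jet \<Omega> (\<lambda>z. fst (X z)) z = X z" by (simp add: v_def[abs_def])
  have "v \<in> H10 \<Omega>" unfolding H10_iff
  proof (intro conjI allI impI vH1)
    fix e :: real assume "e > 0"
    then have "e / 2 > 0" by simp
    with lim have "\<forall>\<^sub>F k in sequentially. nrm2 ?M (axpy (jet \<Omega> (u k)) (-1) X) < e / 2"
      by (rule order_tendstoD)
    then obtain k where k: "nrm2 ?M (axpy (jet \<Omega> (u k)) (-1) X) < e / 2"
      by (auto simp: eventually_sequentially)
    obtain \<phi> where phi: "\<phi> \<in> test_functions \<Omega>" "H1_norm \<Omega> (axpy (u k) (-1) \<phi>) < e / 2"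
      using u[of k] \<open>e / 2 > 0\<close> unfolding H10_iff by meson
    have eq: "axpy v (-1) \<phi> = axpy (axpy (u k) (-1) \<phi>) (-1) (axpy (u k) (-1) v)"
      by (simp add: axpy_def)
    have "H1_norm \<Omega> (axpy (u k) (-1) v) = nrm2 ?M (axpy (jet \<Omega> (u k)) (-1) (jet \<Omega> v))"
      using op uH1 vH1 by (simp add: H1_norm_eq H1_axpy nrm2_jet_axpy)
    also have "\<dots> = nrm2 ?M (axpy (jet \<Omega> (u k)) (-1) X)"
    proof (rule nrm2_cong)
      show "AE z in ?M. axpy (jet \<Omega> (u k)) (-1) (jet \<Omega> v) z = axpy (jet \<Omega> (u k)) (-1) X z"
        using jv by eventually_elim (simp add: axpy_def)
    qed (intro sq_integrableD(1) sq_integrable_axpy jet_sq_integrable uH1 vH1 X)+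
    finally have "H1_norm \<Omega> (axpy v (-1) \<phi>) < e"
      unfolding eq using k phi(2) H1_norm_axpy[OF op, of "axpy (u k) (-1) \<phi>" "axpy (u k) (-1) v" "-1"]
        H1_axpy[OF op uH1 test_functions_H1[OF op phi(1)]] H1_axpy[OF op uH1 vH1] by fastforce
    then show "\<exists>\<phi>\<in>test_functions \<Omega>. H1_norm \<Omega> (axpy v (-1) \<phi>) < e" using phi by blast
  qed
  then show "(\<lambda>z. fst (X z)) \<in> H10 \<Omega>" by (simp add: v_def[abs_def])
qed

section \<open>Clifford multiplication and the norm\<close>

lemma cliff_sgn_sq: "cliff_sgn A B * cliff_sgn A B = 1"
  by (simp add: cliff_sgn_def flip: power_mult_distrib)

lemma cliff_mult_add_left: "(x + y) \<odot> z = x \<odot> z + y \<odot> z"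
  using cliff_mult_sum_left[of "\<lambda>b. if b then x else y" "UNIV :: bool set" z] by (simp add: UNIV_bool add.commute)

lemma cliff_mult_add_right: "z \<odot> (x + y) = z \<odot> x + z \<odot> y"
  using cliff_mult_sum_right[of z "\<lambda>b. if b then x else y" "UNIV :: bool set"] by (simp add: UNIV_bool add.commute)

lemma bounded_bilinear_cliff_mult: "bounded_bilinear ((\<odot>) :: 'n::{finite,linorder} cliff \<Rightarrow> _)"
  unfolding bilinear_conv_bounded_bilinear[symmetric] bilinear_def
  by (auto intro!: linearI simp: cliff_mult_add_left cliff_mult_add_right cliff_mult_scaleR_left cliff_mult_scaleR_right)

interpretation cliff: bounded_bilinear "(\<odot>) :: 'n::{finite,linorder} cliff \<Rightarrow> _"
  by (rule bounded_bilinear_cliff_mult)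

text \<open>Conjugation changes \<open>e\<^sub>A\<close> by a sign only, since \<open>conj_e A\<close> is the inverse of \<open>e\<^sub>A\<close> and \<open>e\<^sub>A\<^sup>2 = \<plusminus>1\<close>.\<close>

lemma conj_e_eq: "conj_e A = cliff_sgn A A *\<^sub>R basis_e A"
proof -
  have "foldr (\<lambda>i p. (- gen_e i) \<odot> p) (rev xs) q = foldr (\<lambda>i p. (- gen_e i) \<odot> p) (rev xs) cliff_one \<odot> q"
    for xs and q :: "'a cliff"
  proof (induction xs arbitrary: q)
    case (Cons x xs)
    have "foldr (\<lambda>i p. (- gen_e i) \<odot> p) (rev (x # xs)) q
        = foldr (\<lambda>i p. (- gen_e i) \<odot> p) (rev xs) cliff_one \<odot> ((- gen_e x) \<odot> q)"
      by (simp add: Cons.IH[of "(- gen_e x) \<odot> q"])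
    also have "\<dots> = (foldr (\<lambda>i p. (- gen_e i) \<odot> p) (rev xs) cliff_one \<odot> (- gen_e x)) \<odot> q"
      by (simp only: cliff_mult_assoc)
    also have "\<dots> = foldr (\<lambda>i p. (- gen_e i) \<odot> p) (rev (x # xs)) cliff_one \<odot> q"
      by (simp add: Cons.IH[of "- gen_e x"] cliff_one_right)
    finally show ?case .
  qed (simp add: cliff_one_left)
  note fold = this
  have "foldr (\<lambda>i p. (- gen_e i) \<odot> p) (rev xs) cliff_one \<odot> foldr (\<lambda>i p. gen_e i \<odot> p) xs cliff_one = (cliff_one :: 'a cliff)" for xs
  proof (induction xs)
    case (Cons x xs)
    let ?P = "foldr (\<lambda>i p. (- gen_e i) \<odot> p) (rev xs) cliff_one" and ?Q = "foldr (\<lambda>i p. gen_e i \<odot> p) xs (cliff_one :: 'a cliff)"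
    have "foldr (\<lambda>i p. (- gen_e i) \<odot> p) (rev (x # xs)) cliff_one = ?P \<odot> (- gen_e x)"
      using fold[of xs "- gen_e x"] by (simp add: cliff_one_right)
    then have "foldr (\<lambda>i p. (- gen_e i) \<odot> p) (rev (x # xs)) cliff_one \<odot> foldr (\<lambda>i p. gen_e i \<odot> p) (x # xs) cliff_one
        = (?P \<odot> (- gen_e x)) \<odot> (gen_e x \<odot> ?Q)" by simp
    also have "\<dots> = ?P \<odot> (((- gen_e x) \<odot> gen_e x) \<odot> ?Q)" by (simp only: cliff_mult_assoc)
    also have "(- gen_e x) \<odot> gen_e x = cliff_one" by (simp add: cliff.minus_left gen_square)
    finally show ?case using Cons.IH by (simp add: cliff_one_left)
  qed (simp add: cliff_one_left)
  then have "conj_e A \<odot> basis_e A = cliff_one"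
    by (simp add: conj_e_def basis_e_eq_prod[of A])
  then have "(conj_e A \<odot> basis_e A) \<odot> basis_e A = basis_e A" by (simp add: cliff_one_left)
  moreover have "(conj_e A \<odot> basis_e A) \<odot> basis_e A = cliff_sgn A A *\<^sub>R conj_e A"
    by (simp add: cliff_mult_assoc basis_mult cliff_mult_scaleR_right cliff_one_right)
  ultimately have "cliff_sgn A A *\<^sub>R (cliff_sgn A A *\<^sub>R conj_e A) = cliff_sgn A A *\<^sub>R basis_e A" by simp
  then show ?thesis by (simp add: cliff_sgn_sq)
qed

lemma sum_basis_nth: "(\<Sum>B\<in>UNIV. c B *\<^sub>R basis_e B) $ C = c C"
  using cliff_expand[of "\<chi> B. c B"] by (metis (no_types, lifting) sum.cong vec_lambda_beta)

lemma sym_diff_cancel: "sym_diff A (sym_diff A C) = C" "sym_diff (sym_diff C A) A = C"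
  by auto

lemma basis_mult_nth: "(basis_e A \<odot> x) $ C = cliff_sgn A (sym_diff A C) * x $ (sym_diff A C)"
proof -
  have "basis_e A \<odot> x = (\<Sum>B\<in>UNIV. (x $ B * cliff_sgn A B) *\<^sub>R basis_e (sym_diff A B))"
    by (subst cliff_expand[of x]) (simp add: cliff_mult_sum_right cliff_mult_scaleR_right basis_mult)
  also have "\<dots> = (\<Sum>B\<in>UNIV. (x $ (sym_diff A B) * cliff_sgn A (sym_diff A B)) *\<^sub>R basis_e B)"
    by (rule sum.reindex_bij_witness[of _ "sym_diff A" "sym_diff A"]) (auto simp only: sym_diff_cancel UNIV_I)
  finally show ?thesis by (simp only: sum_basis_nth mult.commute)
qed

lemma mult_basis_nth: "(x \<odot> basis_e A) $ C = cliff_sgn (sym_diff C A) A * x $ (sym_diff C A)"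
proof -
  have "x \<odot> basis_e A = (\<Sum>B\<in>UNIV. (x $ B * cliff_sgn B A) *\<^sub>R basis_e (sym_diff B A))"
    by (subst cliff_expand[of x]) (simp add: cliff_mult_sum_left cliff_mult_scaleR_left basis_mult)
  also have "\<dots> = (\<Sum>B\<in>UNIV. (x $ (sym_diff B A) * cliff_sgn (sym_diff B A) A) *\<^sub>R basis_e B)"
    by (rule sum.reindex_bij_witness[of _ "\<lambda>B. sym_diff B A" "\<lambda>B. sym_diff B A"]) (auto simp only: sym_diff_cancel UNIV_I)
  finally show ?thesis by (simp only: sum_basis_nth mult.commute)
qed

lemma cliff_eqI:
  assumes "\<And>A. Sc (x \<odot> basis_e A) = Sc (y \<odot> basis_e A)"
  shows "x = y"
proof -
  have "x $ A = y $ A" for A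
  proof -
    have "cliff_sgn A A * x $ A = cliff_sgn A A * y $ A"
      using assms[of A] by (simp add: Sc_def mult_basis_nth)
    then show ?thesis using cliff_sgn_sq[of A A] by auto
  qed
  then show ?thesis by (simp add: vec_eq_iff)
qed

lemma cliff_conj_nth: "cliff_conj x $ A = cliff_sgn A A * x $ A"
proof -
  have "cliff_conj x = (\<Sum>A\<in>UNIV. (cliff_sgn A A * x $ A) *\<^sub>R basis_e A)"
    by (simp add: cliff_conj_def conj_e_eq mult.commute)
  then show ?thesis by (simp only: sum_basis_nth)
qed

lemma abs_cliff_sgn: "\<bar>cliff_sgn A B\<bar> = 1"
  by (simp add: cliff_sgn_def power_abs)

lemma norm_cliff_conj: "norm (cliff_conj x) = norm x"
  unfolding norm_vec_def
  by (rule arg_cong[where f="\<lambda>h. L2_set h UNIV"])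
     (simp add: cliff_conj_nth abs_mult abs_cliff_sgn)

lemma bounded_linear_cliff_conj: "bounded_linear (cliff_conj :: 'n::{finite,linorder} cliff \<Rightarrow> _)"
  by (rule bounded_linear_intro[where K=1])
     (auto simp: norm_cliff_conj vec_eq_iff cliff_conj_nth algebra_simps)

lemma inner_cliff: "x \<bullet> y = (\<Sum>A\<in>UNIV. x $ A * y $ A)" for x y :: "'n::finite cliff"
  by (simp add: inner_vec_def)

lemma Sc_conj_mult: "Sc (cliff_conj x \<odot> y) = x \<bullet> y"
proof -
  have "cliff_conj x \<odot> y = (\<Sum>A\<in>UNIV. (x $ A * cliff_sgn A A) *\<^sub>R (basis_e A \<odot> y))"
    by (simp add: cliff_conj_def conj_e_eq cliff_mult_sum_left cliff_mult_scaleR_left)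
  then have "Sc (cliff_conj x \<odot> y) = (\<Sum>A\<in>UNIV. (x $ A * cliff_sgn A A) * (cliff_sgn A A * y $ A))"
    by (simp add: Sc_def basis_mult_nth)
  also have "\<dots> = (\<Sum>A\<in>UNIV. (cliff_sgn A A * cliff_sgn A A) * (x $ A * y $ A))"
    by (intro sum.cong) (simp_all only: mult_ac)
  finally show ?thesis by (simp add: cliff_sgn_sq inner_cliff)
qed

lemma inner_basis_mult: "(basis_e A \<odot> x) \<bullet> (basis_e A \<odot> y) = x \<bullet> y"
proof -
  have "(basis_e A \<odot> x) \<bullet> (basis_e A \<odot> y)
      = (\<Sum>C\<in>UNIV. (cliff_sgn A (sym_diff A C) * cliff_sgn A (sym_diff A C)) * (x $ (sym_diff A C) * y $ (sym_diff A C)))"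
    unfolding inner_cliff basis_mult_nth by (intro sum.cong) (simp_all only: mult_ac)
  also have "\<dots> = (\<Sum>C\<in>UNIV. x $ (sym_diff A C) * y $ (sym_diff A C))" by (simp only: cliff_sgn_sq mult_1)
  also have "\<dots> = (\<Sum>C\<in>UNIV. x $ C * y $ C)"
    by (rule sum.reindex_bij_witness[of _ "sym_diff A" "sym_diff A"]) (auto simp only: sym_diff_cancel UNIV_I)
  finally show ?thesis by (simp add: inner_cliff)
qed

lemma gen_gen_mult: "gen_e i \<odot> (gen_e i \<odot> x) = - x"
  by (simp add: gen_square cliff.minus_left cliff_one_left flip: cliff_mult_assoc)

lemma inner_gen_skew: "(gen_e i \<odot> x) \<bullet> y = - (x \<bullet> (gen_e i \<odot> y))"
  using inner_basis_mult[of "{i}" x "gen_e i \<odot> y"] by (simp add: gen_gen_mult)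

lemma inner_gen_self: "x \<bullet> (gen_e i \<odot> x) = 0"
  using inner_gen_skew[of i x x] by (simp add: inner_commute)

lemma inner_gen_gen:
  assumes "i \<noteq> j" shows "(gen_e i \<odot> x) \<bullet> (gen_e j \<odot> x) = 0"
proof -
  have "(gen_e i \<odot> x) \<bullet> (gen_e j \<odot> x) = - (x \<bullet> (gen_e i \<odot> (gen_e j \<odot> x)))" by (rule inner_gen_skew)
  also have "gen_e i \<odot> (gen_e j \<odot> x) = - (gen_e j \<odot> (gen_e i \<odot> x))"
    using gen_anticommute[OF assms] by (simp add: cliff.minus_left flip: cliff_mult_assoc)
  also have "- (x \<bullet> - (gen_e j \<odot> (gen_e i \<odot> x))) = - ((gen_e j \<odot> x) \<bullet> (gen_e i \<odot> x))"
    by (simp add: inner_gen_skew)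
  finally show ?thesis by (simp add: inner_commute)
qed

lemma norm_gen_mult: "norm (gen_e i \<odot> x) = norm x"
  using inner_basis_mult[of "{i}" x x] by (simp add: norm_eq_sqrt_inner)

text \<open>The left multiplications by \<open>1, e\<^sub>1, \<dots>, e\<^sub>n\<close> map \<open>x\<close> to pairwise orthogonal elements of norm \<open>|x|\<close>.\<close>

lemma norm_paravector_mult_sq:
  "(norm ((a *\<^sub>R cliff_one + (\<Sum>i\<in>UNIV. v i *\<^sub>R gen_e i)) \<odot> x))\<^sup>2 = (a\<^sup>2 + (\<Sum>i\<in>UNIV. (v i)\<^sup>2)) * (norm x)\<^sup>2"
proof -
  define S where "S = (\<Sum>i\<in>UNIV. v i *\<^sub>R (gen_e i \<odot> x))"
  have eq: "(a *\<^sub>R cliff_one + (\<Sum>i\<in>UNIV. v i *\<^sub>R gen_e i)) \<odot> x = a *\<^sub>R x + S"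
    by (simp add: S_def cliff_mult_add_left cliff_mult_scaleR_left cliff_one_left cliff_mult_sum_left)
  have xS: "x \<bullet> S = 0" by (simp add: S_def inner_sum_right inner_gen_self)
  have "S \<bullet> S = (\<Sum>i\<in>UNIV. \<Sum>j\<in>UNIV. v i * (v j * ((gen_e j \<odot> x) \<bullet> (gen_e i \<odot> x))))"
    by (simp add: S_def inner_sum_left inner_sum_right sum_distrib_left)
  also have "\<dots> = (\<Sum>i\<in>UNIV. \<Sum>j\<in>UNIV. if j = i then v i * (v i * (x \<bullet> x)) else 0)"
  proof (intro sum.cong refl)
    fix i j :: 'a
    show "v i * (v j * ((gen_e j \<odot> x) \<bullet> (gen_e i \<odot> x))) = (if j = i then v i * (v i * (x \<bullet> x)) else 0)"
      using inner_gen_gen[of j i x] inner_basis_mult[of "{i}" x x] by auto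
  qed
  also have "\<dots> = (\<Sum>i\<in>UNIV. (v i)\<^sup>2) * (x \<bullet> x)"
    by (simp add: sum_distrib_right power2_eq_square mult.assoc)
  finally have SS: "S \<bullet> S = (\<Sum>i\<in>UNIV. (v i)\<^sup>2) * (x \<bullet> x)" .
  have "(a *\<^sub>R x + S) \<bullet> (a *\<^sub>R x + S) = a\<^sup>2 * (x \<bullet> x) + S \<bullet> S"
    using xS by (simp add: inner_add_left inner_add_right inner_commute[of S x] power2_eq_square)
  then show ?thesis unfolding eq power2_norm_eq_inner SS by (simp only: distrib_right)
qed

lemma norm_paravector_mult:
  assumes "p \<in> paravectors"
  shows "norm (p \<odot> x) = norm p * norm x"
proof -
  obtain a v where p: "p = a *\<^sub>R cliff_one + (\<Sum>i\<in>UNIV. v i *\<^sub>R gen_e i)" using assms by (auto simp: paravectors_def)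
  have "norm (cliff_one :: 'a cliff) = 1" by (simp add: basis_e_def norm_axis_1)
  then have "(norm p)\<^sup>2 = a\<^sup>2 + (\<Sum>i\<in>UNIV. (v i)\<^sup>2)"
    using norm_paravector_mult_sq[of a v cliff_one] by (simp add: p cliff_one_right)
  then have "(norm (p \<odot> x))\<^sup>2 = (norm p * norm x)\<^sup>2"
    using norm_paravector_mult_sq[of a v x] by (simp add: p power_mult_distrib)
  then show ?thesis by (simp add: power2_eq_iff_nonneg)
qed

lemma conj_paravector:
  assumes "p \<in> paravectors"
  shows "cliff_conj p \<in> paravectors"
proof -
  interpret bounded_linear "cliff_conj :: 'a cliff \<Rightarrow> _" by (rule bounded_linear_cliff_conj)
  obtain a v where p: "p = a *\<^sub>R cliff_one + (\<Sum>i\<in>UNIV. v i *\<^sub>R gen_e i)" using assms by (auto simp: paravectors_def)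
  have b: "cliff_conj (basis_e A) = cliff_sgn A A *\<^sub>R basis_e A" for A :: "'a set"
    by (auto simp: vec_eq_iff cliff_conj_nth basis_e_def axis_def)
  have eq: "cliff_conj p = a *\<^sub>R cliff_one + (\<Sum>i\<in>UNIV. (- v i) *\<^sub>R gen_e i)"
    by (simp add: p add sum scaleR b cliff_sgn_prod)
  show ?thesis unfolding paravectors_def by (intro CollectI exI) (rule eq)
qed

lemma norm_gen_minus_scalar_mult:
  "norm ((gen_e i - c *\<^sub>R cliff_one) \<odot> x) = sqrt (1 + c\<^sup>2) * norm x"
proof -
  have "gen_e i - c *\<^sub>R cliff_one = (- c) *\<^sub>R cliff_one + (\<Sum>j\<in>UNIV. (if j = i then 1 else 0) *\<^sub>R gen_e j)"
    by (simp add: if_distrib[of "\<lambda>c. c *\<^sub>R _"] cong: if_cong)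
  then have "(norm ((gen_e i - c *\<^sub>R cliff_one) \<odot> x))\<^sup>2 = ((- c)\<^sup>2 + (\<Sum>j\<in>(UNIV::'a set). (if j = i then 1 else 0)\<^sup>2)) * (norm x)\<^sup>2"
    by (simp only: norm_paravector_mult_sq)
  also have "(\<Sum>j\<in>(UNIV::'a set). (if j = i then 1 else 0 :: real)\<^sup>2) = 1"
    by (simp add: if_distrib[of "\<lambda>c. c\<^sup>2"] cong: if_cong)
  also have "((- c)\<^sup>2 + 1) * (norm x)\<^sup>2 = (sqrt (1 + c\<^sup>2) * norm x)\<^sup>2"
    by (simp add: power_mult_distrib add_nonneg_nonneg add.commute)
  finally show ?thesis by (simp add: power2_eq_iff_nonneg)
qed

section \<open>The pointwise form and its coercivity\<close>

text \<open>The Dirac operator at a point of height \<open>y\<close>, as a function of the jet \<open>X = (F, \<nabla>F)\<close> at this point. The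
  derivative in the last direction is one of the summands of the sum over all indices.\<close>

definition dirac_symbol :: "real \<Rightarrow> 'n::{finite,linorder} cliff \<times> ('n cliff, 'n) vec \<Rightarrow> 'n cliff" where
  "dirac_symbol y X = y *\<^sub>R (\<Sum>i\<in>UNIV. gen_e i \<odot> (snd X $ i)) - alpha CARD('n) *\<^sub>R (gen_e last_ix \<odot> fst X)"

text \<open>The integrand of the scalar part of \<open>q\<^sub>s(F, G)\<close> at a point of height \<open>y\<close>, as a bilinear form in the jets
  \<open>X = (F, \<nabla>F)\<close> and \<open>Y = (G, \<nabla>G)\<close>.\<close>

definition form_symbol :: "'n::{finite,linorder} cliff \<Rightarrow> real \<Rightarrow> 'n cliff \<times> ('n cliff, 'n) vec \<Rightarrow> 'n cliff \<times> ('n cliff, 'n) vec \<Rightarrow> real" where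
  "form_symbol s y X Y = (\<Sum>i\<in>UNIV. (y\<^sup>2 *\<^sub>R (snd X $ i)) \<bullet> (snd Y $ i))
     + (2 * (1 + alpha CARD('n))) * ((y *\<^sub>R (snd X $ last_ix)) \<bullet> fst Y)
     + ((gen_e last_ix - (2 * Sc s) *\<^sub>R cliff_one) \<odot> dirac_symbol y X) \<bullet> fst Y
     + (((norm s)\<^sup>2 - beta CARD('n)) *\<^sub>R fst X) \<bullet> fst Y"

lemma sum_norm_le_sqrt_card: "(\<Sum>i\<in>UNIV. norm (p $ i)) \<le> sqrt (real CARD('n)) * norm (p :: 'b::real_normed_vector ^ 'n::finite)"
  using L2_set_mult_ineq[of "\<lambda>i. 1" "\<lambda>i. norm (p $ i)" UNIV]
  by (simp add: L2_set_constant norm_vec_def)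

lemma alpha_nonneg: "0 \<le> alpha CARD('n::finite)"
  by (simp add: alpha_def)

lemma norm_dirac_symbol:
  assumes "0 \<le> y"
  shows "norm (dirac_symbol y (X :: 'n::{finite,linorder} cliff \<times> ('n cliff, 'n) vec))
    \<le> y * (sqrt (real CARD('n)) * norm (snd X)) + alpha CARD('n) * norm (fst X)"
proof -
  have "norm (\<Sum>i\<in>UNIV. gen_e i \<odot> (snd X $ i)) \<le> (\<Sum>i\<in>UNIV. norm (snd X $ i))"
    using norm_sum[of "\<lambda>i. gen_e i \<odot> (snd X $ i)" UNIV] by (simp only: norm_gen_mult)
  also have "\<dots> \<le> sqrt (real CARD('n)) * norm (snd X)" by (rule sum_norm_le_sqrt_card)
  finally have "y * norm (\<Sum>i\<in>UNIV. gen_e i \<odot> (snd X $ i)) \<le> y * (sqrt (real CARD('n)) * norm (snd X))"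
    using assms by (intro mult_left_mono)
  then show ?thesis
    using norm_triangle_ineq4[of "y *\<^sub>R (\<Sum>i\<in>UNIV. gen_e i \<odot> (snd X $ i))" "alpha CARD('n) *\<^sub>R (gen_e last_ix \<odot> fst X)"]
      assms alpha_nonneg[where 'n='n]
    by (simp add: dirac_symbol_def norm_gen_mult)
qed

lemma linear_dirac_parts:
  "linear (\<lambda>X. \<Sum>i\<in>UNIV. gen_e i \<odot> (snd X $ i) :: 'n::{finite,linorder} cliff)"
  "linear (\<lambda>X. gen_e last_ix \<odot> fst X :: 'n cliff)"
  by (auto intro!: linearI simp: cliff.add_right cliff.scaleR_right sum.distrib scaleR_sum_right)

lemma dirac_symbol_axpy:
  "dirac_symbol y (X + c *\<^sub>R Y) = dirac_symbol y X + c *\<^sub>R dirac_symbol y Y"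
  unfolding dirac_symbol_def linear_add[OF linear_dirac_parts(1)] linear_add[OF linear_dirac_parts(2)]
    linear_scale[OF linear_dirac_parts(1)] linear_scale[OF linear_dirac_parts(2)]
  by (simp add: algebra_simps)

lemma form_symbol_axpy_left:
  "form_symbol s y (X + c *\<^sub>R Y) Z = form_symbol s y X Z + c * form_symbol s y Y Z"
  unfolding form_symbol_def dirac_symbol_axpy
  by (simp add: inner_add_left cliff.add_right cliff.scaleR_right sum.distrib sum_distrib_left algebra_simps)

lemma form_symbol_axpy_right:
  "form_symbol s y Z (X + c *\<^sub>R Y) = form_symbol s y Z X + c * form_symbol s y Z Y"
  unfolding form_symbol_def
  by (simp add: inner_add_right sum.distrib sum_distrib_left algebra_simps)

lemma norm_prod_sq: "(norm X)\<^sup>2 = (norm (fst X))\<^sup>2 + (norm (snd X))\<^sup>2"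
  by (simp add: norm_prod_def)

text \<open>The left-hand factor is the smaller eigenvalue of the quadratic form on the right.\<close>

lemma quadratic_form_lower_bound:
  fixes a b c x p :: real
  shows "((a + b) / 2 - sqrt ((a - b)\<^sup>2 + c\<^sup>2) / 2) * (x\<^sup>2 + p\<^sup>2) \<le> a * x\<^sup>2 - c * (x * p) + b * p\<^sup>2"
proof -
  define r where "r = sqrt ((a - b)\<^sup>2 + c\<^sup>2)"
  have r2: "r\<^sup>2 = (a - b)\<^sup>2 + c\<^sup>2" by (simp add: r_def)
  have "\<bar>a - b\<bar> = sqrt ((a - b)\<^sup>2)" by simp
  also have "\<dots> \<le> r" unfolding r_def by (rule real_sqrt_le_mono) simp
  finally have r: "\<bar>a - b\<bar> \<le> r" .
  \<comment> \<open>\<open>u\<close> and \<open>v\<close> are what remains of \<open>a\<close> and \<open>b\<close> after the eigenvalue is subtracted, and \<open>4 u v = c\<^sup>2\<close>.\<close>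
  define u where "u = (a - b + r) / 2"
  define v where "v = (b - a + r) / 2"
  have uv: "0 \<le> u" "0 \<le> v" using r by (auto simp: u_def v_def)
  have prod: "u * v = c\<^sup>2 / 4" using r2 by (simp add: u_def v_def power2_eq_square algebra_simps)
  have "0 \<le> u * x\<^sup>2 - c * (x * p) + v * p\<^sup>2"
  proof (cases "u = 0")
    case True
    then show ?thesis using prod uv by simp
  next
    case False
    have "u * (u * x\<^sup>2 - c * (x * p) + v * p\<^sup>2) = u\<^sup>2 * x\<^sup>2 - u * c * (x * p) + (u * v) * p\<^sup>2"
      by (simp add: algebra_simps power2_eq_square)
    also have "\<dots> = (u * x - c * p / 2)\<^sup>2"
      unfolding prod by (simp add: power2_eq_square algebra_simps)
    finally have "0 \<le> u * (u * x\<^sup>2 - c * (x * p) + v * p\<^sup>2)" by simp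
    then show ?thesis using False uv by (simp add: zero_le_mult_iff)
  qed
  then show ?thesis unfolding r_def[symmetric] by (simp add: u_def v_def field_simps)
qed

text \<open>With \<open>x = |F|\<close> and \<open>p = |\<nabla>F|\<close> the four terms of the form are bounded below by a quadratic form in
  \<open>x\<close> and \<open>p\<close> whose smaller eigenvalue is the constant.\<close>

lemma form_symbol_coercive:
  fixes X :: "'n::{finite,linorder} cliff \<times> ('n cliff, 'n) vec"
  assumes y: "0 < m" "m \<le> y" "y \<le> M" and pos: "0 < (norm s)\<^sup>2 - beta CARD('n)"
  shows "K_const CARD('n) m M s * (norm X)\<^sup>2 \<le> form_symbol s y X X"
proof -
  define \<alpha> where "\<alpha> = alpha CARD('n)"
  define q where "q = sqrt (real CARD('n))"
  define t where "t = sqrt (1 + 4 * (Sc s)\<^sup>2)"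
  define x where "x = norm (fst X)"
  define p where "p = norm (snd X)"
  have nn: "0 \<le> \<alpha>" "0 \<le> q" "0 \<le> t" "0 \<le> x" "0 \<le> p" "0 \<le> y"
    using y by (auto simp: \<alpha>_def alpha_nonneg q_def t_def x_def p_def)
  have T1: "m\<^sup>2 * p\<^sup>2 \<le> (\<Sum>i\<in>UNIV. (y\<^sup>2 *\<^sub>R (snd X $ i)) \<bullet> (snd X $ i))"
  proof -
    have "m\<^sup>2 * p\<^sup>2 \<le> y\<^sup>2 * p\<^sup>2" using y by (intro mult_right_mono power_mono) auto
    also have "\<dots> = (\<Sum>i\<in>UNIV. (y\<^sup>2 *\<^sub>R (snd X $ i)) \<bullet> (snd X $ i))"
      unfolding p_def norm_vec_sq[of "snd X"] by (simp add: sum_distrib_left power2_norm_eq_inner)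
    finally show ?thesis .
  qed
  have T2: "- (2 * (1 + \<alpha>) * (M * (p * x))) \<le> (2 * (1 + \<alpha>)) * ((y *\<^sub>R (snd X $ last_ix)) \<bullet> fst X)"
  proof -
    have "\<bar>(y *\<^sub>R (snd X $ last_ix)) \<bullet> fst X\<bar> \<le> y * norm (snd X $ last_ix) * x"
      using Cauchy_Schwarz_ineq2[of "y *\<^sub>R (snd X $ last_ix)" "fst X"] nn by (simp add: x_def)
    also have "\<dots> \<le> M * p * x" unfolding p_def
      using y nn by (intro mult_mono norm_vec_nth_le mult_nonneg_nonneg) auto
    finally have "- (M * (p * x)) \<le> (y *\<^sub>R (snd X $ last_ix)) \<bullet> fst X" by (simp add: mult.assoc)
    then have "(2 * (1 + \<alpha>)) * - (M * (p * x)) \<le> (2 * (1 + \<alpha>)) * ((y *\<^sub>R (snd X $ last_ix)) \<bullet> fst X)"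
      using nn by (intro mult_left_mono) auto
    then show ?thesis by simp
  qed
  have T3: "- (t * (M * (q * p) + \<alpha> * x) * x) \<le> ((gen_e last_ix - (2 * Sc s) *\<^sub>R cliff_one) \<odot> dirac_symbol y X) \<bullet> fst X"
  proof -
    have "\<bar>((gen_e last_ix - (2 * Sc s) *\<^sub>R cliff_one) \<odot> dirac_symbol y X) \<bullet> fst X\<bar>
        \<le> t * norm (dirac_symbol y X) * x"
      using Cauchy_Schwarz_ineq2[of "(gen_e last_ix - (2 * Sc s) *\<^sub>R cliff_one) \<odot> dirac_symbol y X" "fst X"]
      by (simp add: norm_gen_minus_scalar_mult power_mult_distrib t_def x_def)
    also have "\<dots> \<le> t * (M * (q * p) + \<alpha> * x) * x"
    proof (intro mult_right_mono mult_left_mono nn)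
      have "norm (dirac_symbol y X) \<le> y * (q * p) + \<alpha> * x"
        using norm_dirac_symbol[OF nn(6), of X] by (simp add: q_def p_def x_def \<alpha>_def)
      also have "\<dots> \<le> M * (q * p) + \<alpha> * x" using y nn by (intro add_right_mono mult_right_mono) auto
      finally show "norm (dirac_symbol y X) \<le> M * (q * p) + \<alpha> * x" .
    qed
    finally show ?thesis by linarith
  qed
  define a0 where "a0 = (norm s)\<^sup>2 - beta CARD('n)"
  have T4: "(((norm s)\<^sup>2 - beta CARD('n)) *\<^sub>R fst X) \<bullet> fst X = a0 * x\<^sup>2"
    by (simp add: a0_def x_def power2_norm_eq_inner)
  define c where "c = M * (2 * (1 + \<alpha>) + q * t)"
  have "form_symbol s y X X \<ge> m\<^sup>2 * p\<^sup>2 - 2 * (1 + \<alpha>) * (M * (p * x)) - t * (M * (q * p) + \<alpha> * x) * x + a0 * x\<^sup>2"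
    unfolding form_symbol_def T4 using T1 T2 T3 by (simp add: \<alpha>_def)
  also have "m\<^sup>2 * p\<^sup>2 - 2 * (1 + \<alpha>) * (M * (p * x)) - t * (M * (q * p) + \<alpha> * x) * x + a0 * x\<^sup>2
      = (a0 - \<alpha> * t) * x\<^sup>2 - c * (x * p) + m\<^sup>2 * p\<^sup>2"
    by (simp add: c_def algebra_simps power2_eq_square)
  finally have f: "(a0 - \<alpha> * t) * x\<^sup>2 - c * (x * p) + m\<^sup>2 * p\<^sup>2 \<le> form_symbol s y X X" .
  have "K_const CARD('n) m M s = ((a0 - \<alpha> * t) + m\<^sup>2) / 2 - sqrt (((a0 - \<alpha> * t) - m\<^sup>2)\<^sup>2 + c\<^sup>2) / 2"
    using pos unfolding K_const_def c_def power_mult_distrib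
    by (simp add: a0_def \<alpha>_def q_def t_def field_simps)
  then have "K_const CARD('n) m M s * (norm X)\<^sup>2 \<le> (a0 - \<alpha> * t) * x\<^sup>2 - c * (x * p) + m\<^sup>2 * p\<^sup>2"
    using quadratic_form_lower_bound[of "a0 - \<alpha> * t" "m\<^sup>2" c x p] by (simp add: norm_prod_sq x_def p_def)
  with f show ?thesis by linarith
qed

lemma form_symbol_bounded:
  fixes s :: "'n::{finite,linorder} cliff"
  assumes "0 \<le> M"
  shows "\<exists>C\<ge>0. \<forall>y X Y. 0 \<le> y \<longrightarrow> y \<le> M \<longrightarrow> \<bar>form_symbol s y X Y\<bar> \<le> C * (norm X * norm Y)"
proof -
  define \<alpha> where "\<alpha> = alpha CARD('n)"
  define q where "q = sqrt (real CARD('n))"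
  define t where "t = sqrt (1 + 4 * (Sc s)\<^sup>2)"
  define b where "b = \<bar>(norm s)\<^sup>2 - beta CARD('n)\<bar>"
  have nn: "0 \<le> \<alpha>" "0 \<le> q" "0 \<le> t" "0 \<le> b" by (auto simp: \<alpha>_def alpha_nonneg q_def t_def b_def)
  define C where "C = real CARD('n) * M\<^sup>2 + 2 * (1 + \<alpha>) * M + t * (M * q + \<alpha>) + b"
  have "\<bar>form_symbol s y X Y\<bar> \<le> C * (norm X * norm Y)" if y: "0 \<le> y" "y \<le> M" for y and X Y :: "'n cliff \<times> ('n cliff, 'n) vec"
  proof -
    define N where "N = norm X * norm Y"
    have fX: "norm (fst X) \<le> norm X" "norm (fst Y) \<le> norm Y" by (rule norm_fst_le')+
    have sX: "norm (snd X $ i) \<le> norm X" "norm (snd Y $ i) \<le> norm Y" for i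
      by (rule order_trans[OF norm_vec_nth_le norm_snd_le'])+
    have "\<bar>\<Sum>i\<in>UNIV. (y\<^sup>2 *\<^sub>R (snd X $ i)) \<bullet> (snd Y $ i)\<bar> \<le> (\<Sum>i\<in>(UNIV::'n set). M\<^sup>2 * N)"
    proof (rule order_trans[OF sum_abs], rule sum_mono)
      fix i
      have "\<bar>(y\<^sup>2 *\<^sub>R (snd X $ i)) \<bullet> (snd Y $ i)\<bar> \<le> y\<^sup>2 * (norm (snd X $ i) * norm (snd Y $ i))"
        using Cauchy_Schwarz_ineq2[of "y\<^sup>2 *\<^sub>R (snd X $ i)" "snd Y $ i"] by (simp add: mult.assoc)
      also have "\<dots> \<le> M\<^sup>2 * N" unfolding N_def using y assms sX
        by (intro mult_mono power_mono mult_nonneg_nonneg) auto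
      finally show "\<bar>(y\<^sup>2 *\<^sub>R (snd X $ i)) \<bullet> (snd Y $ i)\<bar> \<le> M\<^sup>2 * N" .
    qed
    then have 1: "\<bar>\<Sum>i\<in>UNIV. (y\<^sup>2 *\<^sub>R (snd X $ i)) \<bullet> (snd Y $ i)\<bar> \<le> real CARD('n) * M\<^sup>2 * N" by simp
    have "\<bar>(y *\<^sub>R (snd X $ last_ix)) \<bullet> fst Y\<bar> \<le> y * (norm (snd X $ last_ix) * norm (fst Y))"
      using Cauchy_Schwarz_ineq2[of "y *\<^sub>R (snd X $ last_ix)" "fst Y"] y by (simp add: mult.assoc)
    also have "\<dots> \<le> M * N" unfolding N_def using y assms sX fX
      by (intro mult_mono mult_nonneg_nonneg) auto
    finally have "(2 * (1 + \<alpha>)) * \<bar>(y *\<^sub>R (snd X $ last_ix)) \<bullet> fst Y\<bar> \<le> (2 * (1 + \<alpha>)) * (M * N)"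
      using nn by (intro mult_left_mono) auto
    then have 2: "\<bar>(2 * (1 + \<alpha>)) * ((y *\<^sub>R (snd X $ last_ix)) \<bullet> fst Y)\<bar> \<le> 2 * (1 + \<alpha>) * M * N"
      using nn by (simp add: abs_mult)
    have "norm (dirac_symbol y X) \<le> y * (q * norm (snd X)) + \<alpha> * norm (fst X)"
      using norm_dirac_symbol[OF y(1), of X] by (simp add: q_def \<alpha>_def)
    also have "\<dots> \<le> M * (q * norm X) + \<alpha> * norm X"
      using y assms nn fX norm_snd_le'[of X] by (intro add_mono mult_mono mult_nonneg_nonneg) auto
    finally have d: "norm (dirac_symbol y X) \<le> (M * q + \<alpha>) * norm X" by (simp add: algebra_simps)
    have "\<bar>((gen_e last_ix - (2 * Sc s) *\<^sub>R cliff_one) \<odot> dirac_symbol y X) \<bullet> fst Y\<bar>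
        \<le> t * (norm (dirac_symbol y X) * norm (fst Y))"
      using Cauchy_Schwarz_ineq2[of "(gen_e last_ix - (2 * Sc s) *\<^sub>R cliff_one) \<odot> dirac_symbol y X" "fst Y"]
      by (simp add: norm_gen_minus_scalar_mult power_mult_distrib t_def mult.assoc)
    also have "\<dots> \<le> t * ((M * q + \<alpha>) * norm X * norm Y)"
      using d fX nn assms by (intro mult_left_mono mult_mono mult_nonneg_nonneg add_nonneg_nonneg) auto
    finally have 3: "\<bar>((gen_e last_ix - (2 * Sc s) *\<^sub>R cliff_one) \<odot> dirac_symbol y X) \<bullet> fst Y\<bar> \<le> t * (M * q + \<alpha>) * N"
      by (simp add: N_def mult.assoc)
    have "\<bar>(((norm s)\<^sup>2 - beta CARD('n)) *\<^sub>R fst X) \<bullet> fst Y\<bar> \<le> b * (norm (fst X) * norm (fst Y))"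
      using Cauchy_Schwarz_ineq2[of "((norm s)\<^sup>2 - beta CARD('n)) *\<^sub>R fst X" "fst Y"] by (simp add: b_def mult.assoc)
    also have "\<dots> \<le> b * N" unfolding N_def using nn fX by (intro mult_left_mono mult_mono) auto
    finally have 4: "\<bar>(((norm s)\<^sup>2 - beta CARD('n)) *\<^sub>R fst X) \<bullet> fst Y\<bar> \<le> b * N" .
    have "\<bar>form_symbol s y X Y\<bar> \<le> real CARD('n) * M\<^sup>2 * N + 2 * (1 + \<alpha>) * M * N + t * (M * q + \<alpha>) * N + b * N"
      unfolding form_symbol_def \<alpha>_def[symmetric] using 1 2 3 4 by linarith
    also have "\<dots> = C * N" by (simp add: C_def algebra_simps)
    finally show ?thesis by (simp add: N_def)
  qed
  moreover have "C \<ge> 0" using nn assms by (simp add: C_def)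
  ultimately show ?thesis by blast
qed

section \<open>The space of jets of Clifford-valued Sobolev functions\<close>

text \<open>A Clifford-valued function together with its weak gradient, whose entry \<open>i\<close> is the \<open>i\<close>-th partial
  derivative.\<close>

definition cjet :: "'n::{finite,linorder} pt set \<Rightarrow> ('n pt \<Rightarrow> 'n cliff) \<Rightarrow> 'n pt \<Rightarrow> 'n cliff \<times> ('n cliff, 'n) vec" where
  "cjet \<Omega> F z = (F z, \<chi> i. cderiv \<Omega> i F z)"

text \<open>The coordinate with index \<open>A\<close> of a Clifford-valued jet, a scalar jet.\<close>

definition jet_coord :: "'n set \<Rightarrow> 'n::finite cliff \<times> ('n cliff, 'n) vec \<Rightarrow> real \<times> (real, 'n) vec" where
  "jet_coord A X = (fst X $ A, \<chi> i. snd X $ i $ A)"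

lemma jet_coord_cjet: "jet_coord A (cjet \<Omega> F z) = jet \<Omega> (\<lambda>w. F w $ A) z"
  by (simp add: jet_coord_def cjet_def jet_def cderiv_def)

lemma linear_jet_coord: "linear (jet_coord A)"
  by (auto intro!: linearI simp: jet_coord_def vec_eq_iff)

lemma norm_jet_coord: "norm (jet_coord A X) \<le> norm X"
proof (rule power2_le_imp_le)
  have "(norm (jet_coord A X))\<^sup>2 = (fst X $ A)\<^sup>2 + (\<Sum>i\<in>UNIV. (snd X $ i $ A)\<^sup>2)"
    by (simp add: norm_prod_sq norm_vec_sq jet_coord_def)
  also have "\<dots> \<le> (norm (fst X))\<^sup>2 + (\<Sum>i\<in>UNIV. (norm (snd X $ i))\<^sup>2)"
  proof (intro add_mono sum_mono)
    have "(x $ A)\<^sup>2 \<le> (norm x)\<^sup>2" for x :: "'a cliff"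
      using power_mono[OF norm_vec_nth_le[of x A], of 2] by simp
    then show "(fst X $ A)\<^sup>2 \<le> (norm (fst X))\<^sup>2" "(snd X $ i $ A)\<^sup>2 \<le> (norm (snd X $ i))\<^sup>2" for i by auto
  qed
  also have "\<dots> = (norm X)\<^sup>2" by (simp add: norm_prod_sq norm_vec_sq[of "snd X"])
  finally show "(norm (jet_coord A X))\<^sup>2 \<le> (norm X)\<^sup>2" .
qed simp

lemma jet_coord_eqI: "(\<And>A. jet_coord A X = jet_coord A Y) \<Longrightarrow> X = Y"
  by (auto simp: jet_coord_def prod_eq_iff vec_eq_iff)

lemma Dirac_H_eq: "Dirac_H \<Omega> F z = dirac_symbol (ycoord z) (cjet \<Omega> F z)"
proof -
  have "(\<Sum>i\<in>UNIV. gen_e i \<odot> (ycoord z *\<^sub>R cderiv \<Omega> i F z))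
      = gen_e last_ix \<odot> (ycoord z *\<^sub>R cderiv \<Omega> last_ix F z)
        + (\<Sum>i\<in>UNIV - {last_ix}. gen_e i \<odot> (ycoord z *\<^sub>R cderiv \<Omega> i F z))"
    by (rule sum.remove) auto
  then show ?thesis
    by (simp add: Dirac_H_def dirac_symbol_def cjet_def scaleR_sum_right cliff.scaleR_right)
qed

lemma cH10_axpy:
  assumes "open \<Omega>" "F \<in> cH10 \<Omega>" "G \<in> cH10 \<Omega>"
  shows "axpy F c G \<in> cH10 \<Omega>"
proof -
  have "(\<lambda>z. axpy F c G z $ A) = axpy (\<lambda>z. F z $ A) c (\<lambda>z. G z $ A)" for A by (simp add: axpy_def)
  then show ?thesis using assms H10_axpy[OF assms(1)] by (simp add: cH10_def)
qed

lemma cH10_H1: "F \<in> cH10 \<Omega> \<Longrightarrow> (\<lambda>z. F z $ A) \<in> H1 \<Omega>"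
  by (simp add: cH10_def H10_iff)

lemma cjet_axpy:
  assumes "open \<Omega>" "F \<in> cH10 \<Omega>" "G \<in> cH10 \<Omega>"
  shows "AE z in lebesgue_on \<Omega>. cjet \<Omega> (axpy F c G) z = axpy (cjet \<Omega> F) c (cjet \<Omega> G) z"
proof -
  have "AE z in lebesgue_on \<Omega>. \<forall>A. jet \<Omega> (axpy (\<lambda>w. F w $ A) c (\<lambda>w. G w $ A)) z
      = axpy (jet \<Omega> (\<lambda>w. F w $ A)) c (jet \<Omega> (\<lambda>w. G w $ A)) z"
    using jet_axpy[OF assms(1) cH10_H1[OF assms(2)] cH10_H1[OF assms(3)]] by (simp add: AE_all_countable)
  then show ?thesis
  proof eventually_elim
    case (elim z)
    show ?case
    proof (rule jet_coord_eqI)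
      fix A
      have e: "(\<lambda>w. axpy F c G w $ A) = axpy (\<lambda>w. F w $ A) c (\<lambda>w. G w $ A)" by (simp add: axpy_def)
      show "jet_coord A (cjet \<Omega> (axpy F c G) z) = jet_coord A (axpy (cjet \<Omega> F) c (cjet \<Omega> G) z)"
        using elim[rule_format, of A]
        by (simp add: jet_coord_cjet e axpy_def linear_add[OF linear_jet_coord] linear_scale[OF linear_jet_coord])
    qed
  qed
qed

lemma cjet_sq_integrable:
  assumes "F \<in> cH10 \<Omega>"
  shows "cjet \<Omega> F \<in> sq_integrable (lebesgue_on \<Omega>)"
proof -
  have "(\<lambda>z. \<chi> i. cderiv \<Omega> i F z) \<in> sq_integrable (lebesgue_on \<Omega>)"
  proof (intro sq_integrable_vecI)
    fix i A
    show "(\<lambda>z. (\<chi> i. cderiv \<Omega> i F z) $ i $ A) \<in> sq_integrable (lebesgue_on \<Omega>)"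
      using H1_weak_deriv(1)[OF cH10_H1[OF assms, of A], of i] by (simp add: cderiv_def L2_eq)
  qed
  moreover have "F \<in> sq_integrable (lebesgue_on \<Omega>)"
    using H1_weak_deriv(3)[OF cH10_H1[OF assms]] by (intro sq_integrable_vecI) (simp add: L2_eq)
  ultimately show ?thesis unfolding cjet_def[abs_def] by (intro sq_integrable_Pair)
qed

lemma cH10_zero: "open \<Omega> \<Longrightarrow> (\<lambda>z. 0) \<in> cH10 \<Omega>"
  by (simp add: cH10_def H10_zero)

lemma cjet_zero:
  assumes "open \<Omega>"
  shows "AE z in lebesgue_on \<Omega>. cjet \<Omega> (\<lambda>z. 0) z = 0"
  using cjet_axpy[OF assms cH10_zero[OF assms] cH10_zero[OF assms], of "-1"]
  by (simp add: axpy_def)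

text \<open>The image of \<open>H\<^sup>1\<^sub>0\<close> under the jet map, closed under equality almost everywhere: only in this
  way is it a linear space of functions, as the jet map is linear almost everywhere.\<close>

definition jet_space :: "'n::{finite,linorder} pt set \<Rightarrow> ('n pt \<Rightarrow> 'n cliff \<times> ('n cliff, 'n) vec) set" where
  "jet_space \<Omega> = {X \<in> sq_integrable (lebesgue_on \<Omega>). \<exists>F\<in>cH10 \<Omega>. AE z in lebesgue_on \<Omega>. X z = cjet \<Omega> F z}"

lemma cjet_in_jet_space: "F \<in> cH10 \<Omega> \<Longrightarrow> cjet \<Omega> F \<in> jet_space \<Omega>"
  by (auto simp: jet_space_def cjet_sq_integrable)

lemma jet_space_complete:
  assumes op: "open \<Omega>" and u: "\<And>k::nat. u k \<in> jet_space \<Omega>"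
    and cau: "\<And>e. e > 0 \<Longrightarrow> \<exists>N. \<forall>i\<ge>N. \<forall>j\<ge>N. nrm2 (lebesgue_on \<Omega>) (axpy (u i) (-1) (u j)) < e"
  shows "\<exists>X\<in>jet_space \<Omega>. (\<lambda>k. nrm2 (lebesgue_on \<Omega>) (axpy (u k) (-1) X)) \<longlonglongrightarrow> 0"
proof -
  let ?M = "lebesgue_on \<Omega>"
  have uL: "u k \<in> sq_integrable ?M" for k using u by (simp add: jet_space_def)
  have "\<forall>k. \<exists>F. F \<in> cH10 \<Omega> \<and> (AE z in ?M. u k z = cjet \<Omega> F z)" using u by (auto simp: jet_space_def)
  then obtain F where F: "\<And>k. F k \<in> cH10 \<Omega>" "\<And>k. AE z in ?M. u k z = cjet \<Omega> (F k) z" by metis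
  obtain X where X: "X \<in> sq_integrable ?M" and lim: "(\<lambda>k. nrm2 ?M (axpy (u k) (-1) X)) \<longlonglongrightarrow> 0"
    using sq_integrable_complete[of u ?M, OF uL cau] by blast
  have XA: "(\<lambda>z. jet_coord A (X z)) \<in> sq_integrable ?M" for A
    by (rule sq_integrable_linear[OF linear_jet_coord X])
  have limA: "(\<lambda>k. nrm2 ?M (axpy (jet \<Omega> (\<lambda>z. F k z $ A)) (-1) (\<lambda>z. jet_coord A (X z)))) \<longlonglongrightarrow> 0" for A
  proof (rule Lim_null_comparison[OF _ lim], intro always_eventually allI)
    fix k
    have sq: "axpy (jet \<Omega> (\<lambda>z. F k z $ A)) (-1) (\<lambda>z. jet_coord A (X z)) \<in> sq_integrable ?M"
      by (intro sq_integrable_axpy jet_sq_integrable cH10_H1 F XA)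
    have "nrm2 ?M (axpy (jet \<Omega> (\<lambda>z. F k z $ A)) (-1) (\<lambda>z. jet_coord A (X z))) \<le> 1 * nrm2 ?M (axpy (u k) (-1) X)"
    proof (rule nrm2_bound[OF sq_integrable_axpy[OF uL X] sq_integrableD(1)[OF sq]])
      show "AE z in ?M. norm (axpy (jet \<Omega> (\<lambda>z. F k z $ A)) (-1) (\<lambda>z. jet_coord A (X z)) z) \<le> 1 * norm (axpy (u k) (-1) X z)"
        using F(2)[of k]
      proof eventually_elim
        case (elim z)
        have "axpy (jet \<Omega> (\<lambda>z. F k z $ A)) (-1) (\<lambda>z. jet_coord A (X z)) z = jet_coord A (axpy (u k) (-1) X z)"
          by (simp add: axpy_def elim linear_diff[OF linear_jet_coord] jet_coord_cjet)
        then show ?case by (simp add: norm_jet_coord)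
      qed
    qed simp
    then show "norm (nrm2 ?M (axpy (jet \<Omega> (\<lambda>z. F k z $ A)) (-1) (\<lambda>z. jet_coord A (X z)))) \<le> nrm2 ?M (axpy (u k) (-1) X)"
      using sq.nrm_nonneg[OF sq] by simp
  qed
  have FA: "(\<lambda>z. F k z $ A) \<in> H10 \<Omega>" for k A using F(1)[of k] by (simp add: cH10_def)
  define G where "G z = fst (X z)" for z
  have GA: "(\<lambda>z. fst (jet_coord A (X z))) = (\<lambda>z. G z $ A)" for A by (simp add: jet_coord_def G_def)
  have "G \<in> cH10 \<Omega>"
    using H10_closed(1)[OF op FA XA limA] by (simp add: cH10_def GA)
  moreover have "AE z in ?M. \<forall>A. jet \<Omega> (\<lambda>z. G z $ A) z = jet_coord A (X z)"
    using H10_closed(2)[OF op FA XA limA] by (simp add: AE_all_countable GA)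
  then have "AE z in ?M. X z = cjet \<Omega> G z"
    by eventually_elim (auto intro!: jet_coord_eqI simp: jet_coord_cjet)
  ultimately have "X \<in> jet_space \<Omega>" using X by (auto simp: jet_space_def)
  then show ?thesis using lim by blast
qed

lemma hilbert_jet_space:
  assumes "open \<Omega>"
  shows "hilbert_space_on (jet_space \<Omega>) (ip2 (lebesgue_on \<Omega>))"
proof
  have sub: "X \<in> jet_space \<Omega> \<Longrightarrow> X \<in> sq_integrable (lebesgue_on \<Omega>)" for X by (simp add: jet_space_def)
  have "AE z in lebesgue_on \<Omega>. 0 = cjet \<Omega> (\<lambda>z. 0) z"
    using cjet_zero[OF assms] by eventually_elim simp
  then show "(\<lambda>z. 0) \<in> jet_space \<Omega>"
    using cH10_zero[OF assms] sq_integrable_zero unfolding jet_space_def by blast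
  fix X Y assume XY: "X \<in> jet_space \<Omega>" "Y \<in> jet_space \<Omega>"
  show "axpy X c Y \<in> jet_space \<Omega>" for c
  proof -
    obtain F G where FG: "F \<in> cH10 \<Omega>" "AE z in lebesgue_on \<Omega>. X z = cjet \<Omega> F z"
      "G \<in> cH10 \<Omega>" "AE z in lebesgue_on \<Omega>. Y z = cjet \<Omega> G z" using XY by (auto simp: jet_space_def)
    have "AE z in lebesgue_on \<Omega>. axpy X c Y z = cjet \<Omega> (axpy F c G) z"
      using FG(2,4) cjet_axpy[OF assms FG(1,3), of c] by eventually_elim (simp add: axpy_def)
    then show ?thesis using sq_integrable_axpy[OF sub[OF XY(1)] sub[OF XY(2)]] cH10_axpy[OF assms FG(1,3)]
      unfolding jet_space_def by blast
  qed
  show "ip2 (lebesgue_on \<Omega>) X Y = ip2 (lebesgue_on \<Omega>) Y X" by (rule sq.ip_commute[OF sub[OF XY(1)] sub[OF XY(2)]])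
  show "ip2 (lebesgue_on \<Omega>) (axpy X c Y) Z = ip2 (lebesgue_on \<Omega>) X Z + c * ip2 (lebesgue_on \<Omega>) Y Z"
    if "Z \<in> jet_space \<Omega>" for c Z by (rule sq.ip_axpy[OF sub[OF XY(1)] sub[OF XY(2)] sub[OF that]])
  show "0 \<le> ip2 (lebesgue_on \<Omega>) X X" by (rule sq.ip_nonneg[OF sub[OF XY(1)]])
next
  fix u :: "nat \<Rightarrow> _"
  assume "\<And>k. u k \<in> jet_space \<Omega>"
    "\<And>e. e > 0 \<Longrightarrow> \<exists>N. \<forall>i\<ge>N. \<forall>j\<ge>N. nrm2 (lebesgue_on \<Omega>) (axpy (u i) (-1) (u j)) < e"
  then show "\<exists>X\<in>jet_space \<Omega>. (\<lambda>k. nrm2 (lebesgue_on \<Omega>) (axpy (u k) (-1) X)) \<longlonglongrightarrow> 0"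
    using jet_space_complete[OF assms, of u] by simp
qed

section \<open>Weak solutions and the resolvent estimate\<close>

lemma measurable_lebesgue_on_continuous:
  fixes f :: "'a::euclidean_space \<Rightarrow> 'b::topological_space"
  assumes "continuous_on UNIV f"
  shows "f \<in> borel_measurable (lebesgue_on \<Omega>)"
  by (intro measurable_restrict_space1 measurable_completion)
     (simp add: borel_measurable_continuous_onI[OF assms])

lemma integrable_conj_mult:
  fixes P Q :: "'x \<Rightarrow> 'n::{finite,linorder} cliff"
  assumes "P \<in> sq_integrable M" "Q \<in> sq_integrable M"
  shows "integrable M (\<lambda>z. cliff_conj (P z) \<odot> Q z)"
proof -
  obtain K where K: "\<And>a b :: 'n cliff. norm (a \<odot> b) \<le> norm a * norm b * K" using cliff.bounded by blast
  show ?thesis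
  proof (rule sq_integrable_bilinear[OF assms, where c=K])
    have c: "continuous_on UNIV (\<lambda>p :: 'n cliff \<times> 'n cliff. cliff_conj (fst p) \<odot> snd p)"
      by (intro cliff.continuous_on continuous_intros linear_continuous_on_compose[OF _ bounded_linear.linear[OF bounded_linear_cliff_conj]])
    show "(\<lambda>z. cliff_conj (P z) \<odot> Q z) \<in> borel_measurable M"
      using borel_measurable_continuous_Pair[OF sq_integrableD(1)[OF assms(1)] sq_integrableD(1)[OF assms(2)],
          of "\<lambda>a b. cliff_conj a \<odot> b"] c by simp
    show "AE z in M. norm (cliff_conj (P z) \<odot> Q z) \<le> K * (norm (P z) * norm (Q z))"
    proof (intro AE_I2)
      fix z show "norm (cliff_conj (P z) \<odot> Q z) \<le> K * (norm (P z) * norm (Q z))"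
        using K[of "cliff_conj (P z)" "Q z"] by (simp add: norm_cliff_conj mult_ac)
    qed
  qed
qed

lemma Sc_inner2:
  assumes "P \<in> sq_integrable (lebesgue_on \<Omega>)" "Q \<in> sq_integrable (lebesgue_on \<Omega>)"
  shows "Sc (inner2 \<Omega> P Q) = ip2 (lebesgue_on \<Omega>) P Q"
proof -
  have "Sc (inner2 \<Omega> P Q) = (LINT z|lebesgue_on \<Omega>. (cliff_conj (P z) \<odot> Q z) $ {})"
    unfolding Sc_def inner2_def
    by (rule integral_bounded_linear[OF bounded_linear_vec_nth integrable_conj_mult[OF assms], symmetric])
  then show ?thesis by (simp add: ip2_def Sc_conj_mult flip: Sc_def)
qed

lemma inner2_mult_right:
  assumes "P \<in> sq_integrable (lebesgue_on \<Omega>)" "Q \<in> sq_integrable (lebesgue_on \<Omega>)"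
    "R \<in> sq_integrable (lebesgue_on \<Omega>)" "AE z in lebesgue_on \<Omega>. R z = Q z \<odot> e"
  shows "inner2 \<Omega> P R = inner2 \<Omega> P Q \<odot> e"
proof -
  have bl: "bounded_linear (\<lambda>x. x \<odot> e)" by (rule cliff.bounded_linear_left)
  have "inner2 \<Omega> P R = (LINT z|lebesgue_on \<Omega>. (cliff_conj (P z) \<odot> Q z) \<odot> e)"
    unfolding inner2_def
  proof (rule integral_cong_AE)
    show "(\<lambda>z. cliff_conj (P z) \<odot> R z) \<in> borel_measurable (lebesgue_on \<Omega>)"
      using integrable_conj_mult[OF assms(1,3)] by simp
    show "(\<lambda>z. cliff_conj (P z) \<odot> Q z \<odot> e) \<in> borel_measurable (lebesgue_on \<Omega>)"
      using integrable_bounded_linear[OF bl integrable_conj_mult[OF assms(1,2)]] by simp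
    show "AE z in lebesgue_on \<Omega>. cliff_conj (P z) \<odot> R z = cliff_conj (P z) \<odot> Q z \<odot> e"
      using assms(4) by eventually_elim (simp add: cliff_mult_assoc)
  qed
  also have "\<dots> = inner2 \<Omega> P Q \<odot> e"
    unfolding inner2_def by (rule integral_bounded_linear[OF bl integrable_conj_mult[OF assms(1,2)]])
  finally show ?thesis .
qed

lemma norm2_eq: "F \<in> sq_integrable (lebesgue_on \<Omega>) \<Longrightarrow> norm2 \<Omega> F = nrm2 (lebesgue_on \<Omega>) F"
  by (simp add: norm2_def Sc_inner2 sq.nrm_def)

text \<open>Right multiplication by \<open>e\<^sub>A\<close> permutes the coordinates up to signs, so it preserves \<open>H\<^sup>1\<^sub>0\<close> and commutes
  with weak derivatives.\<close>

lemma cjet_mult_basis: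
  assumes op: "open \<Omega>" and G: "G \<in> cH10 \<Omega>"
  shows "(\<lambda>z. G z \<odot> basis_e A) \<in> cH10 \<Omega>"
    "AE z in lebesgue_on \<Omega>. cderiv \<Omega> i (\<lambda>z. G z \<odot> basis_e A) z = cderiv \<Omega> i G z \<odot> basis_e A"
proof -
  define g where "g C z = G z $ (sym_diff C A)" for C z
  define c where "c C = cliff_sgn (sym_diff C A) A" for C
  have eq: "(\<lambda>z. (G z \<odot> basis_e A) $ C) = axpy (\<lambda>z. 0) (c C) (g C)" for C
    by (simp add: mult_basis_nth axpy_def g_def c_def)
  have gH: "g C \<in> H10 \<Omega>" for C using G unfolding g_def[abs_def] cH10_def by blast
  show "(\<lambda>z. G z \<odot> basis_e A) \<in> cH10 \<Omega>"
    unfolding cH10_def mem_Collect_eq eq using H10_axpy[OF op H10_zero[OF op] gH] by blast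
  have H1: "(\<lambda>z. 0) \<in> H1 \<Omega>" "g C \<in> H1 \<Omega>" for C using gH H10_zero[OF op] by (auto simp: H10_iff)
  have "AE z in lebesgue_on \<Omega>. weak_deriv \<Omega> i (\<lambda>z. 0) z = 0"
    using weak_deriv_axpy[OF op H1(1) H1(1), of i "-1"] by (simp add: axpy_def)
  moreover have "AE z in lebesgue_on \<Omega>. \<forall>C. weak_deriv \<Omega> i (axpy (\<lambda>z. 0) (c C) (g C)) z
      = weak_deriv \<Omega> i (\<lambda>z. 0) z + c C * weak_deriv \<Omega> i (g C) z"
    using weak_deriv_axpy[OF op H1(1) H1(2)] by (simp add: AE_all_countable)
  ultimately show "AE z in lebesgue_on \<Omega>. cderiv \<Omega> i (\<lambda>z. G z \<odot> basis_e A) z = cderiv \<Omega> i G z \<odot> basis_e A"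
  proof eventually_elim
    case (elim z)
    have "cderiv \<Omega> i (\<lambda>z. G z \<odot> basis_e A) z $ C = (cderiv \<Omega> i G z \<odot> basis_e A) $ C" for C
    proof -
      have "cderiv \<Omega> i (\<lambda>z. G z \<odot> basis_e A) z $ C = c C * weak_deriv \<Omega> i (g C) z"
        using elim by (simp add: cderiv_def eq)
      also have "\<dots> = (cderiv \<Omega> i G z \<odot> basis_e A) $ C"
        unfolding mult_basis_nth c_def g_def[abs_def] by (simp add: cderiv_def)
      finally show ?thesis .
    qed
    then show ?case by (simp add: vec_eq_iff)
  qed
qed

text \<open>An open set on which the height lies between positive bounds.\<close>

locale bounded_height_domain =
  fixes \<Omega> :: "'n::{finite,linorder} pt set" and m M :: real
  assumes op: "open \<Omega>" and m_pos: "0 < m"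
    and height: "z \<in> \<Omega> \<Longrightarrow> m \<le> ycoord z" "z \<in> \<Omega> \<Longrightarrow> ycoord z \<le> M"
    and m_le_M: "m \<le> M"
begin

abbreviation \<mu> where "\<mu> \<equiv> lebesgue_on \<Omega>"

lemma height_space: "z \<in> space \<mu> \<Longrightarrow> m \<le> ycoord z \<and> ycoord z \<le> M"
  using height by (simp add: space_restrict_space)

lemma ycoord_measurable [measurable]: "ycoord \<in> borel_measurable \<mu>"
  unfolding ycoord_def[abs_def] by (rule measurable_lebesgue_on_continuous) (intro continuous_intros)

lemma ycoord_power_sq_integrable:
  assumes "f \<in> sq_integrable \<mu>"
  shows "(\<lambda>z. (ycoord z) ^ k *\<^sub>R f z) \<in> sq_integrable \<mu>"
proof (rule sq_integrable_bound[OF assms, where c="M ^ k"])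
  show "(\<lambda>z. (ycoord z) ^ k *\<^sub>R f z) \<in> borel_measurable \<mu>" using sq_integrableD(1)[OF assms] by measurable
  show "AE z in \<mu>. norm ((ycoord z) ^ k *\<^sub>R f z) \<le> M ^ k * norm (f z)"
  proof (intro AE_I2)
    fix z assume "z \<in> space \<mu>"
    then show "norm ((ycoord z) ^ k *\<^sub>R f z) \<le> M ^ k * norm (f z)"
      using height_space[of z] m_pos by (auto simp: power_abs intro!: mult_right_mono power_mono)
  qed
qed

lemma dirac_sq_integrable:
  fixes X :: "'n pt \<Rightarrow> 'n cliff \<times> ('n cliff, 'n) vec"
  assumes "X \<in> sq_integrable \<mu>"
  shows "(\<lambda>z. dirac_symbol (ycoord z) (X z)) \<in> sq_integrable \<mu>"
proof -
  have "axpy (\<lambda>z. (ycoord z) ^ 1 *\<^sub>R (\<Sum>i\<in>UNIV. gen_e i \<odot> (snd (X z) $ i))) (- alpha CARD('n))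
      (\<lambda>z. gen_e last_ix \<odot> fst (X z)) \<in> sq_integrable \<mu>"
    by (intro sq_integrable_axpy ycoord_power_sq_integrable sq_integrable_linear[OF linear_dirac_parts(1) assms]
        sq_integrable_linear[OF linear_dirac_parts(2) assms])
  then show ?thesis by (simp add: axpy_def dirac_symbol_def)
qed

text \<open>The scalar part of \<open>q\<^sub>s\<close>, as a bilinear form on square-integrable jets.\<close>

definition form :: "'n cliff \<Rightarrow> ('n pt \<Rightarrow> 'n cliff \<times> ('n cliff, 'n) vec) \<Rightarrow> ('n pt \<Rightarrow> 'n cliff \<times> ('n cliff, 'n) vec) \<Rightarrow> real" where
  "form s X Y = (LINT z|\<mu>. form_symbol s (ycoord z) (X z) (Y z))"

lemma form_summands:
  fixes X :: "'n pt \<Rightarrow> 'n cliff \<times> ('n cliff, 'n) vec"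
  assumes X: "X \<in> sq_integrable \<mu>"
  shows "(\<lambda>z. (ycoord z)\<^sup>2 *\<^sub>R (snd (X z) $ i)) \<in> sq_integrable \<mu>"
    "(\<lambda>z. ycoord z *\<^sub>R (snd (X z) $ i)) \<in> sq_integrable \<mu>"
    "(\<lambda>z. (gen_e last_ix - c *\<^sub>R cliff_one) \<odot> dirac_symbol (ycoord z) (X z)) \<in> sq_integrable \<mu>"
    "(\<lambda>z. d *\<^sub>R fst (X z)) \<in> sq_integrable \<mu>"
proof -
  have s: "(\<lambda>z. snd (X z) $ i) \<in> sq_integrable \<mu>" by (intro sq_integrable_vec_nth sq_integrable_snd X)
  show "(\<lambda>z. (ycoord z)\<^sup>2 *\<^sub>R (snd (X z) $ i)) \<in> sq_integrable \<mu>"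
    "(\<lambda>z. ycoord z *\<^sub>R (snd (X z) $ i)) \<in> sq_integrable \<mu>"
    using ycoord_power_sq_integrable[OF s, of 2] ycoord_power_sq_integrable[OF s, of 1] by simp_all
  show "(\<lambda>z. (gen_e last_ix - c *\<^sub>R cliff_one) \<odot> dirac_symbol (ycoord z) (X z)) \<in> sq_integrable \<mu>"
    by (rule sq_integrable_linear[OF bounded_linear.linear[OF cliff.bounded_linear_right] dirac_sq_integrable[OF X]])
  show "(\<lambda>z. d *\<^sub>R fst (X z)) \<in> sq_integrable \<mu>"
    by (rule sq_integrable_linear[OF linear_scale_self sq_integrable_fst[OF X]])
qed

lemma form_integrable:
  fixes s :: "'n cliff"
  assumes X: "X \<in> sq_integrable \<mu>" and Y: "Y \<in> sq_integrable \<mu>"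
  shows "integrable \<mu> (\<lambda>z. form_symbol s (ycoord z) (X z) (Y z))"
  unfolding form_symbol_def
  by (intro Bochner_Integration.integrable_add Bochner_Integration.integrable_sum integrable_mult_right
      sq_integrable_inner form_summands X sq_integrable_fst[OF Y] sq_integrable_vec_nth[OF sq_integrable_snd[OF Y]])

lemma form_eq:
  assumes X: "X \<in> sq_integrable \<mu>" and Y: "Y \<in> sq_integrable \<mu>"
  shows "form s X Y = (\<Sum>i\<in>UNIV. ip2 \<mu> (\<lambda>z. (ycoord z)\<^sup>2 *\<^sub>R (snd (X z) $ i)) (\<lambda>z. snd (Y z) $ i))
    + (2 * (1 + alpha CARD('n))) * ip2 \<mu> (\<lambda>z. ycoord z *\<^sub>R (snd (X z) $ last_ix)) (\<lambda>z. fst (Y z))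
    + ip2 \<mu> (\<lambda>z. (gen_e last_ix - (2 * Sc s) *\<^sub>R cliff_one) \<odot> dirac_symbol (ycoord z) (X z)) (\<lambda>z. fst (Y z))
    + ip2 \<mu> (\<lambda>z. ((norm s)\<^sup>2 - beta CARD('n)) *\<^sub>R fst (X z)) (\<lambda>z. fst (Y z))"
proof -
  note f = form_summands[OF X] and y1 = sq_integrable_fst[OF Y] and y2 = sq_integrable_vec_nth[OF sq_integrable_snd[OF Y]]
  have I1: "integrable \<mu> (\<lambda>z. ((ycoord z)\<^sup>2 *\<^sub>R (snd (X z) $ i)) \<bullet> (snd (Y z) $ i))" for i
    by (rule sq_integrable_inner[OF f(1) y2])
  have I1': "integrable \<mu> (\<lambda>z. \<Sum>i\<in>UNIV. ((ycoord z)\<^sup>2 *\<^sub>R (snd (X z) $ i)) \<bullet> (snd (Y z) $ i))"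
    by (intro Bochner_Integration.integrable_sum I1)
  have I2: "integrable \<mu> (\<lambda>z. (2 * (1 + alpha CARD('n))) * ((ycoord z *\<^sub>R (snd (X z) $ last_ix)) \<bullet> fst (Y z)))"
    by (intro integrable_mult_right sq_integrable_inner[OF f(2) y1])
  have I3: "integrable \<mu> (\<lambda>z. ((gen_e last_ix - (2 * Sc s) *\<^sub>R cliff_one) \<odot> dirac_symbol (ycoord z) (X z)) \<bullet> fst (Y z))"
    by (rule sq_integrable_inner[OF f(3) y1])
  have I4: "integrable \<mu> (\<lambda>z. (((norm s)\<^sup>2 - beta CARD('n)) *\<^sub>R fst (X z)) \<bullet> fst (Y z))"
    by (rule sq_integrable_inner[OF f(4) y1])
  show ?thesis
    unfolding form_def form_symbol_def ip2_def
    by (simp only: Bochner_Integration.integral_add Bochner_Integration.integrable_add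
        Bochner_Integration.integral_sum I1 I1' I2 I3 I4 integral_mult_right_zero)
qed

lemma Sc_q_form:
  assumes F: "F \<in> cH10 \<Omega>" and G: "G \<in> cH10 \<Omega>"
  shows "Sc (q_form \<Omega> s F G) = form s (cjet \<Omega> F) (cjet \<Omega> G)"
proof -
  have X: "cjet \<Omega> F \<in> sq_integrable \<mu>" and Y: "cjet \<Omega> G \<in> sq_integrable \<mu>" using F G by (simp_all add: cjet_sq_integrable)
  note f = form_summands[OF X] and y1 = sq_integrable_fst[OF Y] and y2 = sq_integrable_vec_nth[OF sq_integrable_snd[OF Y]]
  have c: "fst (cjet \<Omega> F z) = F z" "snd (cjet \<Omega> F z) $ i = cderiv \<Omega> i F z" for F z i by (simp_all add: cjet_def)
  have yy: "G \<in> sq_integrable \<mu>" "cderiv \<Omega> i G \<in> sq_integrable \<mu>" for i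
    using y1 y2[of i] by (simp_all add: c)
  have "(\<Sum>i\<in>UNIV. inner2 \<Omega> (\<lambda>z. (ycoord z)\<^sup>2 *\<^sub>R cderiv \<Omega> i F z) (cderiv \<Omega> i G))
      = inner2 \<Omega> (\<lambda>z. (ycoord z)\<^sup>2 *\<^sub>R cderiv \<Omega> last_ix F z) (cderiv \<Omega> last_ix G)
        + (\<Sum>i\<in>UNIV - {last_ix}. inner2 \<Omega> (\<lambda>z. (ycoord z)\<^sup>2 *\<^sub>R cderiv \<Omega> i F z) (cderiv \<Omega> i G))"
    by (rule sum.remove) auto
  then have "q_form \<Omega> s F G = (\<Sum>i\<in>UNIV. inner2 \<Omega> (\<lambda>z. (ycoord z)\<^sup>2 *\<^sub>R cderiv \<Omega> i F z) (cderiv \<Omega> i G))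
     + (2 * (1 + alpha CARD('n))) *\<^sub>R inner2 \<Omega> (\<lambda>z. ycoord z *\<^sub>R cderiv \<Omega> last_ix F z) G
     + inner2 \<Omega> (\<lambda>z. (gen_e last_ix - (2 * Sc s) *\<^sub>R cliff_one) \<odot> dirac_symbol (ycoord z) (cjet \<Omega> F z)) G
     + inner2 \<Omega> (\<lambda>z. ((norm s)\<^sup>2 - beta CARD('n)) *\<^sub>R F z) G"
    by (simp add: q_form_def Dirac_H_eq add_ac)
  moreover have "Sc (a + b) = Sc a + Sc b" "Sc (r *\<^sub>R a) = r * Sc a" "Sc (sum h UNIV) = (\<Sum>i\<in>UNIV. Sc (h i))"
    for a b :: "'n cliff" and r and h :: "'n \<Rightarrow> 'n cliff" by (simp_all add: Sc_def)
  ultimately show ?thesis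
    unfolding form_eq[OF X Y] using f yy by (simp add: c Sc_inner2)
qed

lemma q_form_mult_basis:
  assumes F: "F \<in> cH10 \<Omega>" and G: "G \<in> cH10 \<Omega>"
  shows "q_form \<Omega> s F (\<lambda>z. G z \<odot> basis_e A) = q_form \<Omega> s F G \<odot> basis_e A"
proof -
  have c: "fst (cjet \<Omega> F z) = F z" "snd (cjet \<Omega> F z) $ i = cderiv \<Omega> i F z" for F z i by (simp_all add: cjet_def)
  have sq: "F \<in> sq_integrable \<mu>" "cderiv \<Omega> i F \<in> sq_integrable \<mu>" if "F \<in> cH10 \<Omega>" for F i
    using sq_integrable_fst[OF cjet_sq_integrable[OF that]]
      sq_integrable_vec_nth[OF sq_integrable_snd[OF cjet_sq_integrable[OF that]], of i] by (simp_all add: c)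
  note GA = cjet_mult_basis(1)[OF op G, of A] cjet_mult_basis(2)[OF op G, where A=A]
  have d: "inner2 \<Omega> P (cderiv \<Omega> i (\<lambda>z. G z \<odot> basis_e A)) = inner2 \<Omega> P (cderiv \<Omega> i G) \<odot> basis_e A"
    if "P \<in> sq_integrable \<mu>" for P i
    by (rule inner2_mult_right[OF that sq(2)[OF G] sq(2)[OF GA(1)] GA(2)])
  have z: "inner2 \<Omega> P (\<lambda>z. G z \<odot> basis_e A) = inner2 \<Omega> P G \<odot> basis_e A"
    if "P \<in> sq_integrable \<mu>" for P
    by (rule inner2_mult_right[OF that sq(1)[OF G] sq(1)[OF GA(1)]]) simp
  note f = form_summands[OF cjet_sq_integrable[OF F]]
  show ?thesis
    unfolding q_form_def using f
    by (simp add: c d z Dirac_H_eq cliff_mult_add_left cliff_mult_sum_left cliff_mult_scaleR_left)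
qed

lemma form_bounded:
  "\<exists>C. \<forall>X\<in>sq_integrable \<mu>. \<forall>Y\<in>sq_integrable \<mu>. \<bar>form s X Y\<bar> \<le> C * nrm2 \<mu> X * nrm2 \<mu> Y"
proof -
  obtain C where C: "C \<ge> 0" "\<And>y X Y. 0 \<le> y \<Longrightarrow> y \<le> M \<Longrightarrow> \<bar>form_symbol s y X Y\<bar> \<le> C * (norm X * norm Y)"
    using form_symbol_bounded[of M s] m_pos m_le_M by auto
  have "\<bar>form s X Y\<bar> \<le> C * nrm2 \<mu> X * nrm2 \<mu> Y" if X: "X \<in> sq_integrable \<mu>" and Y: "Y \<in> sq_integrable \<mu>" for X Y
  proof -
    have nX: "(\<lambda>z. norm (X z)) \<in> sq_integrable \<mu>" and nY: "(\<lambda>z. norm (Y z)) \<in> sq_integrable \<mu>"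
      using sq_integrableD[OF X] sq_integrableD[OF Y] by (simp_all add: sq_integrable_def)
    have "\<bar>form s X Y\<bar> \<le> (LINT z|\<mu>. norm (form_symbol s (ycoord z) (X z) (Y z)))"
      unfolding form_def using integral_norm_bound[of \<mu> "\<lambda>z. form_symbol s (ycoord z) (X z) (Y z)"] by simp
    also have "\<dots> \<le> (LINT z|\<mu>. C * (norm (X z) * norm (Y z)))"
    proof (rule integral_mono)
      show "integrable \<mu> (\<lambda>z. norm (form_symbol s (ycoord z) (X z) (Y z)))" using form_integrable[OF X Y] by simp
      show "integrable \<mu> (\<lambda>z. C * (norm (X z) * norm (Y z)))" using sq_integrable_inner[OF nX nY] by simp
      show "norm (form_symbol s (ycoord z) (X z) (Y z)) \<le> C * (norm (X z) * norm (Y z))" if "z \<in> space \<mu>" for z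
        using C(2)[of "ycoord z"] height_space[OF that] m_pos by simp
    qed
    also have "\<dots> = C * ip2 \<mu> (\<lambda>z. norm (X z)) (\<lambda>z. norm (Y z))" by (simp add: ip2_def)
    also have "\<dots> \<le> C * (nrm2 \<mu> (\<lambda>z. norm (X z)) * nrm2 \<mu> (\<lambda>z. norm (Y z)))"
      using sq.ip_bound[OF nX nY] C(1) by (intro mult_left_mono) auto
    also have "\<dots> = C * nrm2 \<mu> X * nrm2 \<mu> Y" by (simp add: nrm2_eq)
    finally show ?thesis .
  qed
  then show ?thesis by blast
qed

lemma form_coercive:
  assumes "0 < (norm s)\<^sup>2 - beta CARD('n)" and X: "X \<in> sq_integrable \<mu>"
  shows "K_const CARD('n) m M s * ip2 \<mu> X X \<le> form s X X"
proof -
  have "(LINT z|\<mu>. K_const CARD('n) m M s * (norm (X z))\<^sup>2) \<le> form s X X"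
    unfolding form_def
  proof (rule integral_mono)
    show "integrable \<mu> (\<lambda>z. K_const CARD('n) m M s * (norm (X z))\<^sup>2)" using sq_integrableD[OF X] by simp
    show "K_const CARD('n) m M s * (norm (X z))\<^sup>2 \<le> form_symbol s (ycoord z) (X z) (X z)" if "z \<in> space \<mu>" for z
      using form_symbol_coercive[OF m_pos, of "ycoord z" M s "X z"] height_space[OF that] assms(1) by simp
  qed (rule form_integrable[OF X X])
  then show ?thesis by (simp add: ip2_def power2_norm_eq_inner)
qed

lemma form_axpy_left:
  assumes "X \<in> sq_integrable \<mu>" "Y \<in> sq_integrable \<mu>" "Z \<in> sq_integrable \<mu>"
  shows "form s (axpy X c Y) Z = form s X Z + c * form s Y Z"
  using assms unfolding form_def axpy_def form_symbol_axpy_left by (simp add: form_integrable)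

lemma form_axpy_right:
  assumes "X \<in> sq_integrable \<mu>" "Y \<in> sq_integrable \<mu>" "Z \<in> sq_integrable \<mu>"
  shows "form s Z (axpy X c Y) = form s Z X + c * form s Z Y"
  using assms unfolding form_def axpy_def form_symbol_axpy_right by (simp add: form_integrable)

text \<open>Lax--Milgram on the space of jets solves the scalar part of the equation. All coordinates of the
  equation follow, because \<open>G e\<^sub>A\<close> is an admissible test function along with \<open>G\<close>.\<close>

lemma weak_solution_exists:
  assumes K: "0 < K_const CARD('n) m M s" and pos: "0 < (norm s)\<^sup>2 - beta CARD('n)" and f: "f \<in> L2 \<Omega>"
  shows "\<exists>F. weak_solution \<Omega> s f F"
proof -
  interpret H: hilbert_space_on "jet_space \<Omega>" "ip2 \<mu>" by (rule hilbert_jet_space[OF op])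
  have sub: "X \<in> sq_integrable \<mu>" if "X \<in> jet_space \<Omega>" for X using that by (simp add: jet_space_def)
  have fL: "f \<in> sq_integrable \<mu>" using f by (simp add: L2_eq)
  define l where "l X = ip2 \<mu> f (\<lambda>z. fst (X z))" for X :: "'n pt \<Rightarrow> 'n cliff \<times> ('n cliff, 'n) vec"
  obtain C where C: "\<And>X Y. X \<in> sq_integrable \<mu> \<Longrightarrow> Y \<in> sq_integrable \<mu> \<Longrightarrow> \<bar>form s X Y\<bar> \<le> C * nrm2 \<mu> X * nrm2 \<mu> Y"
    using form_bounded[of s] by blast
  have llin: "l (axpy X c Y) = l X + c * l Y" if "X \<in> jet_space \<Omega>" "Y \<in> jet_space \<Omega>" for X Y c
  proof -
    have "(\<lambda>z. fst (axpy X c Y z)) = axpy (\<lambda>z. fst (X z)) c (\<lambda>z. fst (Y z))" by (simp add: axpy_def)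
    then show ?thesis unfolding l_def using sq.ip_axpy_right sq_integrable_fst[OF sub] that fL by metis
  qed
  have lbd: "\<bar>l X\<bar> \<le> nrm2 \<mu> f * nrm2 \<mu> X" if "X \<in> jet_space \<Omega>" for X
  proof -
    note X = sub[OF that]
    have "nrm2 \<mu> (\<lambda>z. fst (X z)) \<le> 1 * nrm2 \<mu> X"
      by (rule nrm2_bound[OF X sq_integrableD(1)[OF sq_integrable_fst[OF X]]]) (simp_all add: norm_fst_le')
    then have "nrm2 \<mu> f * nrm2 \<mu> (\<lambda>z. fst (X z)) \<le> nrm2 \<mu> f * nrm2 \<mu> X"
      using sq.nrm_nonneg[OF fL] by (intro mult_left_mono) auto
    then show ?thesis unfolding l_def using sq.ip_bound[OF fL sq_integrable_fst[OF X]] by linarith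
  qed
  obtain X where X: "X \<in> jet_space \<Omega>" "\<And>Y. Y \<in> jet_space \<Omega> \<Longrightarrow> form s X Y = l Y"
  proof (rule H.lax_milgram[of "form s" C "K_const CARD('n) m M s" l "nrm2 \<mu> f"])
    show "K_const CARD('n) m M s * ip2 \<mu> X X \<le> form s X X" if "X \<in> jet_space \<Omega>" for X
      by (rule form_coercive[OF pos sub[OF that]])
  qed (use K sub C llin lbd form_axpy_left form_axpy_right in auto)
  obtain F where F: "F \<in> cH10 \<Omega>" "AE z in \<mu>. X z = cjet \<Omega> F z" using X(1) by (auto simp: jet_space_def)
  have sc: "Sc (q_form \<Omega> s F G) = Sc (inner2 \<Omega> f G)" if G: "G \<in> cH10 \<Omega>" for G
  proof -
    note J = cjet_sq_integrable[OF F(1)] and JG = cjet_sq_integrable[OF G]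
    have "form s (cjet \<Omega> F) (cjet \<Omega> G) = form s X (cjet \<Omega> G)"
      unfolding form_def
    proof (rule integral_cong_AE)
      show "AE z in \<mu>. form_symbol s (ycoord z) (cjet \<Omega> F z) (cjet \<Omega> G z) = form_symbol s (ycoord z) (X z) (cjet \<Omega> G z)"
        using F(2) by eventually_elim simp
    qed (use form_integrable[OF J JG] form_integrable[OF sub[OF X(1)] JG] in auto)
    also have "\<dots> = l (cjet \<Omega> G)" by (rule X(2)[OF cjet_in_jet_space[OF G]])
    also have "\<dots> = ip2 \<mu> f G" by (simp add: l_def cjet_def)
    also have "\<dots> = Sc (inner2 \<Omega> f G)"
      using Sc_inner2[OF fL, of G] sq_integrable_fst[OF JG] by (simp add: cjet_def)
    finally show ?thesis by (simp add: Sc_q_form[OF F(1) G])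
  qed
  have "q_form \<Omega> s F G = inner2 \<Omega> f G" if G: "G \<in> cH10 \<Omega>" for G
  proof (rule cliff_eqI)
    fix A
    note GA = cjet_mult_basis(1)[OF op G, of A]
    have G': "G \<in> sq_integrable \<mu>" "(\<lambda>z. G z \<odot> basis_e A) \<in> sq_integrable \<mu>"
      using sq_integrable_fst[OF cjet_sq_integrable[OF G]] sq_integrable_fst[OF cjet_sq_integrable[OF GA]]
      by (simp_all add: cjet_def)
    have "inner2 \<Omega> f (\<lambda>z. G z \<odot> basis_e A) = inner2 \<Omega> f G \<odot> basis_e A"
      by (rule inner2_mult_right[OF fL G']) simp
    then show "Sc (q_form \<Omega> s F G \<odot> basis_e A) = Sc (inner2 \<Omega> f G \<odot> basis_e A)"
      using sc[OF GA] q_form_mult_basis[OF F(1) G, of s A] by simp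
  qed
  then show ?thesis using F(1) by (auto simp: weak_solution_def)
qed

lemma weak_solution_bound:
  assumes K: "0 < K_const CARD('n) m M s" and pos: "0 < (norm s)\<^sup>2 - beta CARD('n)" and f: "f \<in> L2 \<Omega>"
    and sol: "weak_solution \<Omega> s f F"
  shows "K_const CARD('n) m M s * nrm2 \<mu> (cjet \<Omega> F) \<le> nrm2 \<mu> f"
proof -
  have F: "F \<in> cH10 \<Omega>" and eq: "q_form \<Omega> s F F = inner2 \<Omega> f F" using sol by (auto simp: weak_solution_def)
  note J = cjet_sq_integrable[OF F]
  have fL: "f \<in> sq_integrable \<mu>" using f by (simp add: L2_eq)
  have FL: "F \<in> sq_integrable \<mu>" using sq_integrable_fst[OF J] by (simp add: cjet_def)
  define N where "N = nrm2 \<mu> (cjet \<Omega> F)"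
  have N: "0 \<le> N" by (simp add: N_def sq.nrm_nonneg J)
  have FN: "nrm2 \<mu> F \<le> 1 * N" unfolding N_def
    by (rule nrm2_bound[OF J sq_integrableD(1)[OF FL]]) (simp_all add: cjet_def norm_prod_def)
  have "K_const CARD('n) m M s * N\<^sup>2 \<le> form s (cjet \<Omega> F) (cjet \<Omega> F)"
    using form_coercive[OF pos J] by (simp add: N_def sq.nrm_sq J)
  also have "\<dots> = ip2 \<mu> f F" by (simp add: Sc_inner2 fL FL eq flip: Sc_q_form[OF F F])
  also have "\<dots> \<le> nrm2 \<mu> f * nrm2 \<mu> F" using sq.ip_bound[OF fL FL] by simp
  also have "\<dots> \<le> nrm2 \<mu> f * N" using FN sq.nrm_nonneg[OF fL] by (intro mult_left_mono) auto
  finally have "K_const CARD('n) m M s * N * N \<le> nrm2 \<mu> f * N" by (simp add: power2_eq_square mult.assoc)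
  then have "K_const CARD('n) m M s * N \<le> nrm2 \<mu> f"
    using N sq.nrm_nonneg[OF fL] by (cases "N = 0") (auto simp: mult_le_cancel_right)
  then show ?thesis by (simp add: N_def)
qed

text \<open>The bound holds for every weak solution, so the choice of a representative does not matter.\<close>

lemma S_resolvent_bound:
  assumes s: "s \<in> paravectors" and K: "0 < K_const CARD('n) m M s" and pos: "0 < (norm s)\<^sup>2 - beta CARD('n)"
    and f: "f \<in> L2 \<Omega>"
  shows "SR_inv \<Omega> s f \<in> L2 \<Omega>"
    "norm2 \<Omega> (SR_inv \<Omega> s f)
       \<le> (norm s + alpha CARD('n) + M * sqrt (real CARD('n))) * (1 / K_const CARD('n) m M s) * norm2 \<Omega> f"
proof -
  define F where "F = Q_inv \<Omega> s f"
  define c where "c = norm s + alpha CARD('n) + M * sqrt (real CARD('n))"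
  have c: "0 \<le> c" using m_pos m_le_M alpha_nonneg[where 'n='n] by (simp add: c_def)
  have sol: "weak_solution \<Omega> s f F"
    unfolding F_def Q_inv_def by (rule someI_ex[OF weak_solution_exists[OF K pos f]])
  then have F: "F \<in> cH10 \<Omega>" by (simp add: weak_solution_def)
  note J = cjet_sq_integrable[OF F]
  have fL: "f \<in> sq_integrable \<mu>" using f by (simp add: L2_eq)
  have FL: "F \<in> sq_integrable \<mu>" using sq_integrable_fst[OF J] by (simp add: cjet_def)
  have "axpy (\<lambda>z. cliff_conj s \<odot> F z) (-1) (\<lambda>z. dirac_symbol (ycoord z) (cjet \<Omega> F z)) \<in> sq_integrable \<mu>"
    by (intro sq_integrable_axpy dirac_sq_integrable J
        sq_integrable_linear[OF bounded_linear.linear[OF cliff.bounded_linear_right] FL])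
  then have SL: "SR_inv \<Omega> s f \<in> sq_integrable \<mu>"
    by (simp add: axpy_def SR_inv_def[abs_def] F_def Dirac_H_eq)
  then show "SR_inv \<Omega> s f \<in> L2 \<Omega>" by (simp add: L2_eq)
  have "norm (SR_inv \<Omega> s f z) \<le> c * norm (cjet \<Omega> F z)" if "z \<in> space \<mu>" for z
  proof -
    define x where "x = norm (fst (cjet \<Omega> F z))"
    define p where "p = norm (snd (cjet \<Omega> F z))"
    have y: "0 \<le> ycoord z" "ycoord z \<le> M" using height_space[OF that] m_pos by auto
    have "norm (SR_inv \<Omega> s f z) \<le> norm (cliff_conj s \<odot> F z) + norm (dirac_symbol (ycoord z) (cjet \<Omega> F z))"
      unfolding SR_inv_def F_def Dirac_H_eq by (rule norm_triangle_ineq4)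
    also have "\<dots> \<le> norm s * x + (ycoord z * (sqrt (real CARD('n)) * p) + alpha CARD('n) * x)"
      using norm_dirac_symbol[OF y(1), of "cjet \<Omega> F z"] norm_paravector_mult[OF conj_paravector[OF s], of "F z"]
      by (simp add: norm_cliff_conj x_def p_def) (simp add: cjet_def)
    also have "\<dots> \<le> norm s * norm (cjet \<Omega> F z) + (M * (sqrt (real CARD('n)) * norm (cjet \<Omega> F z)) + alpha CARD('n) * norm (cjet \<Omega> F z))"
      using y norm_fst_le'[of "cjet \<Omega> F z"] norm_snd_le'[of "cjet \<Omega> F z"] alpha_nonneg[where 'n='n]
      by (intro add_mono mult_mono mult_nonneg_nonneg) (auto simp: x_def p_def)
    also have "\<dots> = c * norm (cjet \<Omega> F z)" by (simp add: c_def algebra_simps)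
    finally show ?thesis .
  qed
  then have "AE z in \<mu>. norm (SR_inv \<Omega> s f z) \<le> c * norm (cjet \<Omega> F z)" by (intro AE_I2)
  then have "nrm2 \<mu> (SR_inv \<Omega> s f) \<le> c * nrm2 \<mu> (cjet \<Omega> F)"
    by (rule nrm2_bound[OF J sq_integrableD(1)[OF SL] _ c])
  also have "\<dots> \<le> c * (1 / K_const CARD('n) m M s * nrm2 \<mu> f)"
    using weak_solution_bound[OF K pos f sol] K c by (intro mult_left_mono) (simp_all add: field_simps)
  finally show "norm2 \<Omega> (SR_inv \<Omega> s f) \<le> (norm s + alpha CARD('n) + M * sqrt (real CARD('n))) * (1 / K_const CARD('n) m M s) * norm2 \<Omega> f"
    using SL fL by (simp add: norm2_eq c_def)
qed

end

section \<open>The constant of the estimate\<close>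

text \<open>If \<open>|s|\<^sup>2 \<le> \<beta>\<^sub>n\<close>, then \<open>m\<^sup>2 ||s|\<^sup>2 - \<beta>\<^sub>n| \<le> M\<^sup>2 \<beta>\<^sub>n \<le> M\<^sup>2 (1 + \<alpha>\<^sub>n)\<^sup>2\<close>, against the hypothesis.\<close>

lemma norm_exceeds_beta:
  fixes s :: "'n::finite cliff"
  assumes "n \<ge> 1" "0 < m" "m < M"
    and "4 * m\<^sup>2 * \<bar>(norm s)\<^sup>2 - beta n\<bar> - 4 * real n * M\<^sup>2 * (Sc s)\<^sup>2
           - 4 * (m\<^sup>2 * alpha n + M\<^sup>2 * (1 + alpha n) * sqrt (real n)) * sqrt (1 + 4 * (Sc s)\<^sup>2)
         > M\<^sup>2 * (4 * (1 + alpha n)\<^sup>2 + real n)"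
  shows "0 < (norm s)\<^sup>2 - beta n"
proof (rule ccontr)
  assume "\<not> ?thesis"
  then have "\<bar>(norm s)\<^sup>2 - beta n\<bar> \<le> beta n" by simp
  have a: "0 \<le> alpha n" using assms(1) by (simp add: alpha_def)
  have "beta n \<le> (1 + alpha n)\<^sup>2" using a by (simp add: beta_def power2_eq_square algebra_simps)
  with \<open>\<bar>(norm s)\<^sup>2 - beta n\<bar> \<le> beta n\<close> have "\<bar>(norm s)\<^sup>2 - beta n\<bar> \<le> (1 + alpha n)\<^sup>2" by simp
  moreover have "m\<^sup>2 \<le> M\<^sup>2" using assms by (intro power_mono) auto
  ultimately have "m\<^sup>2 * \<bar>(norm s)\<^sup>2 - beta n\<bar> \<le> M\<^sup>2 * (1 + alpha n)\<^sup>2" by (intro mult_mono) auto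
  moreover have "0 \<le> 4 * real n * M\<^sup>2 * (Sc s)\<^sup>2" by simp
  moreover have "0 \<le> 4 * (m\<^sup>2 * alpha n + M\<^sup>2 * (1 + alpha n) * sqrt (real n)) * sqrt (1 + 4 * (Sc s)\<^sup>2)"
    using a by (intro mult_nonneg_nonneg add_nonneg_nonneg) auto
  moreover have "0 \<le> M\<^sup>2 * real n" by simp
  moreover have "M\<^sup>2 * (4 * (1 + alpha n)\<^sup>2 + real n) = 4 * (M\<^sup>2 * (1 + alpha n)\<^sup>2) + M\<^sup>2 * real n"
    by (simp add: algebra_simps)
  ultimately show False using assms(4) by linarith
qed

text \<open>With \<open>a\<close> and \<open>c\<close> as in the constant and \<open>b = m\<^sup>2\<close>, the hypotheses are \<open>a + b > 0\<close> and
  \<open>4 a b > c\<^sup>2\<close>, the latter after expanding the square \<open>c\<^sup>2\<close>.\<close>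

lemma K_const_pos:
  fixes s :: "'n::finite cliff"
  assumes "\<bar>(norm s)\<^sup>2 - beta n\<bar> - alpha n * sqrt (1 + 4 * (Sc s)\<^sup>2) + m\<^sup>2 > 0"
    and "4 * m\<^sup>2 * \<bar>(norm s)\<^sup>2 - beta n\<bar> - 4 * real n * M\<^sup>2 * (Sc s)\<^sup>2
           - 4 * (m\<^sup>2 * alpha n + M\<^sup>2 * (1 + alpha n) * sqrt (real n)) * sqrt (1 + 4 * (Sc s)\<^sup>2)
         > M\<^sup>2 * (4 * (1 + alpha n)\<^sup>2 + real n)"
  shows "0 < K_const n m M s"
proof -
  define t where "t = sqrt (1 + 4 * (Sc s)\<^sup>2)"
  define q where "q = sqrt (real n)"
  define \<alpha> where "\<alpha> = alpha n"
  define A where "A = \<bar>(norm s)\<^sup>2 - beta n\<bar>"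
  define a where "a = A - \<alpha> * t"
  have t2: "t\<^sup>2 = 1 + 4 * (Sc s)\<^sup>2" by (simp add: t_def)
  have q2: "q\<^sup>2 = real n" by (simp add: q_def)
  have "M\<^sup>2 * (2 * (1 + \<alpha>) + q * t)\<^sup>2 = M\<^sup>2 * (4 * (1 + \<alpha>)\<^sup>2) + 4 * M\<^sup>2 * (1 + \<alpha>) * q * t + M\<^sup>2 * (q\<^sup>2 * t\<^sup>2)"
    by (simp add: power2_eq_square algebra_simps)
  also have "M\<^sup>2 * (q\<^sup>2 * t\<^sup>2) = M\<^sup>2 * real n + 4 * real n * M\<^sup>2 * (Sc s)\<^sup>2"
    by (simp add: t2 q2 algebra_simps)
  finally have "M\<^sup>2 * (2 * (1 + \<alpha>) + q * t)\<^sup>2 < 4 * a * m\<^sup>2"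
    using assms(2) unfolding t_def[symmetric] q_def[symmetric] \<alpha>_def[symmetric] A_def[symmetric] a_def
    by (simp add: algebra_simps)
  then have "(a - m\<^sup>2)\<^sup>2 + M\<^sup>2 * (2 * (1 + \<alpha>) + q * t)\<^sup>2 < (a + m\<^sup>2)\<^sup>2"
    by (simp add: power2_sum power2_diff)
  moreover have "0 \<le> a + m\<^sup>2" using assms(1) by (simp add: a_def A_def \<alpha>_def t_def)
  ultimately have "sqrt ((a - m\<^sup>2)\<^sup>2 + M\<^sup>2 * (2 * (1 + \<alpha>) + q * t)\<^sup>2) < a + m\<^sup>2"
    by (intro real_less_lsqrt) auto
  then show ?thesis
    unfolding K_const_def t_def[symmetric] q_def[symmetric] \<alpha>_def[symmetric] A_def[symmetric] a_def by linarith
qed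

theorem corollary4p9:
  fixes \<Omega> :: "'n::{finite,linorder} pt set"
    and n :: nat and m M :: real and s :: "'n cliff"
  assumes "n = CARD('n)" and "n \<ge> 2"
    and "open \<Omega>" and "\<Omega> \<noteq> {}" and "\<Omega> \<subseteq> {z. 0 < ycoord z}" and "smooth_boundary \<Omega>"
    and "bdd_above (ycoord ` \<Omega>)"
    and "m = (INF z\<in>\<Omega>. ycoord z)" and "M = (SUP z\<in>\<Omega>. ycoord z)"
    and "0 < m" and "m < M"
    and "s \<in> paravectors"
    and "(norm s)\<^sup>2 - beta n \<noteq> 0"
    and "\<bar>(norm s)\<^sup>2 - beta n\<bar> - alpha n * sqrt (1 + 4 * (Sc s)\<^sup>2) + m\<^sup>2 > 0"
    and "4 * m\<^sup>2 * \<bar>(norm s)\<^sup>2 - beta n\<bar> - 4 * real n * M\<^sup>2 * (Sc s)\<^sup>2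
           - 4 * (m\<^sup>2 * alpha n + M\<^sup>2 * (1 + alpha n) * sqrt (real n)) * sqrt (1 + 4 * (Sc s)\<^sup>2)
         > M\<^sup>2 * (4 * (1 + alpha n)\<^sup>2 + real n)"
  shows "\<forall>f \<in> L2 \<Omega>. SR_inv \<Omega> s f \<in> L2 \<Omega> \<and>
           norm2 \<Omega> (SR_inv \<Omega> s f)
             \<le> (norm s + alpha n + M * sqrt (real n)) * (1 / K_const n m M s) * norm2 \<Omega> f"
proof -
  have "bdd_below (ycoord ` \<Omega>)" using assms(5) by (intro bdd_belowI[of _ 0]) auto
  then have "m \<le> ycoord z" "ycoord z \<le> M" if "z \<in> \<Omega>" for z
    using that assms(7) unfolding assms(8,9) by (auto intro: cINF_lower cSUP_upper)
  then interpret bounded_height_domain \<Omega> m M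
    using assms(3,10,11) by unfold_locales auto
  have "0 < K_const n m M s" by (rule K_const_pos[OF assms(14,15)])
  moreover have "0 < (norm s)\<^sup>2 - beta n" using assms(2,10,11,15) by (intro norm_exceeds_beta) auto
  ultimately show ?thesis using S_resolvent_bound[OF assms(12)] unfolding assms(1) by blast
qed

end
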